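(* Let $\lambda,\mu$ be partitions and let $r\ge 1$ be an integer with $r\ge\ell(\lambda)$ and $r\ge \ell(\mu)$ (set $\lambda_i=0$ for $i>\ell(\lambda)$, $\mu_j=0$ for $j>\ell(\mu)$). Then $$G_{\lambda/\!\!/\mu}(x)=\det\left(\sum_{n=0}^\infty\left\{\binom{i-j+1}{n}-\Delta_{i,j}(n)\right\}\beta^n\,G_{\lambda_i-\mu_j-i+j+n}(x)\right)_{1\le i,j\le r},$$ where $$\Delta_{i,j}(n)=\begin{cases}\binom{i-r}{-1-r+j+n},&\mu_j=0,\\ 0,&\mu_j>0.\end{cases}$$
   Context: $k=\mathbb{C}(\beta)$; $\Lambda$ is the $k$-algebra of symmetric functions in $x=(x_1,x_2,\dots)$, with Schur functions $s_\lambda$ and Hall inner product $\langle s_\lambda,s_\mu\rangle=\delta_{\lambda,\mu}$. $I_n=\mathrm{span}_k\{s_\lambda:\ell(\lambda)>n\}$ and $\widehat\Lambda=\varprojlim\Lambda/I_n$; elements of $\widehat\Lambda$ are formal sums $\sum c_\lambda s_\lambda$ such that for every $n$ only finitely many $\lambda$ with $\ell(\lambda)\le n$ have $c_\lambda\neq0$. The Hall product extends to $\widehat\Lambda\times\Lambda\to k$. For $f\in\Lambda$, $f^\perp:\widehat\Lambda\to\widehat\Lambda$ is defined by $\langle f^\perp g,h\rangle=\langle g,fh\rangle$ for all $h\in\Lambda$. The stable Grothendieck polynomial $G_\lambda(x)\in\widehat\Lambda$ is the unique element such that for all $n\ge\ell(\lambda)$, $G_\lambda(x_1,\dots,x_n,0,0,\dots)=\det\bigl(x_i^{\lambda_j+n-j}(1+\beta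 x_i)^{j-1}\bigr)_{1\le i,j\le n}/\prod_{1\le i<j\le n}(x_i-x_j)$. The dual stable Grothendieck polynomials $g_\mu\in\Lambda$ are determined by $\langle G_\lambda,g_\mu\rangle=\delta_{\lambda,\mu}$, and $G_{\lambda/\!\!/\mu}=g_\mu^\perp G_\lambda$ (equivalently $G_\lambda(x,y)=\sum_\mu G_\mu(x)G_{\lambda/\!\!/\mu}(y)$). For $m\in\mathbb Z$, $G_m(x)$ is the coefficient of $z^m$ in $\frac{1}{1+\beta z^{-1}}\prod_{l\ge1}\frac{1+\beta x_l}{1-x_lz}$, with $\frac1{1+\beta z^{-1}}$ expanded in powers of $z^{-1}$; thus $G_m=G_{(m)}$ for $m\ge1$ and $G_m=(-\beta)^{-m}$ for $m\le0$. Binomials: $\binom{a}{n}=a(a-1)\cdots(a-n+1)/n!$ for $a\in\mathbb Z,\ n\ge0$, and $\binom an=0$ for $n<0$. The infinite sums converge as formal power series in $x_1,x_2,\dots$ (for $m\ge1$, $G_m$ has no terms of degree less than $m$). *)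

theory Defs
  imports
    "HOL-Library.Multiset"
    "HOL-Computational_Algebra.Fraction_Field"
    "HOL-Computational_Algebra.Polynomial"
    "HOL-Computational_Algebra.Formal_Power_Series"
    "HOL-Analysis.Infinite_Sum"
    "Jordan_Normal_Form.Determinant"
begin

section \<open>Formal power series in countably many variables\<close>

text \<open>
  A monomial is a finite multiset of variable indices. The variables are indexed from 0:
  the index l stands for the variable usually written with the subscript l + 1.
\<close>

typedef 'a mps = "UNIV :: (nat multiset \<Rightarrow> 'a) set"
  morphisms mps_coeff Abs_mps ..

lemma mps_coeff_Abs [simp]: "mps_coeff (Abs_mps f) M = f M"
  by (simp add: Abs_mps_inverse)

lemma mps_eqI: "(\<And>M. mps_coeff f M = mps_coeff g M) \<Longrightarrow> f = g"
  by (metis ext mps_coeff_inverse)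

lemma mps_eq_iff: "f = g \<longleftrightarrow> (\<forall>M. mps_coeff f M = mps_coeff g M)"
  using mps_eqI by blast

lemma double_diff_mset: "A \<subseteq># M \<Longrightarrow> M - (M - A) = (A :: 'v multiset)"
  by (rule multiset_eqI) (simp add: subseteq_mset_def)

lemma mset_subset_eq_mono_diff: "A \<subseteq># M \<Longrightarrow> A - B \<subseteq># M - (B :: 'v multiset)"
  by (simp add: subseteq_mset_def diff_le_mono)

lemma finite_submultisets: "finite {A. A \<subseteq># (M :: 'v multiset)}"
proof (induction M)
  case (add x M)
  have "{A. A \<subseteq># add_mset x M} \<subseteq> {A. A \<subseteq># M} \<union> add_mset x ` {A. A \<subseteq># M}"
  proof
    fix A assume "A \<in> {A. A \<subseteq># add_mset x M}"
    then have A: "A \<subseteq># add_mset x M" by simp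
    show "A \<in> {A. A \<subseteq># M} \<union> add_mset x ` {A. A \<subseteq># M}"
    proof (cases "x \<in># A")
      case True
      then obtain B where B: "A = add_mset x B" by (blast dest: multi_member_split)
      with A show ?thesis by auto
    next
      case False
      have "A \<subseteq># M"
      proof (rule mset_subset_eqI)
        fix y
        show "count A y \<le> count M y"
          using mset_subset_eq_count[OF A, of y] False
          by (cases "y = x") (auto simp: not_in_iff)
      qed
      then show ?thesis by simp
    qed
  qed
  then show ?case using add.IH by (meson finite_UnI finite_imageI finite_subset)
qed simp

instantiation mps :: (comm_ring_1) comm_ring_1
begin

definition zero_mps_def: "0 = Abs_mps (\<lambda>_. 0)"
definition one_mps_def: "1 = Abs_mps (\<lambda>M. if M = {#} then 1 else 0)"
definition plus_mps_def: "f + g = Abs_mps (\<lambda>M. mps_coeff f M + mps_coeff g M)"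
definition minus_mps_def: "f - g = Abs_mps (\<lambda>M. mps_coeff f M - mps_coeff g M)"
definition uminus_mps_def: "- f = Abs_mps (\<lambda>M. - mps_coeff f M)"
definition times_mps_def:
  "f * g = Abs_mps (\<lambda>M. \<Sum>A | A \<subseteq># M. mps_coeff f A * mps_coeff g (M - A))"

instance
proof
  fix f g h :: "'a mps"
  have comm: "f * g = g * f" for f g :: "'a mps"
    unfolding times_mps_def
    by (rule mps_eqI, simp, rename_tac M,
        rule_tac i = "\<lambda>A. M - A" and j = "\<lambda>A. M - A" in sum.reindex_bij_witness)
       (auto simp: mult.commute double_diff_mset)
  show "f * g = g * f" by (rule comm)
  show "f * g * h = f * (g * h)"
  proof (rule mps_eqI)
    fix M
    have "mps_coeff (f * g * h) M =
      (\<Sum>A | A \<subseteq># M. \<Sum>B | B \<subseteq># A. mps_coeff f B * mps_coeff g (A - B) * mps_coeff h (M - A))"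
      by (simp add: times_mps_def sum_distrib_right)
    also have "\<dots> = (\<Sum>(A, B)\<in>(SIGMA A:{A. A \<subseteq># M}. {B. B \<subseteq># A}).
        mps_coeff f B * mps_coeff g (A - B) * mps_coeff h (M - A))"
      by (rule sum.Sigma) (auto simp: finite_submultisets)
    also have "\<dots> = (\<Sum>(B, C)\<in>(SIGMA B:{B. B \<subseteq># M}. {C. C \<subseteq># M - B}).
        mps_coeff f B * (mps_coeff g C * mps_coeff h (M - B - C)))"
    proof (rule sum.reindex_bij_witness
        [where i = "\<lambda>(B, C). (B + C, B)" and j = "\<lambda>(A, B). (B, A - B)"], goal_cases)
      case (2 a)
      then show ?case
        by (auto intro: subset_mset.order_trans simp: mset_subset_eq_mono_diff)
    next
      case (4 b)
      then show ?case
        by (auto simp: subset_mset.le_diff_conv2 add.commute)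
    next
      case (5 a)
      then obtain A B where "a = (A, B)" "B \<subseteq># A" by auto
      moreover have "M - B - (A - B) = M - A"
        using \<open>B \<subseteq># A\<close> by (simp add: subset_mset.add_diff_inverse)
      ultimately show ?case
        by (simp add: mult.assoc)
    qed auto
    also have "\<dots> = (\<Sum>B | B \<subseteq># M. \<Sum>C | C \<subseteq># M - B.
        mps_coeff f B * (mps_coeff g C * mps_coeff h (M - B - C)))"
      by (rule sum.Sigma[symmetric]) (auto simp: finite_submultisets)
    also have "\<dots> = mps_coeff (f * (g * h)) M"
      by (simp add: times_mps_def sum_distrib_left)
    finally show "mps_coeff (f * g * h) M = mps_coeff (f * (g * h)) M" .
  qed
  show "1 * f = f"
  proof (rule mps_eqI)
    fix M
    have "mps_coeff (1 * f) M
        = (\<Sum>A | A \<subseteq># M. if A = {#} then mps_coeff f (M - A) else 0)"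
      by (auto simp: times_mps_def one_mps_def intro!: sum.cong)
    also have "\<dots> = mps_coeff f M"
      by (subst sum.delta) (auto simp: finite_submultisets)
    finally show "mps_coeff (1 * f) M = mps_coeff f M" .
  qed
  show "(f + g) * h = f * h + g * h"
    by (rule mps_eqI) (simp add: times_mps_def plus_mps_def distrib_right sum.distrib)
  have "mps_coeff (0 :: 'a mps) {#} \<noteq> mps_coeff 1 {#}"
    by (simp add: zero_mps_def one_mps_def)
  then show "(0 :: 'a mps) \<noteq> 1" by metis
  show "f + g + h = f + (g + h)" "f + g = g + f" "0 + f = f" "- f + f = 0" "f - g = f + - g"
    by (rule mps_eqI, simp add: plus_mps_def minus_mps_def uminus_mps_def zero_mps_def
        add.assoc add.commute)+
qed

end

definition mps_const :: "'a \<Rightarrow> 'a::zero mps" where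
  "mps_const c = Abs_mps (\<lambda>M. if M = {#} then c else 0)"

definition mps_var :: "nat \<Rightarrow> 'a::zero_neq_one mps" where
  "mps_var l = Abs_mps (\<lambda>M. if M = {#l#} then 1 else 0)"

text \<open>The substitution that puts 0 for all but the first n variables.\<close>

definition mps_restrict :: "nat \<Rightarrow> 'a::zero mps \<Rightarrow> 'a mps" where
  "mps_restrict n f = Abs_mps (\<lambda>M. if set_mset M \<subseteq> {..<n} then mps_coeff f M else 0)"

text \<open>
  Convergence of formal power series is coefficientwise: the topology is the product of the
  discrete topologies on the coefficients.
\<close>

instantiation mps :: (type) t2_space
begin

definition open_mps_def:
  "open (U :: 'a mps set) \<longleftrightarrow>
    (\<forall>f\<in>U. \<exists>S. finite S \<and> {g. \<forall>M\<in>S. mps_coeff g M = mps_coeff f M} \<subseteq> U)"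

instance
proof
  show "open (UNIV :: 'a mps set)"
    unfolding open_mps_def by (auto intro: exI[of _ "{}"])
  fix U V :: "'a mps set"
  assume U: "open U" and V: "open V"
  show "open (U \<inter> V)"
    unfolding open_mps_def
  proof
    fix f assume "f \<in> U \<inter> V"
    then obtain S T where "finite S" "{g. \<forall>M\<in>S. mps_coeff g M = mps_coeff f M} \<subseteq> U"
      "finite T" "{g. \<forall>M\<in>T. mps_coeff g M = mps_coeff f M} \<subseteq> V"
      using U V unfolding open_mps_def by (meson IntD1 IntD2)
    then show "\<exists>S. finite S \<and> {g. \<forall>M\<in>S. mps_coeff g M = mps_coeff f M} \<subseteq> U \<inter> V"
      by (intro exI[of _ "S \<union> T"]) auto
  qed
next
  fix \<U> :: "'a mps set set"
  assume \<U>: "\<forall>U\<in>\<U>. open U"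
  show "open (\<Union>\<U>)"
    unfolding open_mps_def
  proof
    fix f assume "f \<in> \<Union>\<U>"
    then obtain U where U: "U \<in> \<U>" "f \<in> U" by blast
    with \<U> obtain S where "finite S" "{g. \<forall>M\<in>S. mps_coeff g M = mps_coeff f M} \<subseteq> U"
      unfolding open_mps_def by meson
    with U show "\<exists>S. finite S \<and> {g. \<forall>M\<in>S. mps_coeff g M = mps_coeff f M} \<subseteq> \<Union>\<U>"
      by blast
  qed
next
  fix f g :: "'a mps"
  assume "f \<noteq> g"
  then obtain M where M: "mps_coeff f M \<noteq> mps_coeff g M"
    by (auto simp: mps_eq_iff)
  have "open {h. mps_coeff h M = c}" for c :: 'a
    unfolding open_mps_def by (auto intro!: exI[of _ "{M}"])
  with M show "\<exists>U V. open U \<and> open V \<and> f \<in> U \<and> g \<in> V \<and> U \<inter> V = {}"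
    by (intro exI[of _ "{h. mps_coeff h M = mps_coeff f M}"]
        exI[of _ "{h. mps_coeff h M = mps_coeff g M}"]) auto
qed

end

lemma tendsto_mps_iff:
  "(X \<longlongrightarrow> (f :: 'a mps)) F \<longleftrightarrow> (\<forall>M. \<forall>\<^sub>F n in F. mps_coeff (X n) M = mps_coeff f M)"
proof
  assume X: "(X \<longlongrightarrow> f) F"
  show "\<forall>M. \<forall>\<^sub>F n in F. mps_coeff (X n) M = mps_coeff f M"
  proof
    fix M
    have "open {h. mps_coeff h M = mps_coeff f M}"
      unfolding open_mps_def by (auto intro!: exI[of _ "{M}"])
    from topological_tendstoD[OF X this]
    show "\<forall>\<^sub>F n in F. mps_coeff (X n) M = mps_coeff f M" by simp
  qed
next
  assume X: "\<forall>M. \<forall>\<^sub>F n in F. mps_coeff (X n) M = mps_coeff f M"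
  show "(X \<longlongrightarrow> f) F"
  proof (rule topological_tendstoI)
    fix U assume "open U" "f \<in> U"
    then obtain S where S: "finite S" "{g. \<forall>M\<in>S. mps_coeff g M = mps_coeff f M} \<subseteq> U"
      unfolding open_mps_def by meson
    have "\<forall>\<^sub>F n in F. \<forall>M\<in>S. mps_coeff (X n) M = mps_coeff f M"
      using S(1) X by (simp add: eventually_ball_finite)
    then show "\<forall>\<^sub>F n in F. X n \<in> U"
      by eventually_elim (use S(2) in auto)
  qed
qed

section \<open>The ground field, partitions, 1-based matrices\<close>

instance fract :: ("{idom, ring_char_0}") field_char_0
proof
  show "inj (of_nat :: nat \<Rightarrow> 'a fract)"
    by (auto simp: inj_on_def of_nat_fract eq_fract)
qed

type_synonym K = "complex poly fract"

definition beta :: K where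
  "beta = Fraction_Field.Fract [:0, 1:] 1"

text \<open>
  A partition is the weakly decreasing list of its positive parts, so its length is the
  length of the list.
\<close>

definition Par :: "nat list set" where
  "Par = {lam. sorted_wrt (\<ge>) lam \<and> 0 \<notin> set lam}"

definition part :: "nat list \<Rightarrow> nat \<Rightarrow> nat" where
  "part lam i = (if 1 \<le> i \<and> i \<le> length lam then lam ! (i - 1) else 0)"

definition mat1 :: "nat \<Rightarrow> (nat \<Rightarrow> nat \<Rightarrow> 'a) \<Rightarrow> 'a mat" where
  "mat1 n e = mat n n (\<lambda>(a, b). e (a + 1) (b + 1))"

section \<open>Symmetric functions, Schur functions and the Hall product\<close>

definition Lam :: "K mps set" where
  "Lam = {f. (\<forall>\<pi> M. bij \<pi> \<longrightarrow> mps_coeff f (image_mset \<pi> M) = mps_coeff f M) \<and>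
             (\<exists>d. \<forall>M. mps_coeff f M \<noteq> 0 \<longrightarrow> size M \<le> d)}"

definition vandermonde :: "nat \<Rightarrow> K mps" where
  "vandermonde n = (\<Prod>j<n. \<Prod>i<j. mps_var i - mps_var j)"

text \<open>
  Schur functions are the stable limits of the quotients of alternants. Here and for the stable
  Grothendieck polynomials, the quotient by the Vandermonde product (which is not a zero divisor)
  is expressed by multiplying out. A power series is determined by its restrictions to n variables
  for all large n.
\<close>

definition schur :: "nat list \<Rightarrow> K mps" where
  "schur lam = (THE f. \<forall>n\<ge>length lam.
     mps_restrict n f * vandermonde n =
       det (mat1 n (\<lambda>i j. mps_var (i - 1) ^ (part lam j + n - j))))"

definition schur_expansion :: "K mps \<Rightarrow> (nat list \<Rightarrow> K) \<Rightarrow> bool" where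
  "schur_expansion f c \<longleftrightarrow> (\<forall>lam. lam \<notin> Par \<longrightarrow> c lam = 0) \<and>
     ((\<lambda>lam. mps_const (c lam) * schur lam) has_sum f) Par"

text \<open>
  The completion (inverse limit over n of the quotients by the span of the Schur functions of
  length greater than n), realised inside the power series by summing the formal sums of Schur
  functions; these sums always converge, since there are only finitely many Schur functions of
  each degree, and the sum determines the coefficients.
\<close>

definition Lam_hat :: "K mps set" where
  "Lam_hat = {f. \<exists>c. schur_expansion f c \<and> (\<forall>n. finite {lam\<in>Par. length lam \<le> n \<and> c lam \<noteq> 0})}"

definition schur_coeff :: "K mps \<Rightarrow> nat list \<Rightarrow> K" where
  "schur_coeff f = (THE c. schur_expansion f c)"

text \<open>The Hall product of an element of \<open>Lam_hat\<close> and an element of \<open>Lam\<close>.\<close>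

definition hall :: "K mps \<Rightarrow> K mps \<Rightarrow> K" where
  "hall f h = (\<Sum>lam | schur_coeff h lam \<noteq> 0. schur_coeff f lam * schur_coeff h lam)"

definition perp :: "K mps \<Rightarrow> K mps \<Rightarrow> K mps" where
  "perp f g = (THE u. u \<in> Lam_hat \<and> (\<forall>h\<in>Lam. hall u h = hall g (f * h)))"

section \<open>Stable Grothendieck polynomials and their duals\<close>

definition G :: "nat list \<Rightarrow> K mps" where
  "G lam = (THE f. f \<in> Lam_hat \<and> (\<forall>n\<ge>length lam.
     mps_restrict n f * vandermonde n =
       det (mat1 n (\<lambda>i j. mps_var (i - 1) ^ (part lam j + n - j) *
                         (1 + mps_const beta * mps_var (i - 1)) ^ (j - 1)))))"

definition dual_g :: "nat list \<Rightarrow> K mps" where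
  "dual_g mu = (THE g. g \<in> Lam \<and> (\<forall>lam\<in>Par. hall (G lam) g = (if lam = mu then 1 else 0)))"

definition skew_G :: "nat list \<Rightarrow> nat list \<Rightarrow> K mps" where
  "skew_G lam mu = perp (dual_g mu) (G lam)"

text \<open>
  The one-row series, indexed by all integers m, are the coefficients of
  \<open>1 / (1 + \<beta> z\<^sup>-\<^sup>1) * (\<Prod>l. (1 + \<beta> x\<^sub>l) / (1 - x\<^sub>l z))\<close>.
  The product over l is a power series in z whose coefficients are limits of those of the partial
  products (the z-adic topology of the type fps is not the right one here). The first factor is
  the series \<open>(\<Sum>p. (- \<beta>) ^ p * z\<^sup>-\<^sup>p)\<close>.
\<close>

definition geometric_fps :: "'a::comm_ring_1 \<Rightarrow> 'a fps" where
  "geometric_fps x = Abs_fps (\<lambda>k. x ^ k)"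

lemma geometric_fps: "(1 - fps_const x * fps_X) * geometric_fps x = 1"
proof (rule fps_ext)
  fix k
  have "(1 - fps_const x * fps_X) * geometric_fps x
      = geometric_fps x - fps_const x * (fps_X * geometric_fps x)"
    by (simp add: algebra_simps)
  then show "fps_nth ((1 - fps_const x * fps_X) * geometric_fps x) k = fps_nth 1 k"
    by (cases k) (simp_all add: geometric_fps_def)
qed

definition gen_product_coeff :: "nat \<Rightarrow> K mps" where
  "gen_product_coeff a = lim (\<lambda>N. fps_nth
     (\<Prod>l<N. fps_const (1 + mps_const beta * mps_var l) * geometric_fps (mps_var l)) a)"

definition G_int :: "int \<Rightarrow> K mps" where
  "G_int m = (\<Sum>p. mps_const ((- beta) ^ p) *
     (if m + int p \<ge> 0 then gen_product_coeff (nat (m + int p)) else 0))"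

section \<open>Binomial coefficients with integer entries\<close>

definition zbinom :: "int \<Rightarrow> int \<Rightarrow> K" where
  "zbinom a n = (if n < 0 then 0 else of_int a gchoose nat n)"

definition Delta :: "nat \<Rightarrow> nat list \<Rightarrow> nat \<Rightarrow> nat \<Rightarrow> nat \<Rightarrow> K" where
  "Delta r mu i j n =
     (if part mu j = 0 then zbinom (int i - int r) (- 1 - int r + int j + int n) else 0)"

end

theory Submission
  imports Defs
begin

text \<open>
  Put \<open>z = 1/y\<close> and \<open>w = z + \<beta>\<close>. Then
  \<open>\<Prod>\<^sub>l (1 + \<beta> x\<^sub>l) / (1 - x\<^sub>l z) = \<Prod>\<^sub>l 1 / (1 - Y\<^sub>l w)\<close> for
  \<open>Y\<^sub>l = x\<^sub>l / (1 + \<beta> x\<^sub>l)\<close>, so every series in sight is a linear functional of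
  \<open>H(w) = \<Sum>\<^sub>k h\<^sub>k(Y) w\<^sup>k\<close>. In these terms \<open>G\<^bsub>\<lambda>\<^esub>\<close> is a Jacobi--Trudi
  determinant whose row \<open>i\<close> is the functional \<open>Y\<^sup>-\<^sup>i \<phi>\<^bsup>\<lambda>\<^sub>i\<^esup>\<close>, \<open>\<phi> = Y / (1 - \<beta> Y)\<close>
  (with \<open>Y\<^sup>p\<close> standing for the coefficient of \<open>w\<^sup>p\<close>), and unitriangular column operations turn the
  determinant of the theorem into the same determinant with the columns \<open>w\<^sup>-\<^sup>j\<close> replaced by
  columns \<open>V\<^sub>j\<close> biorthogonal to these rows. Expanding along a splitting of the alphabet gives
  minors \<open>det(h(Y))\<close> in the one half, and the element of \<open>\<Lambda>\<close> whose Hall product with such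
  a minor is the corresponding minor of \<open>V\<close> is dual to the \<open>G\<^bsub>\<lambda>\<^esub>\<close>, hence equals
  \<open>g\<^bsub>\<mu>\<^esub>\<close>. Products in the Hall product are handled by the duality of complete homogeneous
  functions and monomials, which makes multiplication dual to splitting the alphabet.
\<close>

section \<open>Coefficients of power series\<close>

text \<open>The series \<open>\<phi>\<close> inverts the substitution: \<open>\<phi>(Y) = x\<close>
  in one variable, and \<open>1 + \<beta> \<phi> = 1 / (1 - \<beta> Y)\<close>. The first fact turns
  the rows of the Jacobi--Trudi determinant, after clearing powers of \<open>1 + \<beta> x\<close>,
  into the alternant that defines \<open>G\<close>; the second sums the binomial series of an entry
  to a power of \<open>1 - \<beta> Y\<close>. The correction \<open>Delta\<close> comes from the
  zero parts of \<open>\<mu>\<close>. Without it a column with \<open>\<mu>_j = 0\<close> would be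
  \<open>w^-j (1 - \<beta>/w)^-1\<close>, an infinite series in \<open>1/w\<close>;
  \<open>Delta\<close> removes exactly its terms below \<open>w^-r\<close>, and what remains is a
  combination of the columns \<open>w^-j, ..., w^-r\<close>. The obstacle is that
  \<open>g_\<mu>\<close> is given only through its pairings with the \<open>G_\<lambda>\<close>. The
  minors \<open>det(h(Y))\<close> have Schur functions as their lowest terms, so the pairings of an
  element of \<open>\<Lambda>\<close> with them can be prescribed freely as long as these vanish for
  all large partitions. The minors of \<open>V\<close> do so because \<open>V_j\<close> has no power
  of \<open>w\<close> above \<open>\<mu>_j - j\<close>.\<close>

lemma mps_coeff_simps [simp]:
  "mps_coeff 0 M = 0"
  "mps_coeff 1 M = (if M = {#} then 1 else 0)"
  "mps_coeff (f + g) M = mps_coeff f M + mps_coeff g M"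
  "mps_coeff (f - g) M = mps_coeff f M - mps_coeff g M"
  "mps_coeff (- f) M = - mps_coeff f M"
  "mps_coeff (mps_restrict n f) M = (if set_mset M \<subseteq> {..<n} then mps_coeff f M else 0)"
  "mps_coeff (mps_const c) M = (if M = {#} then c else 0)"
  "mps_coeff (mps_var l) M = (if M = {#l#} then 1 else 0)"
  by (simp_all add: zero_mps_def one_mps_def plus_mps_def minus_mps_def uminus_mps_def
      mps_restrict_def mps_const_def mps_var_def)

lemma mps_coeff_mult:
  "mps_coeff (f * g) M = (\<Sum>A | A \<subseteq># M. mps_coeff f A * mps_coeff g (M - A))"
  by (simp add: times_mps_def)

lemma mps_coeff_sum [simp]: "mps_coeff (sum f S) M = (\<Sum>x\<in>S. mps_coeff (f x) M)"
  by (induction S rule: infinite_finite_induct) auto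

definition mps_monom :: "nat multiset \<Rightarrow> 'a::comm_ring_1 mps" where
  "mps_monom M0 = Abs_mps (\<lambda>M. if M = M0 then 1 else 0)"

lemma mps_coeff_monom [simp]: "mps_coeff (mps_monom M0) M = (if M = M0 then 1 else 0)"
  by (simp add: mps_monom_def)

lemma mps_coeff_monom_mult [simp]:
  "mps_coeff (mps_monom M0 * f) M = (if M0 \<subseteq># M then mps_coeff f (M - M0) else 0)"
proof -
  have "mps_coeff (mps_monom M0 * f) M
      = (\<Sum>A | A \<subseteq># M. if A = M0 then mps_coeff f (M - A) else 0)"
    by (auto simp: mps_coeff_mult intro!: sum.cong)
  also have "\<dots> = (if M0 \<subseteq># M then mps_coeff f (M - M0) else 0)"
    by (subst sum.delta) (auto simp: finite_submultisets)
  finally show ?thesis .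
qed

lemma mps_monom_0 [simp]: "mps_monom {#} = 1"
  by (rule mps_eqI) simp

lemma mps_var_eq_monom: "mps_var l = mps_monom {#l#}"
  by (rule mps_eqI) simp

lemma mps_monom_mult: "mps_monom A * mps_monom B = mps_monom (A + B)"
  by (rule mps_eqI) auto

lemma mps_monom_prod: "(\<Prod>x\<in>S. mps_monom (F x)) = mps_monom (\<Sum>x\<in>S. F x)"
  by (induction S rule: infinite_finite_induct) (auto simp: mps_monom_mult)

lemma mps_var_power: "mps_var l ^ k = mps_monom (replicate_mset k l)"
  by (induction k) (auto simp: mps_var_eq_monom mps_monom_mult)

lemma mps_coeff_const_mult [simp]: "mps_coeff (mps_const c * f) M = c * mps_coeff f M"
proof -
  have "mps_coeff (mps_const c * f) M
      = (\<Sum>A | A \<subseteq># M. if A = {#} then c * mps_coeff f (M - A) else 0)"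
    by (auto simp: mps_coeff_mult intro!: sum.cong)
  also have "\<dots> = c * mps_coeff f M"
    by (subst sum.delta) (auto simp: finite_submultisets)
  finally show ?thesis .
qed

lemma mps_coeff_var_mult [simp]:
  "mps_coeff (mps_var l * f) M = (if l \<in># M then mps_coeff f (M - {#l#}) else 0)"
  by (simp add: mps_var_eq_monom)

lemma comm_ring_hom_mps_const: "comm_ring_hom (mps_const :: 'a::comm_ring_1 \<Rightarrow> 'a mps)"
proof
  show "mps_const (x * y) = mps_const x * (mps_const y :: 'a mps)" for x y :: 'a
    by (rule mps_eqI) simp
qed (rule mps_eqI, simp)+

interpretation mps_const: comm_ring_hom "mps_const :: 'a::comm_ring_1 \<Rightarrow> 'a mps"
  by (rule comm_ring_hom_mps_const)

lemma comm_ring_hom_mps_restrict: "comm_ring_hom (mps_restrict n :: 'a::comm_ring_1 mps \<Rightarrow> 'a mps)"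
proof
  fix f g :: "'a mps"
  show "mps_restrict n (f * g) = mps_restrict n f * mps_restrict n g"
  proof (rule mps_eqI)
    fix M
    show "mps_coeff (mps_restrict n (f * g)) M = mps_coeff (mps_restrict n f * mps_restrict n g) M"
    proof (cases "set_mset M \<subseteq> {..<n}")
      case True
      then have "set_mset A \<subseteq> {..<n}" if "A \<subseteq># M" for A
        using set_mset_mono[OF that] by blast
      moreover have "set_mset (M - A) \<subseteq> {..<n}" for A
        using True by (meson dual_order.trans in_diffD subsetI)
      ultimately show ?thesis
        using True by (auto simp: mps_coeff_mult intro!: sum.cong)
    next
      case False
      have *: "\<not> (set_mset A \<subseteq> {..<n} \<and> set_mset (M - A) \<subseteq> {..<n})" if "A \<subseteq># M" for A
      proof
        assume "set_mset A \<subseteq> {..<n} \<and> set_mset (M - A) \<subseteq> {..<n}"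
        then have "set_mset (A + (M - A)) \<subseteq> {..<n}" by simp
        with that False show False by simp
      qed
      have "mps_coeff (mps_restrict n f * mps_restrict n g) M = 0"
        unfolding mps_coeff_mult using * by (intro sum.neutral) auto
      with False show ?thesis by simp
    qed
  qed
qed (rule mps_eqI, simp)+

interpretation mps_restrict: comm_ring_hom "mps_restrict n :: 'a::comm_ring_1 mps \<Rightarrow> 'a mps"
  by (rule comm_ring_hom_mps_restrict)

lemma mps_restrict_restrict: "m \<le> n \<Longrightarrow> mps_restrict m (mps_restrict n f) = mps_restrict m (f :: 'a::comm_ring_1 mps)"
  by (rule mps_eqI) (auto simp: subset_iff)

lemma mps_eqI_restrict:
  assumes "\<And>n. n \<ge> N \<Longrightarrow> mps_restrict n f = mps_restrict n (g :: 'a::comm_ring_1 mps)"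
  shows "f = g"
proof (rule mps_eqI)
  fix M :: "nat multiset"
  obtain m where m: "set_mset M \<subseteq> {..<m}"
    by (meson finite_nat_iff_bounded finite_set_mset)
  define n where "n = max N m"
  have "set_mset M \<subseteq> {..<n}" "mps_restrict n f = mps_restrict n g"
    using m assms by (auto simp: n_def)
  then have "mps_coeff (mps_restrict n f) M = mps_coeff (mps_restrict n g) M" by simp
  with \<open>set_mset M \<subseteq> {..<n}\<close> show "mps_coeff f M = mps_coeff g M" by simp
qed

section \<open>Determinants of functions of two indices\<close>

definition detf :: "nat \<Rightarrow> (nat \<Rightarrow> nat \<Rightarrow> 'a::comm_ring_1) \<Rightarrow> 'a" where
  "detf n e = det (mat n n (\<lambda>(i, j). e i j))"

lemma det_mat1: "det (mat1 n e) = detf n (\<lambda>i j. e (Suc i) (Suc j))"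
  by (simp add: mat1_def detf_def)

lemma detf_leibniz:
  "detf n e = (\<Sum>\<pi> | \<pi> permutes {..<n}. of_int (sign \<pi>) * (\<Prod>i<n. e i (\<pi> i)))"
proof -
  have "detf n e = (\<Sum>\<pi> | \<pi> permutes {0..<n}. signof \<pi> *
      (\<Prod>i = 0..<n. mat n n (\<lambda>(i, j). e i j) $$ (i, \<pi> i)))"
    unfolding detf_def by (rule det_def') simp
  also have "\<dots> = (\<Sum>\<pi> | \<pi> permutes {0..<n}. of_int (sign \<pi>) * (\<Prod>i = 0..<n. e i (\<pi> i)))"
    by (intro sum.cong refl arg_cong2[of _ _ _ _ "(*)"] prod.cong) (auto dest: permutes_in_image)
  finally show ?thesis by (simp add: lessThan_atLeast0)
qed

lemma detf_cong: "(\<And>i j. i < n \<Longrightarrow> j < n \<Longrightarrow> e i j = e' i j) \<Longrightarrow> detf n e = detf n e'"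
  unfolding detf_def by (rule arg_cong[where f = det]) (auto intro!: eq_matI)

lemma (in comm_ring_hom) hom_detf: "hom (detf n e) = detf n (\<lambda>i j. hom (e i j))"
  unfolding detf_def hom_det[symmetric] by (rule arg_cong[where f = det]) (auto intro!: eq_matI)

lemma detf_transpose: "detf n (\<lambda>i j. e j i) = detf n e"
proof -
  have "mat n n (\<lambda>(i, j). e j i) = transpose_mat (mat n n (\<lambda>(i, j). e i j))"
    by (auto intro!: eq_matI)
  then show ?thesis by (simp add: detf_def det_transpose[of _ n])
qed

lemma detf_mult: "detf n (\<lambda>i j. \<Sum>k<n. a i k * b k j) = detf n a * detf n b"
proof -
  have "mat n n (\<lambda>(i, j). \<Sum>k<n. a i k * b k j) = mat n n (\<lambda>(i, j). a i j) * mat n n (\<lambda>(i, j). b i j)"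
    by (auto intro!: eq_matI sum.cong simp: scalar_prod_def lessThan_atLeast0)
  then show ?thesis by (simp add: detf_def det_mult[of _ n])
qed

lemma detf_upper_triangular:
  assumes "\<And>i j. j < i \<Longrightarrow> i < n \<Longrightarrow> e i j = 0"
  shows "detf n e = (\<Prod>i<n. e i i)"
  unfolding detf_def
  by (subst det_upper_triangular[of _ n])
     (use assms in \<open>auto simp: prod_list_diag_prod lessThan_atLeast0 upper_triangular_def\<close>)

lemma detf_lower_triangular:
  assumes "\<And>i j. i < j \<Longrightarrow> j < n \<Longrightarrow> e i j = 0"
  shows "detf n e = (\<Prod>i<n. e i i)"
  using detf_upper_triangular[of n "\<lambda>i j. e j i"] assms detf_transpose[of n e] by simp

lemma detf_identical_rows:
  assumes "i < n" "k < n" "i \<noteq> k" "\<And>j. j < n \<Longrightarrow> e i j = e k j"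
  shows "detf n e = 0"
  unfolding detf_def
  by (rule det_identical_rows[of _ n i k]) (use assms in \<open>auto intro!: eq_vecI\<close>)

lemma detf_permute_rows:
  assumes "\<sigma> permutes {..<n}"
  shows "detf n (\<lambda>i. e (\<sigma> i)) = of_int (sign \<sigma>) * detf n e"
proof -
  have "detf n (\<lambda>i. e (\<sigma> i)) = det (mat n n (\<lambda>(i, j). mat n n (\<lambda>(i, j). e i j) $$ (\<sigma> i, j)))"
    unfolding detf_def using permutes_in_image[OF assms]
    by (intro arg_cong[where f = det] eq_matI) auto
  also have "\<dots> = of_int (sign \<sigma>) * det (mat n n (\<lambda>(i, j). e i j))"
    by (rule det_permute_rows) (use assms in \<open>auto simp: lessThan_atLeast0\<close>)
  finally show ?thesis by (simp add: detf_def)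
qed

lemma detf_scale_rows: "detf n (\<lambda>i j. c i * e i j) = (\<Prod>i<n. c i) * detf n e"
  unfolding detf_leibniz sum_distrib_left by (intro sum.cong refl) (simp add: prod.distrib algebra_simps)

lemma detf_scale_cols: "detf n (\<lambda>i j. c j * e i j) = (\<Prod>i<n. c i) * detf n e"
  using detf_scale_rows[of n c "\<lambda>i j. e j i"] detf_transpose[of n e]
    detf_transpose[of n "\<lambda>i j. c j * e i j"] by simp

text \<open>The zero block has \<open>k + 1\<close> rows and \<open>n - k\<close> columns. These
  numbers add up to more than \<open>n\<close>, so by the pigeonhole principle every term of the
  Leibniz sum meets the block.\<close>

lemma detf_zero_block:
  assumes "k < n" "\<And>i j. i \<le> k \<Longrightarrow> k \<le> j \<Longrightarrow> j < n \<Longrightarrow> e i j = 0"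
  shows "detf n e = 0"
proof -
  have "(\<Prod>i<n. e i (\<pi> i)) = 0" if \<pi>: "\<pi> permutes {..<n}" for \<pi>
  proof -
    have "\<exists>i\<le>k. k \<le> \<pi> i"
    proof (rule ccontr)
      assume "\<not> ?thesis"
      then have "\<pi> ` {..k} \<subseteq> {..<k}" by auto
      moreover have "inj_on \<pi> {..k}" using \<pi> by (meson inj_on_subset permutes_inj subset_UNIV)
      ultimately have "card {..k} \<le> card {..<k}" by (metis card_inj_on_le finite_lessThan)
      then show False by simp
    qed
    then obtain i where "i \<le> k" "k \<le> \<pi> i" by blast
    moreover have "\<pi> i < n" using \<pi> calculation assms(1) permutes_in_image[OF \<pi>, of i] by auto
    ultimately have "i < n" "e i (\<pi> i) = 0" using assms by auto
    then show ?thesis by (intro prod_zero) auto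
  qed
  then show ?thesis by (simp add: detf_leibniz)
qed

text \<open>Multilinearity in the rows. The sum runs over all index functions, not only the
  decreasing ones; keeping the redundant terms lets the Cauchy--Binet step read this identity once
  forwards and once backwards.\<close>

lemma detf_row_sum:
  assumes "finite S"
  shows "detf n (\<lambda>i j. \<Sum>p\<in>S. a i p * b p j)
    = (\<Sum>f\<in>{..<n} \<rightarrow>\<^sub>E S. (\<Prod>i<n. a i (f i)) * detf n (\<lambda>i. b (f i)))"
proof -
  have "detf n (\<lambda>i j. \<Sum>p\<in>S. a i p * b p j) = (\<Sum>\<pi> | \<pi> permutes {..<n}. of_int (sign \<pi>) *
      (\<Sum>f\<in>{..<n} \<rightarrow>\<^sub>E S. \<Prod>i<n. a i (f i) * b (f i) (\<pi> i)))"
    unfolding detf_leibniz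
    by (intro sum.cong refl arg_cong2[of _ _ _ _ "(*)"] prod_sum_PiE) (use assms in auto)
  also have "\<dots> = (\<Sum>f\<in>{..<n} \<rightarrow>\<^sub>E S. \<Sum>\<pi> | \<pi> permutes {..<n}. of_int (sign \<pi>) *
      (\<Prod>i<n. a i (f i) * b (f i) (\<pi> i)))"
    by (simp add: sum_distrib_left sum.swap[of _ "{..<n} \<rightarrow>\<^sub>E S"])
  also have "\<dots> = (\<Sum>f\<in>{..<n} \<rightarrow>\<^sub>E S. (\<Prod>i<n. a i (f i)) * detf n (\<lambda>i. b (f i)))"
    by (simp add: detf_leibniz sum_distrib_left prod.distrib mult_ac)
  finally show ?thesis .
qed

section \<open>Linear functionals of the generating series\<close>

text \<open>
  The coefficient of a monomial in \<open>\<Prod>\<^sub>l (1 + b x\<^sub>l) / (1 - x\<^sub>l (w - b))\<close>: the \<open>e\<close>-th power of a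
  variable, \<open>e > 0\<close>, contributes \<open>w (w - b)\<^sup>e\<^sup>-\<^sup>1\<close>. The functional \<open>c\<close> sends \<open>w\<^sup>k\<close> to \<open>c k\<close>. For
  \<open>b = 0\<close> one obtains the usual complete homogeneous functions.
\<close>

definition wpoly :: "K \<Rightarrow> nat multiset \<Rightarrow> K poly" where
  "wpoly b M = [:0, 1:] ^ card (set_mset M) * [:- b, 1:] ^ (size M - card (set_mset M))"

definition HL :: "K \<Rightarrow> (int \<Rightarrow> K) \<Rightarrow> K mps" where
  "HL b c = Abs_mps (\<lambda>M. \<Sum>k\<le>size M. coeff (wpoly b M) k * c (int k))"

definition eta :: "K \<Rightarrow> int \<Rightarrow> K mps" where
  "eta b m = HL b (\<lambda>k. if k = m then 1 else 0)"

definition mps_supported :: "nat set \<Rightarrow> 'a::zero mps \<Rightarrow> 'a mps" where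
  "mps_supported A f = Abs_mps (\<lambda>M. if set_mset M \<subseteq> A then mps_coeff f M else 0)"

lemma mps_coeff_supported [simp]:
  "mps_coeff (mps_supported A f) M = (if set_mset M \<subseteq> A then mps_coeff f M else 0)"
  by (simp add: mps_supported_def)

lemma mps_supported_lessThan: "mps_supported {..<n} f = mps_restrict n f"
  by (simp add: mps_supported_def mps_restrict_def)

lemma card_set_mset_le: "card (set_mset M) \<le> size M"
  by (induction M) (auto intro: card_insert_le_m1 simp: card_insert_if)

lemma wpoly_empty [simp]: "wpoly b {#} = 1"
  by (simp add: wpoly_def)

lemma wpoly_add_new: "l \<notin># M \<Longrightarrow> wpoly b (add_mset l M) = [:0, 1:] * wpoly b M"
  by (simp add: wpoly_def mult.assoc)

lemma wpoly_add_old: "l \<in># M \<Longrightarrow> wpoly b (add_mset l M) = [:- b, 1:] * wpoly b M"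
  using card_set_mset_le[of M]
  by (simp add: wpoly_def insert_absorb Suc_diff_le mult_ac del: mult_pCons_left mult_pCons_right)

text \<open>The generating product has one factor per variable, so coefficients at monomials without
  a common variable multiply. Splitting the alphabet rests on this.\<close>

lemma wpoly_union:
  "set_mset A \<inter> set_mset B = {} \<Longrightarrow> wpoly b (A + B) = wpoly b A * wpoly b B"
proof (induction B)
  case (add x B)
  then have IH: "wpoly b (A + B) = wpoly b A * wpoly b B" and "x \<notin># A" by auto
  then show ?case
    by (cases "x \<in># B")
       (simp_all add: wpoly_add_new wpoly_add_old mult_ac
          del: mult_pCons_left mult_pCons_right)
qed simp

lemma wpoly_image: "inj f \<Longrightarrow> wpoly b (image_mset f M) = wpoly b M"
  by (simp add: wpoly_def card_image inj_on_subset[OF _ subset_UNIV])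

lemma degree_wpoly: "degree (wpoly b M) = size M"
  using card_set_mset_le[of M] by (simp add: wpoly_def degree_mult_eq degree_power_eq)

lemma coeff_wpoly_size: "coeff (wpoly b M) (size M) = 1"
proof -
  have "lead_coeff (wpoly b M) = 1"
    by (simp add: wpoly_def lead_coeff_mult lead_coeff_power)
  then show ?thesis by (simp add: degree_wpoly)
qed

lemma coeff_wpoly_0: "M \<noteq> {#} \<Longrightarrow> coeff (wpoly b M) 0 = 0"
proof -
  assume "M \<noteq> {#}"
  then have "card (set_mset M) > 0" by (simp add: card_gt_0_iff)
  then show ?thesis by (simp add: wpoly_def poly_0_coeff_0[symmetric])
qed

lemma wpoly_0: "wpoly 0 M = monom 1 (size M)"
proof -
  have "wpoly 0 M = [:0, 1:] ^ size M"
    using card_set_mset_le[of M] by (simp add: wpoly_def power_add[symmetric])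
  then show ?thesis by (simp add: monom_altdef)
qed

lemma mps_coeff_HL: "mps_coeff (HL b c) M = (\<Sum>k\<le>size M. coeff (wpoly b M) k * c (int k))"
  by (simp add: HL_def)

lemma mps_coeff_HL_upto:
  "size M \<le> N \<Longrightarrow> mps_coeff (HL b c) M = (\<Sum>k\<le>N. coeff (wpoly b M) k * c (int k))"
  unfolding mps_coeff_HL
  by (rule sum.mono_neutral_left) (auto simp: coeff_eq_0 degree_wpoly)

lemma mps_coeff_HL_empty [simp]: "mps_coeff (HL b c) {#} = c 0"
  by (simp add: mps_coeff_HL)

lemma HL_cong: "(\<And>k. c (int k) = c' (int k)) \<Longrightarrow> HL b c = HL b c'"
  by (simp add: HL_def)

lemma HL_scale: "HL b (\<lambda>k. x * c k) = mps_const x * HL b c"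
  by (rule mps_eqI) (simp add: mps_coeff_HL sum_distrib_left mult_ac)

lemma HL_add: "HL b (\<lambda>k. c k + c' k) = HL b c + HL b c'"
  by (rule mps_eqI) (simp add: mps_coeff_HL sum.distrib algebra_simps)

lemma HL_diff: "HL b (\<lambda>k. c k - c' k) = HL b c - HL b c'"
  by (rule mps_eqI) (simp add: mps_coeff_HL sum_subtractf algebra_simps)

lemma HL_0 [simp]: "HL b (\<lambda>_. 0) = 0"
  by (rule mps_eqI) (simp add: mps_coeff_HL)

lemma HL_sum: "HL b (\<lambda>k. \<Sum>x\<in>S. c x k) = (\<Sum>x\<in>S. HL b (c x))"
  by (induction S rule: infinite_finite_induct) (auto simp: HL_add)

lemma mps_coeff_eta: "mps_coeff (eta b m) M = (if m < 0 then 0 else coeff (wpoly b M) (nat m))"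
proof (cases "m < 0")
  case True
  then show ?thesis by (auto simp: eta_def mps_coeff_HL intro!: sum.neutral)
next
  case False
  then obtain k where k: "m = int k" using nonneg_int_cases by (metis not_less)
  have "mps_coeff (eta b m) M = (\<Sum>j\<le>max k (size M). if j = k then coeff (wpoly b M) j else 0)"
    unfolding eta_def
    by (rule trans[OF mps_coeff_HL_upto[of _ "max k (size M)"] sum.cong]) (auto simp: k)
  also have "\<dots> = coeff (wpoly b M) k" by (subst sum.delta) auto
  finally show ?thesis by (simp add: k)
qed

lemma eta_neg: "m < 0 \<Longrightarrow> eta b m = 0"
  by (rule mps_eqI) (simp add: mps_coeff_eta)

lemma eta_0: "eta b 0 = 1"
  by (rule mps_eqI) (auto simp: mps_coeff_eta coeff_wpoly_0)

lemma mps_coeff_h: "mps_coeff (eta 0 m) M = (if m = int (size M) then 1 else 0)"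
  by (auto simp: mps_coeff_eta wpoly_0)

lemma mps_coeff_HL_add_new:
  assumes "l \<notin># M"
  shows "mps_coeff (HL b c) (add_mset l M) = mps_coeff (HL b (\<lambda>k. c (k + 1))) M"
proof -
  have "mps_coeff (HL b c) (add_mset l M)
      = (\<Sum>k\<le>Suc (size M). coeff (pCons 0 (wpoly b M)) k * c (int k))"
    by (simp add: mps_coeff_HL wpoly_add_new[OF assms] del: sum.atMost_Suc)
  also have "\<dots> = (\<Sum>k\<le>size M. coeff (wpoly b M) k * c (int k + 1))"
    by (subst sum.atMost_Suc_shift) (simp add: add.commute)
  finally show ?thesis by (simp add: mps_coeff_HL)
qed

lemma mps_coeff_HL_add_old:
  assumes "l \<in># M"
  shows "mps_coeff (HL b c) (add_mset l M) = mps_coeff (HL b (\<lambda>k. c (k + 1) - b * c k)) M"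
proof -
  have "mps_coeff (HL b c) (add_mset l M) = (\<Sum>k\<le>Suc (size M). coeff (pCons 0 (wpoly b M)) k * c (int k))
      - (\<Sum>k\<le>Suc (size M). coeff (wpoly b M) k * (b * c (int k)))"
    unfolding sum_subtractf[symmetric]
    by (auto simp add: mps_coeff_HL wpoly_add_old[OF assms] algebra_simps
        simp del: sum.atMost_Suc intro!: sum.cong)
  also have "(\<Sum>k\<le>Suc (size M). coeff (pCons 0 (wpoly b M)) k * c (int k))
      = (\<Sum>k\<le>size M. coeff (wpoly b M) k * c (int k + 1))"
    by (subst sum.atMost_Suc_shift) (simp add: add.commute)
  also have "(\<Sum>k\<le>Suc (size M). coeff (wpoly b M) k * (b * c (int k)))
      = mps_coeff (HL b (\<lambda>k. b * c k)) M"
    by (rule mps_coeff_HL_upto[symmetric]) simp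
  finally show ?thesis by (simp add: HL_diff) (simp add: mps_coeff_HL)
qed

text \<open>The factor of the variable \<open>x\<close> with index \<open>l\<close> is
  \<open>(1 + b x) / (1 - x (w - b))\<close>, and its denominator is \<open>(1 + b x) - x w\<close>.
  Multiplying by the denominator therefore removes the variable up to the factor
  \<open>1 + b x\<close>; multiplication by \<open>w\<close> is the shift of
  \<open>c\<close>.\<close>

lemma HL_var_relation:
  assumes "l \<notin> A"
  shows "(1 + mps_const b * mps_var l) * mps_supported (insert l A) (HL b c)
    - mps_var l * mps_supported (insert l A) (HL b (\<lambda>k. c (k + 1)))
    = (1 + mps_const b * mps_var l) * mps_supported A (HL b c)"
proof (rule mps_eqI)
  fix M
  show "mps_coeff ((1 + mps_const b * mps_var l) * mps_supported (insert l A) (HL b c)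
    - mps_var l * mps_supported (insert l A) (HL b (\<lambda>k. c (k + 1)))) M
    = mps_coeff ((1 + mps_const b * mps_var l) * mps_supported A (HL b c)) M"
  proof (cases "l \<in># M")
    case False
    then have "set_mset M \<subseteq> insert l A \<longleftrightarrow> set_mset M \<subseteq> A" by auto
    with False show ?thesis by (simp add: distrib_right mult.assoc)
  next
    case True
    then obtain N where M: "M = add_mset l N" by (blast dest: multi_member_split)
    show ?thesis
    proof (cases "l \<in># N")
      case True
      then have *: "\<not> set_mset N \<subseteq> A" using assms by auto
      show ?thesis using True assms *
        by (auto simp add: M distrib_right mult.assoc mps_coeff_HL_add_old HL_diff HL_scale)
    next
      case False
      then have "set_mset N \<subseteq> insert l A \<longleftrightarrow> set_mset N \<subseteq> A" by auto
      with False show ?thesis using assms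
        by (auto simp add: M distrib_right mult.assoc mps_coeff_HL_add_new)
    qed
  qed
qed

text \<open>The series x / (1 + b x) in the variable x with index l.\<close>

definition yvar :: "K \<Rightarrow> nat \<Rightarrow> K mps" where
  "yvar b l = mps_supported {l} (eta b 1)"

lemma mps_supported_empty_HL: "mps_supported {} (HL b c) = mps_const (c 0)"
  by (rule mps_eqI) auto

lemma mps_supported_empty_eta: "mps_supported {} (eta b m) = (if m = 0 then 1 else 0)"
  unfolding eta_def mps_supported_empty_HL by simp

lemma mps_supported_1 [simp]: "mps_supported A (1 :: K mps) = 1"
  by (rule mps_eqI) auto

lemma yvar_relation: "(1 + mps_const b * mps_var l) * yvar b l = mps_var l"
proof -
  have "HL b (\<lambda>k. if k + 1 = 1 then 1 else 0) = 1"
    using eta_0[of b] by (simp add: eta_def)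
  then show ?thesis
    using HL_var_relation[of l "{}" b "\<lambda>k. if k = 1 then 1 else 0"]
    by (simp add: yvar_def eta_def[symmetric] mps_supported_empty_eta)
qed

lemma yvar_inverse: "(1 + mps_const b * mps_var l) * (1 - mps_const b * yvar b l) = 1"
  using arg_cong[OF yvar_relation[of b l], of "(*) (mps_const b)"] by (simp add: algebra_simps)

lemma yvar_0: "yvar 0 l = mps_var l"
  using yvar_relation[of 0 l] by simp

text \<open>\<open>HL_var_relation\<close> divided by the unit \<open>1 + b x\<close>, whose inverse
  is \<open>1 - b Y\<close>: removing a variable is multiplication by
  \<open>1 - Y w\<close>.\<close>

lemma HL_yvar_relation:
  assumes "l \<notin> A"
  shows "mps_supported (insert l A) (HL b c)
    - yvar b l * mps_supported (insert l A) (HL b (\<lambda>k. c (k + 1))) = mps_supported A (HL b c)"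
    (is "?F - yvar b l * ?F' = ?G")
proof -
  let ?u = "1 - mps_const b * yvar b l"
  let ?v = "1 + mps_const b * mps_var l"
  have vu: "?v * ?u = 1" by (rule yvar_inverse)
  have "?v * (?F - yvar b l * ?F') = ?v * ?G"
    using HL_var_relation[OF assms, of b c] yvar_relation[of b l]
    by (simp add: right_diff_distrib mult.assoc[symmetric])
  then have "?u * (?v * (?F - yvar b l * ?F')) = ?u * (?v * ?G)" by simp
  moreover have "?u * (?v * f) = f" for f
    using vu by (metis mult.assoc mult.commute mult_1_left)
  ultimately show ?thesis by metis
qed

lemma coeff_linear_mult:
  "coeff ([:1, - y:] * p) e = coeff p e - (y :: 'a::comm_ring_1) * coeff (pCons 0 p) e"
  by (cases e) (auto simp: coeff_pCons)

text \<open>Removing all variables of \<open>B\<close> multiplies the generating series by the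
  product of the \<open>1 - Y w\<close>. Its coefficient at \<open>w^e\<close> is a signed
  elementary symmetric function of the \<open>Y\<close>, and \<open>w^e\<close> itself acts as a
  shift of the functional by \<open>e\<close>.\<close>

lemma HL_elementary:
  assumes "finite B" "A \<inter> B = {}" "card B \<le> N"
  shows "(\<Sum>e\<le>N. coeff (\<Prod>l\<in>B. [:1, - yvar b l:]) e * mps_supported (A \<union> B) (HL b (\<lambda>k. c (k + int e))))
    = mps_supported A (HL b c)"
  using assms
proof (induction B arbitrary: c N A rule: finite_induct)
  case empty
  have "(\<Sum>e\<le>N. coeff (1 :: K mps poly) e * mps_supported A (HL b (\<lambda>k. c (k + int e))))
    = (\<Sum>e\<le>N. if e = 0 then mps_supported A (HL b c) else 0)"
    by (intro sum.cong) auto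
  then show ?case by simp
next
  case (insert l B)
  then obtain N' where N: "N = Suc N'" by (cases N) auto
  let ?E = "\<Prod>l\<in>B. [:1, - yvar b l:]"
  let ?F = "\<lambda>e. mps_supported (A \<union> insert l B) (HL b (\<lambda>k. c (k + int e)))"
  have deg: "coeff ?E (Suc N') = 0"
  proof (rule coeff_eq_0)
    have "degree ?E \<le> card B"
      using \<open>finite B\<close>
    proof (induction B rule: finite_induct)
      case (insert x F)
      have "degree ([:1, - yvar b x:] * (\<Prod>l\<in>F. [:1, - yvar b l:])) \<le> 1 + card F"
        by (rule order.trans[OF degree_mult_le]) (use insert.IH in \<open>auto intro: add_mono\<close>)
      with insert show ?case by (simp del: mult_pCons_left)
    qed simp
    then show "degree ?E < Suc N'" using insert N by simp
  qed
  have "(\<Sum>e\<le>N. coeff (\<Prod>l\<in>insert l B. [:1, - yvar b l:]) e * ?F e)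
      = (\<Sum>e\<le>Suc N'. coeff ?E e * ?F e) - (\<Sum>e\<le>Suc N'. yvar b l * coeff (pCons 0 ?E) e * ?F e)"
    unfolding sum_subtractf[symmetric] N
    by (intro sum.cong) (use insert in \<open>simp_all add: coeff_linear_mult left_diff_distrib
        del: mult_pCons_left\<close>)
  also have "(\<Sum>e\<le>Suc N'. yvar b l * coeff (pCons 0 ?E) e * ?F e)
      = (\<Sum>e\<le>N'. yvar b l * coeff ?E e * ?F (Suc e))"
    by (subst sum.atMost_Suc_shift) simp
  also have "(\<Sum>e\<le>Suc N'. coeff ?E e * ?F e) = (\<Sum>e\<le>N'. coeff ?E e * ?F e)"
    by (simp add: deg)
  also have "(\<Sum>e\<le>N'. coeff ?E e * ?F e) - (\<Sum>e\<le>N'. yvar b l * coeff ?E e * ?F (Suc e))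
      = (\<Sum>e\<le>N'. coeff ?E e * (?F e - yvar b l * ?F (Suc e)))"
    by (simp add: sum_subtractf algebra_simps)
  also have "\<dots> = (\<Sum>e\<le>N'. coeff ?E e * mps_supported (A \<union> B) (HL b (\<lambda>k. c (k + int e))))"
  proof (intro sum.cong refl arg_cong2[of _ _ _ _ "(*)"])
    fix e
    have "l \<notin> A \<union> B" using insert by auto
    from HL_yvar_relation[OF this, of b "\<lambda>k. c (k + int e)"]
    show "?F e - yvar b l * ?F (Suc e) = mps_supported (A \<union> B) (HL b (\<lambda>k. c (k + int e)))"
      by (simp add: algebra_simps)
  qed
  also have "\<dots> = mps_supported A (HL b c)"
    by (rule insert.IH) (use insert N in auto)
  finally show ?case .
qed

lemma HL_single_eta: "mps_supported {l} (eta b (int m)) = yvar b l ^ m"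
proof (induction m)
  case 0
  then show ?case by (simp add: eta_0)
next
  case (Suc m)
  have "eta b (int m) = HL b (\<lambda>k. if k + 1 = int (Suc m) then 1 else 0)"
    unfolding eta_def by (intro arg_cong[where f = "HL b"] ext) auto
  then show ?case
    using HL_yvar_relation[of l "{}" b "\<lambda>k. if k = int (Suc m) then 1 else 0"] Suc
    by (simp add: eta_def[symmetric] mps_supported_empty_eta)
qed

definition alternator :: "K \<Rightarrow> nat \<Rightarrow> K mps" where
  "alternator b n = detf n (\<lambda>i k. yvar b k ^ (n - Suc i))"

text \<open>The passage from Jacobi--Trudi determinants to alternants, for arbitrary row
  functionals. Multiplying by the matrix \<open>C\<close> of signed elementary functions in all
  variables but the one with index \<open>l\<close> reduces every entry of column \<open>l\<close>
  to this single variable.\<close>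

lemma HL_alternant:
  "mps_restrict n (detf n (\<lambda>i j. HL b (\<lambda>k. c i (k - int (Suc j))))) * alternator b n
    = detf n (\<lambda>i l. mps_supported {l} (HL b (\<lambda>k. c i (k - int n))))"
proof -
  define C where "C j l = coeff (\<Prod>l\<in>{..<n} - {l}. [:1, - yvar b l:]) (n - Suc j)" for j l
  have main: "mps_restrict n (detf n (\<lambda>i j. HL b (\<lambda>k. c i (k - int (Suc j))))) * detf n C
    = detf n (\<lambda>i l. mps_supported {l} (HL b (\<lambda>k. c i (k - int n))))" for c
  proof -
    have "mps_restrict n (detf n (\<lambda>i j. HL b (\<lambda>k. c i (k - int (Suc j))))) * detf n C
      = detf n (\<lambda>i l. \<Sum>j<n. mps_restrict n (HL b (\<lambda>k. c i (k - int (Suc j)))) * C j l)"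
      by (simp add: mps_restrict.hom_detf detf_mult)
    also have "\<dots> = detf n (\<lambda>i l. mps_supported {l} (HL b (\<lambda>k. c i (k - int n))))"
    proof (rule detf_cong)
      fix i l assume "i < n" "l < n"
      have "(\<Sum>j<n. mps_restrict n (HL b (\<lambda>k. c i (k - int (Suc j)))) * C j l)
        = (\<Sum>e\<le>n - 1. coeff (\<Prod>l\<in>{..<n} - {l}. [:1, - yvar b l:]) e *
            mps_restrict n (HL b (\<lambda>k. c i (k + int e - int n))))"
        by (rule sum.reindex_bij_witness[where i = "\<lambda>e. n - Suc e" and j = "\<lambda>j. n - Suc j"])
           (use \<open>l < n\<close> in \<open>auto simp: C_def of_nat_diff mult.commute algebra_simps\<close>)
      also have "\<dots> = mps_supported {l} (HL b (\<lambda>k. c i (k - int n)))"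
        using HL_elementary[of "{..<n} - {l}" "{l}" "n - 1" b "\<lambda>k. c i (k - int n)"] \<open>l < n\<close>
        by (simp add: mps_supported_lessThan[symmetric] insert_absorb)
      finally show "(\<Sum>j<n. mps_restrict n (HL b (\<lambda>k. c i (k - int (Suc j)))) * C j l)
        = mps_supported {l} (HL b (\<lambda>k. c i (k - int n)))" .
    qed
    finally show ?thesis .
  qed
  \<comment> \<open>The determinant of \<open>C\<close> comes from the identity just proved: for
    these special rows the matrix on the left is unitriangular, and the one-variable entries on the
    right are the powers of \<open>Y\<close> in the alternator.\<close>
  have "detf n (\<lambda>i j. HL b (\<lambda>k. if k - int (Suc j) = - int (Suc i) then 1 else 0))
    = detf n (\<lambda>i j. eta b (int j - int i))"
    unfolding eta_def by (intro detf_cong arg_cong[where f = "HL b"] ext) auto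
  also have "\<dots> = 1"
    by (subst detf_upper_triangular) (auto simp: eta_neg eta_0)
  finally have "detf n C = detf n (\<lambda>i l. mps_supported {l}
      (HL b (\<lambda>k. if k - int n = - int (Suc i) then 1 else 0)))"
    using main[of "\<lambda>i k. if k = - int (Suc i) then 1 else 0"] by simp
  also have "\<dots> = alternator b n"
    unfolding alternator_def
  proof (rule detf_cong)
    fix i l assume "i < n" "l < n"
    then have "HL b (\<lambda>k. if k - int n = - int (Suc i) then 1 else 0) = eta b (int (n - Suc i))"
      unfolding eta_def by (intro arg_cong[where f = "HL b"] ext) auto
    then show "mps_supported {l} (HL b (\<lambda>k. if k - int n = - int (Suc i) then 1 else 0))
      = yvar b l ^ (n - Suc i)"
      by (simp add: HL_single_eta)
  qed
  finally show ?thesis using main by simp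
qed

section \<open>The Vandermonde determinant\<close>

text \<open>Newton interpolation at the nodes \<open>z\<close>. The coefficients are chosen before
  \<open>x\<close>, so a matrix of powers factors into a unitriangular matrix and a matrix of Newton
  products.\<close>

lemma power_newton_expansion:
  fixes z :: "nat \<Rightarrow> 'a::comm_ring_1"
  shows "\<exists>a. a m = 1 \<and> (\<forall>x. x ^ m = (\<Sum>j\<le>m. a j * (\<Prod>l<j. x - z l)))"
proof (induction m)
  case (Suc m)
  then obtain a where a: "a m = 1" "\<And>x. x ^ m = (\<Sum>j\<le>m. a j * (\<Prod>l<j. x - z l))" by blast
  define a' where "a' j = (if j = 0 then 0 else a (j - 1)) + (if j \<le> m then z j * a j else 0)" for j
  have "x ^ Suc m = (\<Sum>j\<le>Suc m. a' j * (\<Prod>l<j. x - z l))" for x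
  proof -
    have "(\<Sum>j\<le>Suc m. a' j * (\<Prod>l<j. x - z l))
      = (\<Sum>j\<le>Suc m. (if j = 0 then 0 else a (j - 1)) * (\<Prod>l<j. x - z l))
        + (\<Sum>j\<le>Suc m. (if j \<le> m then z j * a j else 0) * (\<Prod>l<j. x - z l))"
      unfolding sum.distrib[symmetric] by (intro sum.cong) (auto simp: a'_def distrib_right)
    also have "(\<Sum>j\<le>Suc m. (if j = 0 then 0 else a (j - 1)) * (\<Prod>l<j. x - z l))
      = (\<Sum>j\<le>m. a j * ((\<Prod>l<j. x - z l) * (x - z j)))"
      by (subst sum.atMost_Suc_shift) simp
    also have "(\<Sum>j\<le>Suc m. (if j \<le> m then z j * a j else 0) * (\<Prod>l<j. x - z l))
      = (\<Sum>j\<le>m. z j * a j * (\<Prod>l<j. x - z l))"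
      by simp
    also have "(\<Sum>j\<le>m. a j * ((\<Prod>l<j. x - z l) * (x - z j))) + (\<Sum>j\<le>m. z j * a j * (\<Prod>l<j. x - z l))
      = x * x ^ m"
      unfolding a(2) sum_distrib_left sum.distrib[symmetric]
      by (intro sum.cong) (auto simp: algebra_simps)
    finally show ?thesis by simp
  qed
  moreover have "a' (Suc m) = 1" by (simp add: a'_def a)
  ultimately show ?case by blast
qed auto

lemma detf_vandermonde:
  fixes y :: "nat \<Rightarrow> 'a::comm_ring_1"
  shows "detf n (\<lambda>i k. y k ^ (n - Suc i)) = (\<Prod>j<n. \<Prod>i<j. y i - y j)"
proof -
  \<comment> \<open>The nodes are taken in reverse order, so that row \<open>i\<close> of the matrix
    of Newton products vanishes at all \<open>y k\<close> with \<open>k > i\<close>, which makes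
    this factor triangular too.\<close>
  define z where "z l = y (n - Suc l)" for l
  obtain a where a: "\<And>m. a m m = 1" "\<And>m x. x ^ m = (\<Sum>j\<le>m. a m j * (\<Prod>l<j. x - z l))"
    using power_newton_expansion[of _ z] by metis
  define A where "A i i' = (if i \<le> i' then a (n - Suc i) (n - Suc i') else 0)" for i i'
  define B where "B i' k = (\<Prod>l<n - Suc i'. y k - z l)" for i' k
  have "detf n (\<lambda>i k. y k ^ (n - Suc i)) = detf n (\<lambda>i k. \<Sum>i'<n. A i i' * B i' k)"
  proof (rule detf_cong)
    fix i k assume "i < n" "k < n"
    have "(\<Sum>i'<n. A i i' * B i' k) = (\<Sum>i'\<in>{i..<n}. A i i' * B i' k)"
      by (rule sum.mono_neutral_right) (auto simp: A_def)
    also have "\<dots> = (\<Sum>j\<le>n - Suc i. a (n - Suc i) j * (\<Prod>l<j. y k - z l))"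
      by (rule sum.reindex_bij_witness[where i = "\<lambda>j. n - Suc j" and j = "\<lambda>j. n - Suc j"])
         (use \<open>i < n\<close> in \<open>auto simp: A_def B_def\<close>)
    also have "\<dots> = y k ^ (n - Suc i)" by (rule a(2)[symmetric])
    finally show "y k ^ (n - Suc i) = (\<Sum>i'<n. A i i' * B i' k)" ..
  qed
  also have "\<dots> = detf n A * detf n B" by (rule detf_mult)
  also have "detf n A = 1"
    by (subst detf_upper_triangular) (auto simp: A_def a(1))
  also have "detf n B = (\<Prod>i<n. B i i)"
  proof (rule detf_lower_triangular)
    fix i j assume "i < j" "j < n"
    then have "n - Suc j \<in> {..<n - Suc i}" "y j - z (n - Suc j) = 0" by (auto simp: z_def)
    then show "B i j = 0" unfolding B_def by (intro prod_zero) auto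
  qed
  also have "(\<Prod>i<n. B i i) = (\<Prod>i<n. \<Prod>j\<in>{i<..<n}. y i - y j)"
  proof (rule prod.cong)
    fix i assume "i \<in> {..<n}"
    show "B i i = (\<Prod>j\<in>{i<..<n}. y i - y j)"
      unfolding B_def z_def
      by (rule prod.reindex_bij_witness[where i = "\<lambda>j. n - Suc j" and j = "\<lambda>j. n - Suc j"]) auto
  qed simp
  also have "\<dots> = (\<Prod>(i, j)\<in>(SIGMA i:{..<n}. {i<..<n}). y i - y j)"
    by (rule prod.Sigma) auto
  also have "\<dots> = (\<Prod>(j, i)\<in>(SIGMA j:{..<n}. {..<j}). y i - y j)"
    by (rule prod.reindex_bij_witness[where i = "\<lambda>(a, b). (b, a)" and j = "\<lambda>(a, b). (b, a)"]) auto
  also have "\<dots> = (\<Prod>j<n. \<Prod>i<j. y i - y j)"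
    by (rule prod.Sigma[symmetric]) auto
  finally show ?thesis by simp
qed

lemma alternator_0: "alternator 0 n = vandermonde n"
  by (simp add: alternator_def yvar_0 detf_vandermonde vandermonde_def)

text \<open>Reading off the coefficient at \<open>x_i M\<close> shows that the coefficient of
  \<open>f\<close> at \<open>M\<close> is unchanged when one \<open>j\<close> in \<open>M\<close> is
  replaced by \<open>i\<close>, and is zero when \<open>M\<close> contains no \<open>j\<close>.
  Induction on the multiplicity of \<open>j\<close> finishes.\<close>

lemma mps_var_diff_cancel:
  fixes f :: "K mps"
  assumes "i \<noteq> j" "(mps_var i - mps_var j) * f = 0"
  shows "f = 0"
proof (rule mps_eqI)
  fix M
  have *: "mps_coeff f M = (if j \<in># M then mps_coeff f (add_mset i (M - {#j#})) else 0)" for M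
  proof -
    have "mps_coeff ((mps_var i - mps_var j) * f) (add_mset i M) = 0"
      by (simp add: assms)
    then show ?thesis using assms(1) by (auto simp: left_diff_distrib)
  qed
  show "mps_coeff f M = mps_coeff 0 M"
  proof (induction "count M j" arbitrary: M)
    case 0
    then show ?case using *[of M] by (simp add: count_eq_zero_iff)
  next
    case (Suc m)
    then have "m = count (add_mset i (M - {#j#})) j" using assms(1) by simp
    from Suc(1)[OF this] show ?case using *[of M] by simp
  qed
qed

lemma vandermonde_cancel:
  assumes "f * vandermonde n = 0"
  shows "f = 0"
proof -
  have *: "f = 0" if "finite S" "f * (\<Prod>x\<in>S. g x) = 0" "\<And>x f. x \<in> S \<Longrightarrow> f * g x = 0 \<Longrightarrow> f = 0"
    for f :: "K mps" and g :: "nat \<Rightarrow> K mps" and S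
    using that
  proof (induction S arbitrary: f rule: finite_induct)
    case (insert x S)
    have "f * g x * (\<Prod>x\<in>S. g x) = 0" using insert by (simp add: mult.assoc)
    then have "f * g x = 0" using insert by blast
    then show ?case using insert by blast
  qed simp
  show ?thesis
  proof (rule *[OF _ assms[unfolded vandermonde_def]])
    fix j and f :: "K mps" assume "f * (\<Prod>i<j. mps_var i - mps_var j) = 0"
    moreover have "f = 0" if "i < j" "f * (mps_var i - mps_var j) = 0" for i and f :: "K mps"
      by (rule mps_var_diff_cancel[of i j]) (use that in \<open>simp_all add: mult.commute[of f]\<close>)
    ultimately show "f = 0" by (intro *[of "{..<j}" f "\<lambda>i. mps_var i - mps_var j"]) auto
  qed simp
qed

unbundle no m_inv_syntax

section \<open>Permutations of the variables\<close>

text \<open>Reading coefficients at the image monomial means that the variables themselves are moved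
  by the inverse permutation, see \<open>mps_perm_var\<close>.\<close>

definition mps_perm :: "(nat \<Rightarrow> nat) \<Rightarrow> 'a mps \<Rightarrow> 'a mps" where
  "mps_perm \<pi> f = Abs_mps (\<lambda>M. mps_coeff f (image_mset \<pi> M))"

lemma mps_coeff_perm [simp]: "mps_coeff (mps_perm \<pi> f) M = mps_coeff f (image_mset \<pi> M)"
  by (simp add: mps_perm_def)

lemma image_mset_inv:
  assumes "bij \<pi>"
  shows "image_mset \<pi> (image_mset (inv \<pi>) M) = M" "image_mset (inv \<pi>) (image_mset \<pi> M) = M"
  using assms by (simp_all add: multiset.map_comp comp_def surj_f_inv_f bij_is_surj bij_is_inj)

lemma comm_ring_hom_mps_perm:
  assumes "bij \<pi>"
  shows "comm_ring_hom (mps_perm \<pi> :: 'a::comm_ring_1 mps \<Rightarrow> 'a mps)"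
proof
  fix f g :: "'a mps"
  show "mps_perm \<pi> (f * g) = mps_perm \<pi> f * mps_perm \<pi> g"
  proof (rule mps_eqI)
    fix M
    have "mps_coeff (mps_perm \<pi> (f * g)) M
      = (\<Sum>A | A \<subseteq># image_mset \<pi> M. mps_coeff f A * mps_coeff g (image_mset \<pi> M - A))"
      by (simp add: mps_coeff_mult)
    also have "\<dots> = (\<Sum>A | A \<subseteq># M. mps_coeff f (image_mset \<pi> A) * mps_coeff g (image_mset \<pi> (M - A)))"
    proof (rule sum.reindex_bij_witness[where i = "image_mset \<pi>" and j = "image_mset (inv \<pi>)"], goal_cases)
      case (2 A)
      then show ?case using image_mset_subseteq_mono[of A "image_mset \<pi> M" "inv \<pi>"]
        by (simp add: image_mset_inv[OF assms])
    next
      case (5 A)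
      then have "image_mset (inv \<pi>) A \<subseteq># M"
        using image_mset_subseteq_mono[of A "image_mset \<pi> M" "inv \<pi>"]
        by (simp add: image_mset_inv[OF assms])
      then show ?case
        by (simp add: image_mset_inv[OF assms] image_mset_Diff)
    qed (auto simp: image_mset_inv[OF assms] image_mset_subseteq_mono)
    also have "\<dots> = mps_coeff (mps_perm \<pi> f * mps_perm \<pi> g) M"
      by (simp add: mps_coeff_mult)
    finally show "mps_coeff (mps_perm \<pi> (f * g)) M = mps_coeff (mps_perm \<pi> f * mps_perm \<pi> g) M" .
  qed
qed (rule mps_eqI, simp)+

definition mps_symmetric :: "K mps \<Rightarrow> bool" where
  "mps_symmetric f \<longleftrightarrow> (\<forall>\<pi>. bij \<pi> \<longrightarrow> mps_perm \<pi> f = f)"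

lemma mps_symmetric_iff:
  "mps_symmetric f \<longleftrightarrow> (\<forall>\<pi> M. bij \<pi> \<longrightarrow> mps_coeff f (image_mset \<pi> M) = mps_coeff f M)"
  by (auto simp: mps_symmetric_def mps_eq_iff)

lemma mps_symmetric_intros:
  "mps_symmetric 0" "mps_symmetric 1"
  "mps_symmetric f \<Longrightarrow> mps_symmetric g \<Longrightarrow> mps_symmetric (f + g)"
  "mps_symmetric f \<Longrightarrow> mps_symmetric g \<Longrightarrow> mps_symmetric (f - g)"
  "mps_symmetric f \<Longrightarrow> mps_symmetric g \<Longrightarrow> mps_symmetric (f * g)"
  "mps_symmetric (mps_const c)"
proof -
  have "mps_perm \<pi> (f + g) = mps_perm \<pi> f + mps_perm \<pi> g"
    "mps_perm \<pi> (f - g) = mps_perm \<pi> f - mps_perm \<pi> g"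
    "mps_perm \<pi> (f * g) = mps_perm \<pi> f * mps_perm \<pi> g" if "bij \<pi>" for \<pi>
  proof -
    interpret comm_ring_hom "mps_perm \<pi> :: K mps \<Rightarrow> K mps"
      by (rule comm_ring_hom_mps_perm[OF that])
    show "mps_perm \<pi> (f + g) = mps_perm \<pi> f + mps_perm \<pi> g"
      "mps_perm \<pi> (f - g) = mps_perm \<pi> f - mps_perm \<pi> g"
      "mps_perm \<pi> (f * g) = mps_perm \<pi> f * mps_perm \<pi> g"
      by (rule hom_add hom_minus hom_mult)+
  qed
  then show "mps_symmetric f \<Longrightarrow> mps_symmetric g \<Longrightarrow> mps_symmetric (f + g)"
    "mps_symmetric f \<Longrightarrow> mps_symmetric g \<Longrightarrow> mps_symmetric (f - g)"
    "mps_symmetric f \<Longrightarrow> mps_symmetric g \<Longrightarrow> mps_symmetric (f * g)"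
    by (auto simp: mps_symmetric_def)
qed (simp_all add: mps_symmetric_iff)

lemma mps_symmetric_sum: "(\<And>x. x \<in> S \<Longrightarrow> mps_symmetric (f x)) \<Longrightarrow> mps_symmetric (sum f S)"
  by (induction S rule: infinite_finite_induct) (auto intro: mps_symmetric_intros)

lemma mps_symmetric_detf:
  "(\<And>i j. i < n \<Longrightarrow> j < n \<Longrightarrow> mps_symmetric (e i j)) \<Longrightarrow> mps_symmetric (detf n e)"
  unfolding mps_symmetric_def
  by (auto simp: comm_ring_hom.hom_detf[OF comm_ring_hom_mps_perm] intro!: detf_cong)

lemma mps_symmetric_HL: "mps_symmetric (HL b c)"
  by (simp add: mps_symmetric_iff mps_coeff_HL wpoly_image bij_is_inj)

lemma mps_perm_var: "bij \<pi> \<Longrightarrow> mps_perm \<pi> (mps_var l) = (mps_var (inv \<pi> l) :: 'a::comm_ring_1 mps)"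
proof (rule mps_eqI)
  fix M assume \<pi>: "bij \<pi>"
  have "image_mset \<pi> M = {#l#} \<longleftrightarrow> M = {#inv \<pi> l#}"
    using image_mset_inv[OF \<pi>] by (metis image_mset_add_mset image_mset_empty)
  then show "mps_coeff (mps_perm \<pi> (mps_var l)) M = (mps_coeff (mps_var (inv \<pi> l)) M :: 'a)"
    by simp
qed

lemma mps_perm_vandermonde:
  assumes "\<pi> permutes {..<n}"
  shows "mps_perm \<pi> (vandermonde n) = of_int (sign \<pi>) * vandermonde n"
proof -
  have bij: "bij \<pi>" using assms by (rule permutes_bij)
  interpret comm_ring_hom "mps_perm \<pi> :: K mps \<Rightarrow> K mps"
    by (rule comm_ring_hom_mps_perm[OF bij])
  have "mps_perm \<pi> (vandermonde n) = detf n (\<lambda>i k. mps_var (inv \<pi> k) ^ (n - Suc i))"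
    by (simp add: alternator_0[symmetric] alternator_def yvar_0 hom_detf hom_power mps_perm_var[OF bij])
  also have "\<dots> = detf n (\<lambda>k i. mps_var (inv \<pi> k) ^ (n - Suc i))"
    by (rule detf_transpose)
  also have "\<dots> = of_int (sign (inv \<pi>)) * detf n (\<lambda>k i. mps_var k ^ (n - Suc i))"
    by (rule detf_permute_rows) (rule permutes_inv[OF assms])
  also have "detf n (\<lambda>k i. mps_var k ^ (n - Suc i)) = vandermonde n"
    by (subst detf_transpose) (simp add: alternator_0[symmetric] alternator_def yvar_0)
  also have "sign (inv \<pi>) = sign \<pi>"
    using assms by (meson finite_lessThan permutation_permutes sign_inverse)
  finally show ?thesis .
qed

lemma mps_perm_restrict:
  assumes "\<pi> permutes {..<n}"
  shows "mps_perm \<pi> (mps_restrict n f) = mps_restrict n (mps_perm \<pi> (f :: K mps))"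
proof (rule mps_eqI)
  fix M
  have "\<pi> ` set_mset M \<subseteq> {..<n} \<longleftrightarrow> set_mset M \<subseteq> {..<n}"
    using permutes_in_image[OF assms] by (auto simp: subset_iff)
  then show "mps_coeff (mps_perm \<pi> (mps_restrict n f)) M = mps_coeff (mps_restrict n (mps_perm \<pi> f)) M"
    by simp
qed

section \<open>Monomials and partitions\<close>

definition mon :: "nat \<Rightarrow> (nat \<Rightarrow> nat) \<Rightarrow> nat multiset" where
  "mon n e = (\<Sum>l<n. replicate_mset (e l) l)"

lemma count_mon [simp]: "count (mon n e) l = (if l < n then e l else 0)"
  by (simp add: mon_def count_sum)

lemma size_mon: "size (mon n e) = (\<Sum>l<n. e l)"
  by (simp add: mon_def size_multiset_sum)

lemma set_mset_mon: "set_mset (mon n e) \<subseteq> {..<n}"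
  by (auto simp: count_greater_zero_iff[symmetric] simp del: count_greater_zero_iff split: if_splits)

lemma mon_eq_iff: "mon n e = mon n e' \<longleftrightarrow> (\<forall>l<n. e l = e' l)"
  by (auto simp: multiset_eq_iff)

lemma mon_count: "set_mset M \<subseteq> {..<n} \<Longrightarrow> mon n (count M) = M"
proof (rule multiset_eqI)
  fix l assume "set_mset M \<subseteq> {..<n}"
  then show "count (mon n (count M)) l = count M l"
    using count_inI[of M l] by (cases "l < n") auto
qed

lemma image_mset_mon:
  assumes "\<pi> permutes {..<n}"
  shows "image_mset \<pi> (mon n e) = mon n (\<lambda>l. e (inv \<pi> l))"
proof -
  have "image_mset \<pi> (mon n e) = (\<Sum>l<n. replicate_mset (e l) (\<pi> l))"
    unfolding mon_def by (induction n) auto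
  also have "\<dots> = (\<Sum>l<n. replicate_mset (e (inv \<pi> l)) l)"
    by (rule sum.reindex_bij_witness[where i = "inv \<pi>" and j = \<pi>])
       (use assms permutes_inverses[OF assms] permutes_in_image[OF permutes_inv[OF assms]]
         permutes_in_image[OF assms] in auto)
  finally show ?thesis by (simp add: mon_def)
qed

lemma sorting_permutation:
  fixes f :: "nat \<Rightarrow> 'a::linorder"
  assumes "inj_on f {..<n}"
  shows "\<exists>\<pi>. \<pi> permutes {..<n} \<and> (\<forall>i j. i < j \<longrightarrow> j < n \<longrightarrow> f (\<pi> j) < f (\<pi> i))"
proof -
  define xs where "xs = map f [0..<n]"
  define ys where "ys = rev (sort xs)"
  have "mset ys = mset xs" by (simp add: ys_def)
  from mset_eq_permutation[OF this] obtain \<pi> where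
    \<pi>: "\<pi> permutes {..<length xs}" "permute_list \<pi> xs = ys" by blast
  have len: "length xs = n" "length ys = n" by (simp_all add: xs_def ys_def)
  have ys: "ys ! i = f (\<pi> i)" if "i < n" for i
  proof -
    have "\<pi> i < n" using permutes_in_image[OF \<pi>(1), of i] that len by simp
    then show ?thesis
      using permute_list_nth[OF \<pi>(1), of i] that len \<pi>(2) by (simp add: xs_def)
  qed
  have "distinct xs" using assms by (simp add: xs_def distinct_map lessThan_atLeast0)
  then have "sorted_wrt (<) (sort xs)"
    by (simp add: strict_sorted_iff)
  then have "sorted_wrt (\<lambda>x y. y < x) ys"
    by (simp add: ys_def sorted_wrt_rev)
  then have "ys ! j < ys ! i" if "i < j" "j < n" for i j
    using that len by (auto dest: sorted_wrt_nth_less)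
  then show ?thesis using \<pi>(1) ys len by (auto intro!: exI[of _ \<pi>])
qed

text \<open>Such a \<open>\<pi>\<close> preserves the order, and an increasing permutation of an
  initial segment is the identity. This singles out the diagonal term of an alternant.\<close>

lemma strictly_decreasing_permutation:
  fixes e e' :: "nat \<Rightarrow> 'a::linorder"
  assumes "\<pi> permutes {..<n}"
    and "\<And>i j. i < j \<Longrightarrow> j < n \<Longrightarrow> e j < e i" "\<And>i j. i < j \<Longrightarrow> j < n \<Longrightarrow> e' j < e' i"
    and "\<And>i. i < n \<Longrightarrow> e (\<pi> i) = e' i"
  shows "\<pi> = id"
proof -
  have in_n: "\<pi> i < n \<longleftrightarrow> i < n" for i using permutes_in_image[OF assms(1), of i] by simp
  have mono: "\<pi> i < \<pi> j" if "i < j" "j < n" for i j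
  proof (rule ccontr)
    assume "\<not> \<pi> i < \<pi> j"
    moreover have "\<pi> i \<noteq> \<pi> j" using that permutes_inj[OF assms(1)] by (auto dest: injD)
    ultimately have "\<pi> j < \<pi> i" by simp
    then have "e (\<pi> i) < e (\<pi> j)" using assms(2) that in_n by simp
    then show False using assms(3)[OF that] assms(4) that by (auto dest: order.strict_trans)
  qed
  have ge: "i \<le> \<pi> i" if "i < n" for i
    using that
  proof (induction i)
    case (Suc i)
    then show ?case using mono[of i "Suc i"] by simp
  qed simp
  have "\<pi> i = i" if "i < n" for i
    using that
  proof (induction "n - i" arbitrary: i rule: less_induct)
    case less
    show ?case
    proof (rule ccontr)
      assume "\<pi> i \<noteq> i"
      then have "i < \<pi> i" using ge[OF less(2)] by simp
      then have "\<pi> (\<pi> i) = \<pi> i" using less in_n by simp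
      then have "\<pi> i = i" using permutes_inj[OF assms(1)] by (auto dest: injD)
      then show False using \<open>i < \<pi> i\<close> by simp
    qed
  qed
  then show ?thesis using assms(1) by (metis eq_id_iff lessThan_iff permutes_not_in)
qed

section \<open>Partitions as decreasing sequences\<close>

lemma Par_part_decreasing: "lam \<in> Par \<Longrightarrow> 0 < i \<Longrightarrow> i \<le> j \<Longrightarrow> part lam j \<le> part lam i"
  using sorted_wrt_nth_less[of "(\<ge>)" lam "i - 1" "j - 1"]
  by (cases "i = j") (auto simp: Par_def part_def)

lemma part_eq_0_iff: "lam \<in> Par \<Longrightarrow> 0 < i \<Longrightarrow> part lam i = 0 \<longleftrightarrow> length lam < i"
proof -
  assume "lam \<in> Par" "0 < i"
  then have "lam ! (i - 1) \<noteq> 0" if "i \<le> length lam"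
    using nth_mem[of "i - 1" lam] that by (metis (no_types, lifting) Par_def Suc_pred' Suc_le_lessD
        diff_Suc_1 mem_Collect_eq One_nat_def)
  then show "part lam i = 0 \<longleftrightarrow> length lam < i"
    using \<open>0 < i\<close> by (auto simp: part_def)
qed

lemma Par_eqI:
  assumes "lam \<in> Par" "mu \<in> Par" "\<And>i. part lam (Suc i) = part mu (Suc i)"
  shows "lam = mu"
proof -
  have "length lam < Suc i \<longleftrightarrow> length mu < Suc i" for i
    using part_eq_0_iff[OF assms(1), of "Suc i"] part_eq_0_iff[OF assms(2), of "Suc i"] assms(3)
    by simp
  then have "length lam = length mu"
    by (metis less_Suc_eq_le order_antisym order_refl)
  then show ?thesis
  proof (rule nth_equalityI)
    fix i assume "i < length lam"
    then show "lam ! i = mu ! i" using assms(3)[of i] \<open>length lam = length mu\<close>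
      by (simp add: part_def)
  qed
qed

lemma Par_exists:
  assumes "\<And>i j. i < j \<Longrightarrow> j < n \<Longrightarrow> p j \<le> (p i :: nat)"
  shows "\<exists>lam\<in>Par. length lam \<le> n \<and> (\<forall>i<n. part lam (Suc i) = p i)"
proof -
  define m where "m = (LEAST i. n \<le> i \<or> p i = 0)"
  have m: "n \<le> m \<or> p m = 0" unfolding m_def by (rule LeastI[of _ n]) simp
  have m': "i < n \<and> p i \<noteq> 0" if "i < m" for i
    using not_less_Least[OF that[unfolded m_def]] by auto
  have "m \<le> n" unfolding m_def by (rule Least_le) simp
  have zero: "p i = 0" if "m \<le> i" "i < n" for i
    using m that assms[of m i] by (cases "m = i") auto
  have "map p [0..<m] \<in> Par"
    using m' assms \<open>m \<le> n\<close> by (force simp: Par_def sorted_wrt_iff_nth_less)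
  moreover have "part (map p [0..<m]) (Suc i) = p i" if "i < n" for i
    using zero[of i] that by (auto simp: part_def)
  ultimately show ?thesis using \<open>m \<le> n\<close> by (intro bexI[of _ "map p [0..<m]"]) auto
qed

text \<open>The sequence \<open>f i + i + 1\<close> is weakly decreasing because \<open>f\<close>
  drops by at least one in each step, and nonnegative because its last term is. Row indices sorted
  into decreasing order thus come from a partition.\<close>

lemma Par_exists_shifted:
  assumes "\<And>i j. i < j \<Longrightarrow> j < n \<Longrightarrow> f j < (f i :: int)" "\<And>i. i < n \<Longrightarrow> - int n \<le> f i"
  shows "\<exists>lam\<in>Par. length lam \<le> n \<and> (\<forall>i<n. f i = int (part lam (Suc i)) - int (Suc i))"
proof -
  have *: "f (i + d) + int d \<le> f i" if "i + d < n" for i d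
    using that
  proof (induction d)
    case (Suc d)
    then show ?case using assms(1)[of "i + d" "i + Suc d"] by simp
  qed simp
  have ge: "0 \<le> f i + int (Suc i)" if "i < n" for i
    using *[of i "n - Suc i"] assms(2)[of "i + (n - Suc i)"] that by (simp add: of_nat_diff)
  obtain lam where "lam \<in> Par" "length lam \<le> n" "\<forall>i<n. part lam (Suc i) = nat (f i + int (Suc i))"
  proof (rule bexE[OF Par_exists[of n "\<lambda>i. nat (f i + int (Suc i))"]])
    fix i j :: nat assume "i < j" "j < n"
    then show "nat (f j + int (Suc j)) \<le> nat (f i + int (Suc i))"
      using *[of i "j - i"] by (simp add: nat_mono of_nat_diff)
  qed auto
  then show ?thesis using ge by (intro bexI[of _ lam]) auto
qed

section \<open>Jacobi--Trudi determinants\<close>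

text \<open>Row \<open>i\<close> is the functional sending \<open>w\<^sup>q\<close> to \<open>c i q\<close>; column \<open>j\<close> is the generating series times \<open>w\<^bsup>-j-1\<^esup>\<close>.\<close>

definition JT :: "K \<Rightarrow> (nat \<Rightarrow> int \<Rightarrow> K) \<Rightarrow> nat \<Rightarrow> K mps" where
  "JT b c r = detf r (\<lambda>i j. HL b (\<lambda>k. c i (k - int (Suc j))))"

text \<open>With these rows \<open>JT b\<close> is the determinant of the complete homogeneous
  functions in \<open>Y = x / (1 + b x)\<close>, so it is a Schur function evaluated at the
  \<open>Y\<close>; \<open>b = 0\<close> gives the Schur function itself.\<close>

definition schur_row :: "nat list \<Rightarrow> nat \<Rightarrow> int \<Rightarrow> K" where
  "schur_row lam i q = (if q = int (part lam (Suc i)) - int (Suc i) then 1 else 0)"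

definition expo :: "nat \<Rightarrow> nat list \<Rightarrow> nat \<Rightarrow> nat" where
  "expo n lam i = part lam (Suc i) + n - Suc i"

lemma detf_last_row:
  assumes "\<And>j. j < n \<Longrightarrow> e n j = 0" "e n n = 1"
  shows "detf (Suc n) e = detf n e"
proof -
  let ?A = "mat (Suc n) (Suc n) (\<lambda>(i, j). e i j)"
  have "detf (Suc n) e = (\<Sum>j<Suc n. ?A $$ (n, j) * cofactor ?A n j)"
    unfolding detf_def by (rule laplace_expansion_row) auto
  also have "\<dots> = cofactor ?A n n"
    using assms by simp
  also have "\<dots> = det (mat_delete ?A n n)"
    by (simp add: cofactor_def mult_2[symmetric])
  also have "mat_delete ?A n n = mat n n (\<lambda>(i, j). e i j)"
    by (auto simp: mat_delete_def intro!: eq_matI)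
  finally show ?thesis by (simp add: detf_def)
qed

lemma HL_delta: "HL b (\<lambda>k. if k - x = m then 1 else 0) = eta b (m + x)"
  unfolding eta_def by (intro arg_cong[where f = "HL b"] ext) auto

text \<open>The hypothesis makes the entries of a row beyond \<open>l\<close> equal to
  \<open>eta b (j - i)\<close>: zero left of the diagonal and one on it. The last row and column can
  therefore be dropped one after the other.\<close>

lemma JT_stable:
  assumes "\<And>i q. l \<le> i \<Longrightarrow> c i q = (if q = - int (Suc i) then 1 else 0)" "l \<le> r"
  shows "JT b c r = JT b c l"
  using assms(2)
proof (induction r rule: dec_induct)
  case (step r)
  have "JT b c (Suc r) = JT b c r"
    unfolding JT_def
    by (rule detf_last_row; unfold assms(1)[OF step(1)] HL_delta) (simp_all add: eta_neg eta_0)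
  with step show ?case by simp
qed simp

lemma schur_row_tail: "length lam \<le> i \<Longrightarrow> schur_row lam i q = (if q = - int (Suc i) then 1 else 0)"
  by (simp add: schur_row_def part_def)

lemma JT_schur_eta:
  "JT b (schur_row lam) r = detf r (\<lambda>i j. eta b (int (part lam (Suc i)) - int (Suc i) + int (Suc j)))"
  unfolding JT_def schur_row_def by (simp only: HL_delta)

lemma mps_symmetric_JT: "mps_symmetric (JT b c r)"
  unfolding JT_def by (intro mps_symmetric_detf mps_symmetric_HL)

lemma JT_schur_alternant:
  assumes "length lam \<le> n"
  shows "mps_restrict n (JT b (schur_row lam) n) * alternator b n = detf n (\<lambda>i l. yvar b l ^ expo n lam i)"
  unfolding JT_def HL_alternant
proof (rule detf_cong)
  fix i l assume "i < n" "l < n"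
  then have "int (part lam (Suc i)) - int (Suc i) + int n = int (expo n lam i)"
    by (simp add: expo_def of_nat_diff)
  then show "mps_supported {l} (HL b (\<lambda>k. schur_row lam i (k - int n))) = yvar b l ^ expo n lam i"
    unfolding schur_row_def HL_delta by (simp only: HL_single_eta)
qed

lemma mps_eqI_vandermonde:
  assumes "\<And>n. n \<ge> N \<Longrightarrow> mps_restrict n f * vandermonde n = mps_restrict n g * vandermonde n"
  shows "f = g"
proof (rule mps_eqI_restrict)
  fix n assume "N \<le> n"
  then have "(mps_restrict n f - mps_restrict n g) * vandermonde n = 0"
    using assms by (simp add: left_diff_distrib)
  then show "mps_restrict n f = mps_restrict n g"
    using vandermonde_cancel by fastforce
qed

lemma schur_eq_JT:
  assumes "length lam \<le> r"
  shows "schur lam = JT 0 (schur_row lam) r"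
proof -
  have stable: "JT 0 (schur_row lam) n = JT 0 (schur_row lam) (length lam)" if "length lam \<le> n" for n
    by (rule JT_stable) (use that schur_row_tail in auto)
  have det: "det (mat1 n (\<lambda>i j. mps_var (i - 1) ^ (part lam j + n - j)))
    = detf n (\<lambda>i l. mps_var l ^ expo n lam i)" for n
    unfolding det_mat1 expo_def by (subst detf_transpose[symmetric]) simp
  have "schur lam = JT 0 (schur_row lam) (length lam)"
    unfolding schur_def
  proof (rule the_equality)
    show *: "\<forall>n\<ge>length lam. mps_restrict n (JT 0 (schur_row lam) (length lam)) * vandermonde n
      = det (mat1 n (\<lambda>i j. mps_var (i - 1) ^ (part lam j + n - j)))"
    proof (intro allI impI)
      fix n assume n: "length lam \<le> n"
      show "mps_restrict n (JT 0 (schur_row lam) (length lam)) * vandermonde n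
        = det (mat1 n (\<lambda>i j. mps_var (i - 1) ^ (part lam j + n - j)))"
        using JT_schur_alternant[OF n, of 0] unfolding det stable[OF n] by (simp add: yvar_0 alternator_0)
    qed
    show "f = JT 0 (schur_row lam) (length lam)" if "\<forall>n\<ge>length lam. mps_restrict n f * vandermonde n
      = det (mat1 n (\<lambda>i j. mps_var (i - 1) ^ (part lam j + n - j)))" for f
      by (rule mps_eqI_vandermonde[of "length lam"]) (use that * in simp)
  qed
  with stable[OF assms] show ?thesis by simp
qed

lemma schur_alternant:
  assumes "length lam \<le> n"
  shows "mps_restrict n (schur lam) * vandermonde n = detf n (\<lambda>i l. mps_var l ^ expo n lam i)"
  using JT_schur_alternant[OF assms, of 0] schur_eq_JT[OF assms] by (simp add: yvar_0 alternator_0)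

lemma mps_symmetric_schur: "mps_symmetric (schur lam)"
  using schur_eq_JT[of lam "length lam"] mps_symmetric_JT by simp

section \<open>Homogeneous series\<close>

text \<open>The degree is an integer because Jacobi--Trudi matrices contain entries of negative
  nominal degree. These are zero, and zero is homogeneous of every degree.\<close>

definition mps_homogeneous :: "int \<Rightarrow> K mps \<Rightarrow> bool" where
  "mps_homogeneous k f \<longleftrightarrow> (\<forall>M. mps_coeff f M \<noteq> 0 \<longrightarrow> int (size M) = k)"

lemma mps_homogeneous_mult:
  assumes "mps_homogeneous k f" "mps_homogeneous l g"
  shows "mps_homogeneous (k + l) (f * g)"
  unfolding mps_homogeneous_def
proof (intro allI impI)
  fix M assume "mps_coeff (f * g) M \<noteq> 0"
  then obtain A where A: "A \<subseteq># M" "mps_coeff f A \<noteq> 0" "mps_coeff g (M - A) \<noteq> 0"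
    unfolding mps_coeff_mult by (metis (mono_tags, lifting) mem_Collect_eq mult_zero_left mult_zero_right sum.neutral)
  then have "int (size A) = k" "int (size (M - A)) = l"
    using assms by (auto simp: mps_homogeneous_def)
  moreover have "size M = size A + size (M - A)"
    using A by (metis size_union subset_mset.add_diff_inverse)
  ultimately show "int (size M) = k + l" by simp
qed

lemma mps_homogeneous_prod:
  "(\<And>x. x \<in> S \<Longrightarrow> mps_homogeneous (k x) (f x)) \<Longrightarrow> mps_homogeneous (\<Sum>x\<in>S. k x) (\<Prod>x\<in>S. f x)"
proof (induction S rule: infinite_finite_induct)
  case (insert x S)
  then show ?case using mps_homogeneous_mult by simp
qed (auto simp: mps_homogeneous_def)

lemma mps_homogeneous_sum:
  "(\<And>x. x \<in> S \<Longrightarrow> mps_homogeneous k (f x)) \<Longrightarrow> mps_homogeneous k (\<Sum>x\<in>S. f x)"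
  unfolding mps_homogeneous_def mps_coeff_sum by (metis sum.neutral)

lemma mps_coeff_of_int_mult [simp]: "mps_coeff (of_int m * f) M = of_int m * mps_coeff f M"
  by (metis mps_const.hom_of_int mps_coeff_const_mult)

lemma sum_permutes_lessThan:
  assumes "\<pi> permutes {..<n}"
  shows "(\<Sum>i<n. a i + d (\<pi> i)) = (\<Sum>i<n. a i + d i :: 'a::comm_monoid_add)"
  using sum.permute[OF assms, of d] by (simp add: sum.distrib comp_def)

lemma mps_homogeneous_detf:
  assumes "\<And>i j. i < n \<Longrightarrow> j < n \<Longrightarrow> mps_homogeneous (a i + d j) (e i j)"
  shows "mps_homogeneous (\<Sum>i<n. a i + d i) (detf n e)"
  unfolding detf_leibniz
proof (rule mps_homogeneous_sum)
  fix \<pi> assume "\<pi> \<in> {\<pi>. \<pi> permutes {..<n}}"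
  then have \<pi>: "\<pi> permutes {..<n}" by simp
  have "mps_homogeneous (\<Sum>i<n. a i + d (\<pi> i)) (\<Prod>i<n. e i (\<pi> i))"
    by (rule mps_homogeneous_prod) (use assms permutes_in_image[OF \<pi>] in auto)
  then show "mps_homogeneous (\<Sum>i<n. a i + d i) (of_int (sign \<pi>) * (\<Prod>i<n. e i (\<pi> i)))"
    unfolding sum_permutes_lessThan[OF \<pi>] by (auto simp: mps_homogeneous_def)
qed

lemma sum_part: "length lam \<le> n \<Longrightarrow> (\<Sum>i<n. part lam (Suc i)) = sum_list lam"
proof -
  assume "length lam \<le> n"
  then have "(\<Sum>i<n. part lam (Suc i)) = (\<Sum>i<length lam. part lam (Suc i))"
    by (intro sum.mono_neutral_right) (auto simp: part_def)
  also have "\<dots> = (\<Sum>i<length lam. lam ! i)" by (simp add: part_def)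
  finally show ?thesis by (simp add: sum_list_sum_nth lessThan_atLeast0)
qed

lemma mps_homogeneous_schur: "mps_homogeneous (int (sum_list lam)) (schur lam)"
proof -
  let ?n = "length lam"
  have "mps_homogeneous (\<Sum>i<?n. (int (part lam (Suc i)) - int (Suc i)) + int (Suc i)) (schur lam)"
    unfolding schur_eq_JT[OF order_refl] JT_schur_eta
    by (rule mps_homogeneous_detf) (auto simp: mps_homogeneous_def mps_coeff_h split: if_splits)
  then show ?thesis by (simp add: of_nat_sum[symmetric] sum_part del: of_nat_sum)
qed

lemma mps_homogeneous_vandermonde: "mps_homogeneous (\<Sum>i<n. int (n - Suc i)) (vandermonde n)"
proof -
  have "mps_homogeneous (\<Sum>i<n. int (n - Suc i) + 0) (vandermonde n)"
    unfolding alternator_0[symmetric] alternator_def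
    by (rule mps_homogeneous_detf) (auto simp: mps_homogeneous_def yvar_0 mps_var_power split: if_splits)
  then show ?thesis by simp
qed

section \<open>Schur coefficients by alternants\<close>

text \<open>Independent of \<open>n\<close> once \<open>n\<close> is at least the length of the partition.\<close>

definition cfn :: "nat \<Rightarrow> K mps \<Rightarrow> nat list \<Rightarrow> K" where
  "cfn n f lam = mps_coeff (mps_restrict n f * vandermonde n) (mon n (expo n lam))"

lemma size_mon_expo: "length lam \<le> n \<Longrightarrow> size (mon n (expo n lam)) = sum_list lam + (\<Sum>i<n. n - Suc i)"
proof -
  assume "length lam \<le> n"
  moreover have "(\<Sum>i<n. expo n lam i) = (\<Sum>i<n. part lam (Suc i)) + (\<Sum>i<n. n - Suc i)"
    unfolding sum.distrib[symmetric] by (intro sum.cong) (auto simp: expo_def)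
  ultimately show ?thesis by (simp add: size_mon sum_part)
qed

lemma cfn_linear:
  "cfn n 0 lam = 0"
  "cfn n (f + g) lam = cfn n f lam + cfn n g lam"
  "cfn n (f - g) lam = cfn n f lam - cfn n g lam"
  "cfn n (mps_const x * f) lam = x * cfn n f lam"
proof -
  have "mps_restrict n (mps_const x) = mps_const x" by (rule mps_eqI) simp
  then show "cfn n (mps_const x * f) lam = x * cfn n f lam"
    by (simp add: cfn_def mps_restrict.hom_mult mult.assoc)
qed (simp_all add: cfn_def mps_restrict.hom_add mps_restrict.hom_minus distrib_right left_diff_distrib)

lemma cfn_sum: "cfn n (\<Sum>x\<in>S. f x) lam = (\<Sum>x\<in>S. cfn n (f x) lam)"
  by (induction S rule: infinite_finite_induct) (auto simp: cfn_linear)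

text \<open>The Vandermonde product is homogeneous, so only the component of \<open>f\<close> of
  degree \<open>sum_list lam\<close> reaches the monomial at which \<open>cfn\<close> looks.\<close>

lemma cfn_local:
  assumes "length lam \<le> n" "\<And>M. size M = sum_list lam \<Longrightarrow> mps_coeff f M = mps_coeff g M"
  shows "cfn n f lam = cfn n g lam"
  unfolding cfn_def mps_coeff_mult
proof (rule sum.cong[OF refl])
  let ?M = "mon n (expo n lam)"
  fix A assume "A \<in> {A. A \<subseteq># ?M}"
  then have A: "A \<subseteq># ?M" by simp
  show "mps_coeff (mps_restrict n f) A * mps_coeff (vandermonde n) (?M - A)
    = mps_coeff (mps_restrict n g) A * mps_coeff (vandermonde n) (?M - A)"
  proof (cases "mps_coeff (vandermonde n) (?M - A) = 0")
    case False
    then have "int (size (?M - A)) = (\<Sum>i<n. int (n - Suc i))"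
      using mps_homogeneous_vandermonde[of n] by (simp add: mps_homogeneous_def)
    then have "size (?M - A) = (\<Sum>i<n. n - Suc i)" by (metis of_nat_eq_iff of_nat_sum)
    moreover have "size ?M = size A + size (?M - A)"
      using A by (metis size_union subset_mset.add_diff_inverse)
    ultimately have "size A = sum_list lam" using size_mon_expo[OF assms(1)] by simp
    then show ?thesis using assms(2) by simp
  qed simp
qed

lemma sum_eq_single:
  assumes "finite S" "a \<in> S" "\<And>x. x \<in> S \<Longrightarrow> f x = (if x = a then c else 0)"
  shows "sum f S = (c :: 'b::comm_monoid_add)"
proof -
  have "sum f S = (\<Sum>x\<in>S. if x = a then c else 0)" by (rule sum.cong) (simp_all add: assms(3))
  then show ?thesis using assms(1,2) by simp
qed

text \<open>Among the rearrangements of a strictly decreasing exponent vector only the vector itself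
  is strictly decreasing, so at most the identity contributes to the Leibniz sum.\<close>

lemma alternant_coeff:
  assumes "\<And>i j. i < j \<Longrightarrow> j < n \<Longrightarrow> e j < e i" "\<And>i j. i < j \<Longrightarrow> j < n \<Longrightarrow> e' j < e' i"
  shows "mps_coeff (detf n (\<lambda>i l. mps_var l ^ e i) :: K mps) (mon n e') = (if \<forall>l<n. e l = e' l then 1 else 0)"
proof -
  have monom: "(\<Prod>i<n. mps_var (\<pi> i) ^ e i :: K mps) = mps_monom (mon n (\<lambda>l. e (inv \<pi> l)))"
    if "\<pi> permutes {..<n}" for \<pi>
  proof -
    have "(\<Prod>i<n. mps_var (\<pi> i) ^ e i :: K mps) = mps_monom (\<Sum>i<n. replicate_mset (e i) (\<pi> i))"
      by (simp add: mps_var_power mps_monom_prod)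
    also have "(\<Sum>i<n. replicate_mset (e i) (\<pi> i)) = image_mset \<pi> (mon n e)"
      unfolding mon_def by (induction n) auto
    finally show ?thesis by (simp add: image_mset_mon[OF that])
  qed
  show ?thesis
    unfolding detf_leibniz mps_coeff_sum
  proof (rule sum_eq_single[where a = id])
    fix \<pi> assume "\<pi> \<in> {\<pi>. \<pi> permutes {..<n}}"
    then have \<pi>: "\<pi> permutes {..<n}" by blast
    have id: "\<pi> = id" if "\<forall>l<n. e' l = e (inv \<pi> l)"
    proof -
      have "inv \<pi> = id"
        by (rule strictly_decreasing_permutation[of _ n e e', OF permutes_inv[OF \<pi>] assms]) (use that in auto)
      then show ?thesis using \<pi> by (metis inv_id permutes_inv_inv)
    qed
    have coeff: "mps_coeff (of_int (sign \<pi>) * (\<Prod>i<n. mps_var (\<pi> i) ^ e i) :: K mps) (mon n e')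
      = of_int (sign \<pi>) * (if \<forall>l<n. e' l = e (inv \<pi> l) then 1 else 0)"
      by (simp only: monom[OF \<pi>] mps_coeff_of_int_mult mps_coeff_monom mon_eq_iff)
    show "mps_coeff (of_int (sign \<pi>) * (\<Prod>i<n. mps_var (\<pi> i) ^ e i) :: K mps) (mon n e')
      = (if \<pi> = id then (if \<forall>l<n. e l = e' l then 1 else 0) else 0)"
    proof (cases "\<pi> = id")
      case True
      then have "(\<forall>l<n. e' l = e (inv \<pi> l)) \<longleftrightarrow> (\<forall>l<n. e l = e' l)" by auto
      moreover have "sign \<pi> = 1" using True by simp
      ultimately show ?thesis using True
        coeff by (simp only: of_int_1 mult_1_left simp_thms if_True)
    next
      case False
      then have "\<not> (\<forall>l<n. e' l = e (inv \<pi> l))" using id by blast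
      then show ?thesis using False
        coeff by (simp only: mult_zero_right simp_thms if_False)
    qed
  next
    show "finite {\<pi>. \<pi> permutes {..<n}}" by (rule finite_permutations) (rule finite_lessThan)
  next
    show "id \<in> {\<pi>. \<pi> permutes {..<n}}" by (rule CollectI) (rule permutes_id)
  qed
qed

lemma expo_decreasing: "lam \<in> Par \<Longrightarrow> i < j \<Longrightarrow> j < n \<Longrightarrow> expo n lam j < expo n lam i"
  using Par_part_decreasing[of lam "Suc i" "Suc j"] by (simp add: expo_def)

lemma expo_eq_iff:
  assumes "lam \<in> Par" "mu \<in> Par" "length lam \<le> n" "length mu \<le> n"
  shows "(\<forall>l<n. expo n lam l = expo n mu l) \<longleftrightarrow> lam = mu"
proof
  assume *: "\<forall>l<n. expo n lam l = expo n mu l"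
  show "lam = mu"
  proof (rule Par_eqI[OF assms(1,2)])
    fix i
    show "part lam (Suc i) = part mu (Suc i)"
    proof (cases "i < n")
      case True
      with * have "expo n lam i = expo n mu i" by blast
      with True show ?thesis by (simp add: expo_def)
    next
      case False
      then show ?thesis using assms by (simp add: part_def)
    qed
  qed
qed simp

lemma cfn_schur:
  assumes "lam \<in> Par" "mu \<in> Par" "length lam \<le> n" "length mu \<le> n"
  shows "cfn n (schur mu) lam = (if lam = mu then 1 else 0)"
  unfolding cfn_def schur_alternant[OF assms(4)]
  using alternant_coeff[of n "expo n mu" "expo n lam"] expo_decreasing assms expo_eq_iff[OF assms(2,1,4,3)]
  by auto

text \<open>Setting the last variable to zero turns each new factor \<open>x_i - x_n\<close> into
  \<open>x_i\<close>.\<close>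

lemma vandermonde_Suc:
  "mps_restrict n (vandermonde (Suc n)) = vandermonde n * mps_monom (mon n (\<lambda>_. 1))"
proof -
  have *: "mps_restrict n (vandermonde n) = vandermonde n"
    and **: "mps_restrict n (\<Prod>i<n. mps_var i - mps_var n :: K mps) = mps_monom (mon n (\<lambda>_. 1))"
  proof -
    have var: "mps_restrict n (mps_var i) = (if i < n then mps_var i else 0 :: K mps)" for i
      by (rule mps_eqI) auto
    show "mps_restrict n (vandermonde n) = vandermonde n"
      unfolding vandermonde_def mps_restrict.hom_prod mps_restrict.hom_minus
      by (intro prod.cong refl) (auto simp: var)
    have "mps_restrict n (\<Prod>i<n. mps_var i - mps_var n :: K mps) = (\<Prod>i<n. mps_var i)"
      unfolding mps_restrict.hom_prod mps_restrict.hom_minus by (intro prod.cong refl) (auto simp: var)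
    also have "\<dots> = mps_monom (mon n (\<lambda>_. 1))"
      by (simp add: mps_var_eq_monom mps_monom_prod mon_def)
    finally show "mps_restrict n (\<Prod>i<n. mps_var i - mps_var n :: K mps) = mps_monom (mon n (\<lambda>_. 1))" .
  qed
  have "vandermonde (Suc n) = vandermonde n * (\<Prod>i<n. mps_var i - mps_var n)"
    by (simp add: vandermonde_def)
  then show ?thesis by (simp add: mps_restrict.hom_mult * **)
qed

text \<open>Since the partition has at most \<open>n\<close> parts, the exponent of the new variable
  is zero. It may be set to zero, and the factor that \<open>vandermonde_Suc\<close> produces
  accounts for the rise of all other exponents by one.\<close>

lemma cfn_Suc:
  assumes "length lam \<le> n"
  shows "cfn (Suc n) f lam = cfn n f lam"
proof -
  have M: "mon (Suc n) (expo (Suc n) lam) = mon n (expo n lam) + mon n (\<lambda>_. 1)"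
    using assms by (auto simp: multiset_eq_iff expo_def part_def less_Suc_eq)
  have sub: "set_mset (mon (Suc n) (expo (Suc n) lam)) \<subseteq> {..<n}"
    unfolding M using set_mset_mon[of n] by auto
  have "cfn (Suc n) f lam
    = mps_coeff (mps_restrict n (mps_restrict (Suc n) f * vandermonde (Suc n))) (mon (Suc n) (expo (Suc n) lam))"
    using sub by (simp add: cfn_def)
  also have "\<dots> = mps_coeff (mps_monom (mon n (\<lambda>_. 1)) * (mps_restrict n f * vandermonde n))
      (mon n (expo n lam) + mon n (\<lambda>_. 1))"
    by (simp only: mps_restrict.hom_mult mps_restrict_restrict[OF le_SucI[OF order_refl]] vandermonde_Suc M mult_ac)
  also have "\<dots> = cfn n f lam" by (simp add: cfn_def)
  finally show ?thesis .
qed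

lemma cfn_stable: "length lam \<le> n \<Longrightarrow> cfn n f lam = cfn (length lam) f lam"
  by (induction n rule: dec_induct) (auto simp: cfn_Suc)

text \<open>The product \<open>F\<close> with the Vandermonde product is alternating. Its
  coefficients vanish at exponent vectors with a repetition, and sorting brings any other vector to
  the form \<open>expo n lam\<close>, where the coefficient is a \<open>cfn\<close>.\<close>

lemma restrict_eq_0_if_cfn_0:
  assumes "mps_symmetric f" "\<And>lam. lam \<in> Par \<Longrightarrow> length lam \<le> n \<Longrightarrow> cfn n f lam = 0"
  shows "mps_restrict n f = 0"
proof -
  define F where "F = mps_restrict n f * vandermonde n"
  have anti: "mps_coeff F (image_mset \<pi> M) = of_int (sign \<pi>) * mps_coeff F M" if \<pi>: "\<pi> permutes {..<n}" for \<pi> M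
  proof -
    interpret comm_ring_hom "mps_perm \<pi> :: K mps \<Rightarrow> K mps"
      by (rule comm_ring_hom_mps_perm) (rule permutes_bij[OF \<pi>])
    have "mps_perm \<pi> f = f" using assms(1) permutes_bij[OF \<pi>] by (simp add: mps_symmetric_def)
    then have "mps_perm \<pi> F = of_int (sign \<pi>) * F"
      unfolding F_def hom_mult by (simp add: mps_perm_restrict[OF \<pi>] mps_perm_vandermonde[OF \<pi>] mult_ac)
    from arg_cong[OF this, of "\<lambda>f. mps_coeff f M"] show ?thesis by simp
  qed
  have "F = 0"
  proof (rule mps_eqI)
    fix M
    show "mps_coeff F M = mps_coeff 0 M"
    proof (cases "set_mset M \<subseteq> {..<n}")
      case False
      have "F = mps_restrict n F"
        unfolding F_def mps_restrict.hom_mult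
        using mps_restrict_restrict[of n n f] alternator_0[of n]
        by (simp add: vandermonde_def mps_restrict.hom_prod mps_restrict.hom_minus)
           (intro arg_cong2[of _ _ _ _ "(*)"] refl prod.cong arg_cong2[of _ _ _ _ "(-)"]; rule mps_eqI; auto)
      then have "mps_coeff F M = mps_coeff (mps_restrict n F) M" by simp
      with False show ?thesis by simp
    next
      case True
      then have M: "M = mon n (count M)" by (simp add: mon_count)
      show ?thesis
      proof (cases "inj_on (count M) {..<n}")
        case False
        then obtain i j where ij: "i < n" "j < n" "i \<noteq> j" "count M i = count M j"
          by (auto simp: inj_on_def)
        \<comment> \<open>This transposition fixes the monomial but changes the sign of
          \<open>F\<close>, so the coefficient equals its own negative.\<close>
        let ?t = "Transposition.transpose i j"
        have t: "?t permutes {..<n}" using ij by (intro permutes_swap_id) auto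
        have "image_mset ?t M = mon n (\<lambda>l. count M (inv ?t l))"
          by (subst M) (rule image_mset_mon[OF t])
        also have "\<dots> = mon n (count M)"
          unfolding mon_eq_iff using ij by (auto simp: transpose_def)
        finally have "mps_coeff F M = - mps_coeff F M"
          using anti[OF t, of M] ij M by (simp add: sign_swap_id)
        then have "2 * mps_coeff F M = 0" by simp
        then show ?thesis by simp
      next
        case True
        from sorting_permutation[OF this] obtain \<pi> where \<pi>: "\<pi> permutes {..<n}"
          "\<And>i j. i < j \<Longrightarrow> j < n \<Longrightarrow> count M (\<pi> j) < count M (\<pi> i)" by blast
        obtain lam where lam: "lam \<in> Par" "length lam \<le> n"
          "\<And>i. i < n \<Longrightarrow> int (count M (\<pi> i)) - int n = int (part lam (Suc i)) - int (Suc i)"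
          using Par_exists_shifted[of n "\<lambda>i. int (count M (\<pi> i)) - int n"] \<pi>(2) by force
        have "image_mset (inv \<pi>) M = mon n (\<lambda>l. count M (inv (inv \<pi>) l))"
          by (subst M) (rule image_mset_mon[OF permutes_inv[OF \<pi>(1)]])
        also have "\<dots> = mon n (expo n lam)"
          unfolding mon_eq_iff permutes_inv_inv[OF \<pi>(1)] expo_def using lam(3) by force
        finally have "of_int (sign (inv \<pi>)) * mps_coeff F M = cfn n f lam"
          using anti[OF permutes_inv[OF \<pi>(1)], of M] by (simp add: cfn_def F_def)
        with assms(2)[OF lam(1,2)] show ?thesis by (auto simp: sign_def split: if_splits)
      qed
    qed
  qed
  then show ?thesis using vandermonde_cancel by (simp add: F_def)
qed

section \<open>Existence and uniqueness of Schur expansions\<close>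

lemma length_le_sum_list_Par: "lam \<in> Par \<Longrightarrow> length lam \<le> sum_list lam"
proof -
  assume "lam \<in> Par"
  then have "0 \<notin> set lam" by (simp add: Par_def)
  then show ?thesis by (induction lam) (auto simp: Suc_le_eq)
qed

lemma finite_Par_size: "finite {lam \<in> Par. sum_list lam \<le> d}"
proof (rule finite_subset)
  show "{lam \<in> Par. sum_list lam \<le> d} \<subseteq> {xs. set xs \<subseteq> {..d} \<and> length xs \<le> d}"
  proof safe
    fix lam x assume "sum_list lam \<le> d" "x \<in> set lam"
    then show "x \<le> d" using member_le_sum_list[of x lam] by simp
  next
    fix lam :: "nat list" assume "lam \<in> Par" "sum_list lam \<le> d"
    then show "length lam \<le> d" using length_le_sum_list_Par[of lam] by simp
  qed
  show "finite {xs :: nat list. set xs \<subseteq> {..d} \<and> length xs \<le> d}"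
    by (rule finite_lists_length_le) simp
qed

lemma finite_Par_size_eq: "finite {lam \<in> Par. sum_list lam = d}"
  by (rule finite_subset[OF _ finite_Par_size[of d]]) auto

lemma mps_coeff_schur_0: "sum_list lam \<noteq> size M \<Longrightarrow> mps_coeff (schur lam) M = 0"
  using mps_homogeneous_schur[of lam] by (auto simp: mps_homogeneous_def)

text \<open>Schur functions are homogeneous and there are finitely many partitions of each size.
  Hence every coefficient of the partial sums is eventually constant, and convergence becomes a
  finite identity for each monomial.\<close>

lemma schur_expansion_iff:
  "schur_expansion f c \<longleftrightarrow> (\<forall>lam. lam \<notin> Par \<longrightarrow> c lam = 0) \<and>
    (\<forall>M. mps_coeff f M = (\<Sum>lam | lam \<in> Par \<and> sum_list lam = size M. c lam * mps_coeff (schur lam) M))"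
proof -
  have ev: "\<forall>\<^sub>F S in finite_subsets_at_top Par. mps_coeff (\<Sum>lam\<in>S. mps_const (c lam) * schur lam) M
    = (\<Sum>lam | lam \<in> Par \<and> sum_list lam = size M. c lam * mps_coeff (schur lam) M)" for M
    unfolding eventually_finite_subsets_at_top
  proof (intro exI conjI allI impI)
    fix S assume S: "finite S \<and> {lam \<in> Par. sum_list lam = size M} \<subseteq> S \<and> S \<subseteq> Par"
    show "mps_coeff (\<Sum>lam\<in>S. mps_const (c lam) * schur lam) M
      = (\<Sum>lam | lam \<in> Par \<and> sum_list lam = size M. c lam * mps_coeff (schur lam) M)"
      using S mps_coeff_schur_0[of _ M] unfolding mps_coeff_sum mps_coeff_const_mult
      by (intro sum.mono_neutral_right) auto
  qed (auto simp: finite_Par_size_eq)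
  have "((\<lambda>lam. mps_const (c lam) * schur lam) has_sum f) Par \<longleftrightarrow>
    (\<forall>M. mps_coeff f M = (\<Sum>lam | lam \<in> Par \<and> sum_list lam = size M. c lam * mps_coeff (schur lam) M))"
    unfolding has_sum_def tendsto_mps_iff
  proof (intro all_cong1 iffI)
    fix M assume "\<forall>\<^sub>F S in finite_subsets_at_top Par. mps_coeff (\<Sum>lam\<in>S. mps_const (c lam) * schur lam) M = mps_coeff f M"
    with ev[of M] have "\<forall>\<^sub>F S in finite_subsets_at_top Par. mps_coeff f M
      = (\<Sum>lam | lam \<in> Par \<and> sum_list lam = size M. c lam * mps_coeff (schur lam) M)"
      by eventually_elim simp
    then show "mps_coeff f M = (\<Sum>lam | lam \<in> Par \<and> sum_list lam = size M. c lam * mps_coeff (schur lam) M)"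
      using finite_subsets_at_top_neq_bot by (simp add: eventually_const)
  qed (use ev in auto)
  then show ?thesis by (simp add: schur_expansion_def)
qed

lemma schur_expansion_unique:
  assumes "schur_expansion f c"
  shows "c lam = (if lam \<in> Par then cfn (length lam) f lam else 0)"
proof (cases "lam \<in> Par")
  case True
  let ?d = "sum_list lam"
  have "cfn (length lam) f lam = cfn ?d f lam"
    by (rule cfn_stable[symmetric]) (rule length_le_sum_list_Par[OF True])
  also have "\<dots> = cfn ?d (\<Sum>mu | mu \<in> Par \<and> sum_list mu = ?d. mps_const (c mu) * schur mu) lam"
    by (rule cfn_local) (use assms length_le_sum_list_Par[OF True] in \<open>auto simp: schur_expansion_iff\<close>)
  also have "\<dots> = (\<Sum>mu | mu \<in> Par \<and> sum_list mu = ?d. if mu = lam then c mu else 0)"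
    unfolding cfn_sum cfn_linear
  proof (rule sum.cong[OF refl])
    fix mu assume mu: "mu \<in> {mu. mu \<in> Par \<and> sum_list mu = ?d}"
    then have "length mu \<le> ?d" using length_le_sum_list_Par[of mu] by simp
    then show "c mu * cfn ?d (schur mu) lam = (if mu = lam then c mu else 0)"
      using mu True length_le_sum_list_Par[OF True] by (simp add: cfn_schur)
  qed
  also have "\<dots> = c lam"
    by (subst sum.delta) (use True finite_Par_size_eq in auto)
  finally show ?thesis using True by simp
qed (use assms in \<open>auto simp: schur_expansion_iff\<close>)

text \<open>One degree at a time: the homogeneous component \<open>f'\<close> minus the proposed
  finite sum of Schur functions is symmetric and all its \<open>cfn\<close> vanish, so it is zero by
  \<open>restrict_eq_0_if_cfn_0\<close>.\<close>

lemma schur_expansion_symmetric: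
  assumes "mps_symmetric f"
  shows "schur_expansion f (\<lambda>lam. if lam \<in> Par then cfn (length lam) f lam else 0)"
  unfolding schur_expansion_iff
proof (intro conjI allI impI)
  fix M :: "nat multiset"
  define d where "d = size M"
  define f' where "f' = (Abs_mps (\<lambda>M. if size M = d then mps_coeff f M else 0) :: K mps)"
  let ?S = "{mu. mu \<in> Par \<and> sum_list mu = d}"
  define D where "D = f' - (\<Sum>mu\<in>?S. mps_const (cfn (length mu) f mu) * schur mu)"
  have "mps_symmetric f'"
    using assms by (simp add: mps_symmetric_iff f'_def)
  then have sym: "mps_symmetric D"
    unfolding D_def by (intro mps_symmetric_intros mps_symmetric_sum mps_symmetric_schur)
  have "D = 0"
  proof (rule mps_eqI_restrict)
    fix n assume n: "d \<le> n"
    have "mps_restrict n D = 0"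
    proof (rule restrict_eq_0_if_cfn_0[OF sym])
      fix lam assume lam: "lam \<in> Par" "length lam \<le> n"
      have S: "length mu \<le> n" if "mu \<in> ?S" for mu
        using length_le_sum_list_Par[of mu] that n by simp
      have "cfn n D lam = cfn n f' lam - (\<Sum>mu\<in>?S. cfn (length mu) f mu * cfn n (schur mu) lam)"
        by (simp add: D_def cfn_linear cfn_sum)
      also have "(\<Sum>mu\<in>?S. cfn (length mu) f mu * cfn n (schur mu) lam)
        = (\<Sum>mu\<in>?S. if mu = lam then cfn (length mu) f mu else 0)"
        by (intro sum.cong refl) (use lam S in \<open>auto simp: cfn_schur\<close>)
      also have "\<dots> = (if sum_list lam = d then cfn (length lam) f lam else 0)"
        by (subst sum.delta) (use lam finite_Par_size_eq in auto)
      also have "cfn n f' lam = (if sum_list lam = d then cfn (length lam) f lam else 0)"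
      proof (cases "sum_list lam = d")
        case True
        then have "cfn n f' lam = cfn n f lam"
          by (intro cfn_local lam) (simp add: f'_def)
        with True show ?thesis using cfn_stable[OF lam(2), of f] by simp
      next
        case False
        then have "cfn n f' lam = cfn n 0 lam"
          by (intro cfn_local lam) (simp add: f'_def)
        with False show ?thesis by (simp add: cfn_linear)
      qed
      finally show "cfn n D lam = 0" by simp
    qed
    then show "mps_restrict n D = mps_restrict n 0" by simp
  qed
  from arg_cong[OF this, of "\<lambda>f. mps_coeff f M"]
  show "mps_coeff f M = (\<Sum>lam | lam \<in> Par \<and> sum_list lam = size M.
      (if lam \<in> Par then cfn (length lam) f lam else 0) * mps_coeff (schur lam) M)"
    by (simp add: D_def f'_def d_def)
qed simp

section \<open>Products of complete homogeneous symmetric functions\<close>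

text \<open>A multiset of pairs encodes a matrix of natural numbers; its two images are the row and column sums.\<close>

definition margins :: "nat multiset \<Rightarrow> nat multiset \<Rightarrow> (nat \<times> nat) multiset set" where
  "margins \<alpha> \<gamma> = {m. image_mset fst m = \<alpha> \<and> image_mset snd m = \<gamma>}"

text \<open>The product of the complete homogeneous functions whose degrees are the multiplicities
  in \<open>\<alpha>\<close>, see \<open>hprod_mon\<close>. Indexing by a monomial makes the duality
  \<open>hall_hprod\<close> a plain extraction of coefficients.\<close>

definition hprod :: "nat multiset \<Rightarrow> K mps" where
  "hprod \<alpha> = Abs_mps (\<lambda>\<gamma>. of_nat (card (margins \<alpha> \<gamma>)))"

lemma mps_coeff_hprod [simp]: "mps_coeff (hprod \<alpha>) \<gamma> = of_nat (card (margins \<alpha> \<gamma>))"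
  by (simp add: hprod_def)

lemma finite_margins: "finite (margins \<alpha> \<gamma>)"
proof (rule finite_subset[OF _ finite_submultisets])
  let ?X = "\<Sum>p\<in>set_mset \<alpha> \<times> set_mset \<gamma>. replicate_mset (size \<alpha>) p"
  show "margins \<alpha> \<gamma> \<subseteq> {m. m \<subseteq># ?X}"
  proof
    fix m assume m: "m \<in> margins \<alpha> \<gamma>"
    have "count m p \<le> count ?X p" for p
    proof (cases "p \<in># m")
      case True
      then have "fst p \<in># \<alpha>" "snd p \<in># \<gamma>" using m by (auto simp: margins_def)
      then have "p \<in> set_mset \<alpha> \<times> set_mset \<gamma>" by (cases p) simp
      then have "count ?X p = size \<alpha>" by (simp add: count_sum)
      moreover have "size m = size \<alpha>" using m by (auto simp: margins_def)
      ultimately show ?thesis using count_le_size[of m p] by simp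
    next
      case False
      then show ?thesis by (simp add: not_in_iff)
    qed
    then show "m \<in> {m. m \<subseteq># ?X}" by (simp add: subseteq_mset_def)
  qed
qed

lemma card_margins_swap: "card (margins \<alpha> \<gamma>) = card (margins \<gamma> \<alpha>)"
  by (rule bij_betw_same_card[of "image_mset prod.swap"], rule bij_betw_byWitness[of _ "image_mset prod.swap"])
     (auto simp: margins_def multiset.map_comp comp_def)

lemma card_margins_image:
  assumes "inj \<pi>"
  shows "card (margins (image_mset \<pi> \<alpha>) \<gamma>) = card (margins \<alpha> \<gamma>)"
proof (rule bij_betw_same_card[symmetric, of "image_mset (map_prod \<pi> id)"],
    rule bij_betw_byWitness[of _ "image_mset (map_prod (inv \<pi>) id)"])
  show "\<forall>m\<in>margins \<alpha> \<gamma>. image_mset (map_prod (inv \<pi>) id) (image_mset (map_prod \<pi> id) m) = m"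
    using assms by (auto simp: multiset.map_comp map_prod.comp map_prod.id)
  show "\<forall>m\<in>margins (image_mset \<pi> \<alpha>) \<gamma>. image_mset (map_prod \<pi> id) (image_mset (map_prod (inv \<pi>) id) m) = m"
  proof
    fix m assume m: "m \<in> margins (image_mset \<pi> \<alpha>) \<gamma>"
    have "map_prod \<pi> id (map_prod (inv \<pi>) id p) = p" if "p \<in># m" for p
    proof -
      have "image_mset fst m = image_mset \<pi> \<alpha>" using m by (simp add: margins_def)
      moreover have "fst p \<in># image_mset fst m" using that by auto
      ultimately have "fst p \<in># image_mset \<pi> \<alpha>" by (simp only:)
      then have "fst p \<in> range \<pi>" by auto
      then show ?thesis by (cases p) (simp add: f_inv_into_f)
    qed
    then show "image_mset (map_prod \<pi> id) (image_mset (map_prod (inv \<pi>) id) m) = m"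
      by (simp add: multiset.map_comp comp_def multiset.map_ident_strong)
  qed
  show "image_mset (map_prod \<pi> id) ` margins \<alpha> \<gamma> \<subseteq> margins (image_mset \<pi> \<alpha>) \<gamma>"
    by (auto simp: margins_def multiset.map_comp comp_def)
  have "image_mset (inv \<pi>) (image_mset \<pi> \<alpha>) = \<alpha>"
    using assms by (simp add: multiset.map_comp comp_def)
  then show "image_mset (map_prod (inv \<pi>) id) ` margins (image_mset \<pi> \<alpha>) \<gamma> \<subseteq> margins \<alpha> \<gamma>"
    by (auto simp: margins_def multiset.map_comp comp_def) (simp flip: multiset.map_comp[unfolded comp_def])
qed

lemma hprod_image: "inj \<pi> \<Longrightarrow> hprod (image_mset \<pi> \<alpha>) = hprod \<alpha>"
  by (rule mps_eqI) (simp add: card_margins_image)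

lemma mps_symmetric_hprod: "mps_symmetric (hprod \<alpha>)"
  unfolding mps_symmetric_iff mps_coeff_hprod
  by (metis bij_is_inj card_margins_image card_margins_swap)

lemma hprod_size: "mps_coeff (hprod \<alpha>) \<gamma> \<noteq> 0 \<Longrightarrow> size \<gamma> = size \<alpha>"
proof -
  assume "mps_coeff (hprod \<alpha>) \<gamma> \<noteq> 0"
  then have "margins \<alpha> \<gamma> \<noteq> {}" by auto
  then obtain m where "image_mset fst m = \<alpha>" "image_mset snd m = \<gamma>" by (auto simp: margins_def)
  then show ?thesis by auto
qed

text \<open>The rows of a matrix with row sums \<open>\<alpha> + \<beta>\<close> fall into those
  belonging to \<open>\<alpha>\<close> and those belonging to \<open>\<beta>\<close>; the column
  sums of the first block play the part of the divisor \<open>A\<close> in the product.\<close>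

lemma hprod_union:
  assumes "set_mset \<alpha> \<inter> set_mset \<beta> = {}"
  shows "hprod (\<alpha> + \<beta>) = hprod \<alpha> * hprod \<beta>"
proof (rule mps_eqI)
  fix \<gamma>
  let ?S = "SIGMA A:{A. A \<subseteq># \<gamma>}. margins \<alpha> A \<times> margins \<beta> (\<gamma> - A)"
  let ?p = "filter_mset (\<lambda>x. fst x \<in># \<alpha>)"
  let ?q = "filter_mset (\<lambda>x. fst x \<notin># \<alpha>)"
  have split: "?p m + ?q m = m" for m :: "(nat \<times> nat) multiset"
    by (rule multiset_partition[symmetric])
  have "card (margins (\<alpha> + \<beta>) \<gamma>) = card ?S"
  proof (rule bij_betw_same_card[of "\<lambda>m. (image_mset snd (?p m), ?p m, ?q m)"],
      rule bij_betw_byWitness[of _ "\<lambda>(A, m, m'). m + m'"])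
    show "\<forall>m\<in>margins (\<alpha> + \<beta>) \<gamma>. (case (image_mset snd (?p m), ?p m, ?q m) of (A, m, m') \<Rightarrow> m + m') = m"
      by (simp add: split)
    show "\<forall>x\<in>?S. (image_mset snd (?p (case x of (A, m, m') \<Rightarrow> m + m')), ?p (case x of (A, m, m') \<Rightarrow> m + m'),
        ?q (case x of (A, m, m') \<Rightarrow> m + m')) = x"
    proof
      fix x assume "x \<in> ?S"
      then obtain A m m' where x: "x = (A, m, m')" "m \<in> margins \<alpha> A" "m' \<in> margins \<beta> (\<gamma> - A)" by auto
      have 1: "fst y \<in># \<alpha>" if "y \<in># m" for y using x(2) that by (auto simp: margins_def)
      have 2: "fst y \<notin># \<alpha>" if "y \<in># m'" for y using x(3) that assms by (auto simp: margins_def)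
      have "?p m = m" "?q m' = m'" using 1 2 by (simp_all add: filter_mset_eq_conv)
      moreover have "?q m = {#}" "?p m' = {#}" using 1 2 by (simp_all add: filter_mset_eq_mempty_iff)
      ultimately show "(image_mset snd (?p (case x of (A, m, m') \<Rightarrow> m + m')), ?p (case x of (A, m, m') \<Rightarrow> m + m'),
        ?q (case x of (A, m, m') \<Rightarrow> m + m')) = x"
        using x by (auto simp: margins_def)
    qed
    show "(\<lambda>m. (image_mset snd (?p m), ?p m, ?q m)) ` margins (\<alpha> + \<beta>) \<gamma> \<subseteq> ?S"
    proof
      fix x assume "x \<in> (\<lambda>m. (image_mset snd (?p m), ?p m, ?q m)) ` margins (\<alpha> + \<beta>) \<gamma>"
      then obtain m where m: "image_mset fst m = \<alpha> + \<beta>" "image_mset snd m = \<gamma>"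
        and x: "x = (image_mset snd (?p m), ?p m, ?q m)" by (auto simp: margins_def)
      have "image_mset fst (?p m) = filter_mset (\<lambda>a. a \<in># \<alpha>) (image_mset fst m)"
        by (simp add: filter_mset_image_mset)
      also have "\<dots> = filter_mset (\<lambda>a. a \<in># \<alpha>) \<alpha> + filter_mset (\<lambda>a. a \<in># \<alpha>) \<beta>" by (simp add: m)
      also have "filter_mset (\<lambda>a. a \<in># \<alpha>) \<alpha> = \<alpha>" by (simp add: filter_mset_eq_conv)
      also have "filter_mset (\<lambda>a. a \<in># \<alpha>) \<beta> = {#}" using assms by (auto simp: filter_mset_eq_mempty_iff)
      finally have 1: "image_mset fst (?p m) = \<alpha>" by simp
      have "image_mset fst (?p m) + image_mset fst (?q m) = \<alpha> + \<beta>"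
        "image_mset snd (?p m) + image_mset snd (?q m) = \<gamma>"
        unfolding image_mset_union[symmetric] split m by simp_all
      then have "image_mset fst (?q m) = \<beta>" "image_mset snd (?q m) = \<gamma> - image_mset snd (?p m)"
        "image_mset snd (?p m) \<subseteq># \<gamma>"
        using 1 by auto
      then show "x \<in> ?S" using 1 x by (simp add: margins_def)
    qed
    show "(\<lambda>(A, m, m'). m + m') ` ?S \<subseteq> margins (\<alpha> + \<beta>) \<gamma>"
      by (auto simp: margins_def)
  qed
  also have "card ?S = (\<Sum>A | A \<subseteq># \<gamma>. card (margins \<alpha> A \<times> margins \<beta> (\<gamma> - A)))"
    by (rule card_SigmaI) (auto simp: finite_submultisets finite_margins)
  finally show "mps_coeff (hprod (\<alpha> + \<beta>)) \<gamma> = mps_coeff (hprod \<alpha> * hprod \<beta>) \<gamma>"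
    by (simp add: mps_coeff_mult card_cartesian_product)
qed

lemma hprod_replicate: "hprod (replicate_mset k i) = eta 0 (int k)"
proof (rule mps_eqI)
  fix \<gamma>
  have "margins (replicate_mset k i) \<gamma> = (if k = size \<gamma> then {image_mset (Pair i) \<gamma>} else {})"
  proof (rule Set.set_eqI, rule iffI)
    fix m assume m: "m \<in> margins (replicate_mset k i) \<gamma>"
    have "image_mset (Pair i) (image_mset snd m) = image_mset (\<lambda>p. p) m"
      unfolding multiset.map_comp comp_def
    proof (rule image_mset_cong)
      fix p assume "p \<in># m"
      then have "fst p \<in># image_mset fst m" by auto
      moreover have "image_mset fst m = replicate_mset k i" using m by (simp add: margins_def)
      ultimately have "fst p \<in># replicate_mset k i" by (simp only:)
      then show "(i, snd p) = p" by (cases p) (auto split: if_splits)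
    qed
    moreover have "k = size \<gamma>"
      using m unfolding margins_def by (metis (mono_tags) mem_Collect_eq size_image_mset size_replicate_mset)
    ultimately show "m \<in> (if k = size \<gamma> then {image_mset (Pair i) \<gamma>} else {})"
      using m by (auto simp: margins_def)
  next
    fix m assume "m \<in> (if k = size \<gamma> then {image_mset (Pair i) \<gamma>} else {})"
    then show "m \<in> margins (replicate_mset k i) \<gamma>"
      by (auto simp: margins_def multiset.map_comp comp_def image_mset_const_eq split: if_splits)
  qed
  then show "mps_coeff (hprod (replicate_mset k i)) \<gamma> = mps_coeff (eta 0 (int k)) \<gamma>"
    by (simp add: mps_coeff_h)
qed

lemma hprod_0 [simp]: "hprod {#} = 1"
  using hprod_replicate[of 0 0] by (simp add: eta_0)

lemma hprod_mon: "hprod (mon n e) = (\<Prod>i<n. eta 0 (int (e i)))"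
proof (induction n)
  case (Suc n)
  have "set_mset (mon n e) \<inter> set_mset (replicate_mset (e n) n) = {}"
    using set_mset_mon[of n e] by auto
  then show ?case using Suc by (simp add: mon_def hprod_union hprod_replicate)
qed (simp add: mon_def)

lemma prod_eta_0:
  "(\<Prod>i<n. eta 0 (q i)) = (if \<forall>i<n. 0 \<le> q i then hprod (mon n (\<lambda>i. nat (q i))) else 0)"
proof (cases "\<forall>i<n. 0 \<le> q i")
  case True
  then show ?thesis by (simp add: hprod_mon)
next
  case False
  then obtain i where "i < n" "eta 0 (q i) = 0" by (auto simp: eta_neg)
  with False show ?thesis by (auto intro!: prod_zero)
qed

section \<open>The Hall product\<close>

text \<open>Both sides are the same signed sum over permutations: on the left the Vandermonde
  product is expanded, on the right the Jacobi--Trudi determinant. The terms agree because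
  transposing matrices exchanges row and column sums.\<close>

lemma cfn_hprod:
  assumes "lam \<in> Par"
  shows "cfn (length lam) (hprod \<alpha>) lam = mps_coeff (schur lam) \<alpha>"
proof -
  define n where "n = length lam"
  \<comment> \<open>The exponent left over in the Vandermonde expansion and at the same time the
    index of the Jacobi--Trudi entry. If some \<open>q \<pi> i\<close> is negative, the monomial
    does not divide on one side and a complete homogeneous factor vanishes on the other.\<close>
  define q where "q \<pi> i = int (part lam (Suc i)) - int (Suc i) + int (Suc (\<pi> i))" for \<pi> i
  have V: "vandermonde n = (\<Sum>\<pi> | \<pi> permutes {..<n}. of_int (sign \<pi>) * mps_monom (mon n (\<lambda>l. n - Suc (\<pi> l))))"
  proof -
    have "vandermonde n = detf n (\<lambda>l i. mps_var l ^ (n - Suc i))"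
      by (subst detf_transpose) (simp add: alternator_0[symmetric] alternator_def yvar_0)
    then show ?thesis
      by (simp add: detf_leibniz mps_var_power mps_monom_prod mon_def)
  qed
  have sub: "mon n (\<lambda>l. n - Suc (\<pi> l)) \<subseteq># mon n (expo n lam) \<longleftrightarrow> (\<forall>i<n. 0 \<le> q \<pi> i)"
    and diff: "(\<forall>i<n. 0 \<le> q \<pi> i) \<Longrightarrow>
      mon n (expo n lam) - mon n (\<lambda>l. n - Suc (\<pi> l)) = mon n (\<lambda>i. nat (q \<pi> i))"
    if "\<pi> permutes {..<n}" for \<pi>
  proof -
    have lt: "\<pi> i < n" if "i < n" for i using permutes_in_image[OF \<open>\<pi> permutes {..<n}\<close>, of i] that by simp
    have "n - Suc (\<pi> i) \<le> expo n lam i \<longleftrightarrow> 0 \<le> q \<pi> i" if "i < n" for i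
      using lt[OF that] that by (auto simp: q_def expo_def)
    then show "mon n (\<lambda>l. n - Suc (\<pi> l)) \<subseteq># mon n (expo n lam) \<longleftrightarrow> (\<forall>i<n. 0 \<le> q \<pi> i)"
      by (auto simp: subseteq_mset_def)
    have "expo n lam i - (n - Suc (\<pi> i)) = nat (q \<pi> i)" if "i < n" for i
      using lt[OF that] that by (auto simp: q_def expo_def)
    then show "mon n (expo n lam) - mon n (\<lambda>l. n - Suc (\<pi> l)) = mon n (\<lambda>i. nat (q \<pi> i))"
      by (auto simp: multiset_eq_iff)
  qed
  have "cfn n (hprod \<alpha>) lam = mps_coeff (vandermonde n * mps_restrict n (hprod \<alpha>)) (mon n (expo n lam))"
    by (simp add: cfn_def mult.commute)
  also have "\<dots> = (\<Sum>\<pi> | \<pi> permutes {..<n}. of_int (sign \<pi>) *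
      (if \<forall>i<n. 0 \<le> q \<pi> i then mps_coeff (hprod \<alpha>) (mon n (\<lambda>i. nat (q \<pi> i))) else 0))"
    unfolding V sum_distrib_right mps_coeff_sum
  proof (rule sum.cong[OF refl])
    fix \<pi> assume "\<pi> \<in> {\<pi>. \<pi> permutes {..<n}}"
    then have \<pi>: "\<pi> permutes {..<n}" by blast
    show "mps_coeff (of_int (sign \<pi>) * mps_monom (mon n (\<lambda>l. n - Suc (\<pi> l))) * mps_restrict n (hprod \<alpha>)) (mon n (expo n lam))
      = of_int (sign \<pi>) * (if \<forall>i<n. 0 \<le> q \<pi> i then mps_coeff (hprod \<alpha>) (mon n (\<lambda>i. nat (q \<pi> i))) else 0)"
      using diff[OF \<pi>] set_mset_mon
      by (simp only: mult.assoc mps_coeff_of_int_mult mps_coeff_monom_mult sub[OF \<pi>] mps_coeff_simps if_True cong: if_cong)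
  qed
  also have "\<dots> = mps_coeff (schur lam) \<alpha>"
    unfolding schur_eq_JT[OF order_refl] JT_schur_eta detf_leibniz n_def[symmetric] mps_coeff_sum
      mps_coeff_of_int_mult prod_eta_0 q_def[symmetric]
    by (rule sum.cong) (auto simp: card_margins_swap[of \<alpha>])
  finally show ?thesis by (simp add: n_def)
qed

lemma schur_coeff_symmetric:
  assumes "mps_symmetric f"
  shows "schur_coeff f lam = (if lam \<in> Par then cfn (length lam) f lam else 0)"
    and schur_expansion_schur_coeff: "schur_expansion f (schur_coeff f)"
proof -
  have *: "schur_coeff f = (\<lambda>lam. if lam \<in> Par then cfn (length lam) f lam else 0)"
    unfolding schur_coeff_def
    by (rule the_equality) (rule schur_expansion_symmetric[OF assms], rule ext, rule schur_expansion_unique)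
  then show "schur_coeff f lam = (if lam \<in> Par then cfn (length lam) f lam else 0)" by simp
  show "schur_expansion f (schur_coeff f)"
    unfolding * by (rule schur_expansion_symmetric[OF assms])
qed

lemma schur_expansion_imp_symmetric: "schur_expansion f c \<Longrightarrow> mps_symmetric f"
  using mps_symmetric_schur
  by (auto simp: schur_expansion_iff mps_symmetric_iff intro!: sum.cong)

section \<open>Bounded degree and closure properties of \<open>Lam\<close>\<close>

definition mps_bounded :: "K mps \<Rightarrow> bool" where
  "mps_bounded f \<longleftrightarrow> (\<exists>d. \<forall>M. mps_coeff f M \<noteq> 0 \<longrightarrow> size M \<le> d)"

lemma mps_bounded_add: "mps_bounded f \<Longrightarrow> mps_bounded g \<Longrightarrow> mps_bounded (f + g)"
  unfolding mps_bounded_def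
proof (elim exE)
  fix d e assume "\<forall>M. mps_coeff f M \<noteq> 0 \<longrightarrow> size M \<le> d" "\<forall>M. mps_coeff g M \<noteq> 0 \<longrightarrow> size M \<le> e"
  then have "\<forall>M. mps_coeff (f + g) M \<noteq> 0 \<longrightarrow> size M \<le> max d e"
    by (metis add_0 le_max_iff_disj mps_coeff_simps(3))
  then show "\<exists>d. \<forall>M. mps_coeff (f + g) M \<noteq> 0 \<longrightarrow> size M \<le> d" by blast
qed

lemma mps_bounded_mult: "mps_bounded f \<Longrightarrow> mps_bounded g \<Longrightarrow> mps_bounded (f * g)"
  unfolding mps_bounded_def
proof (elim exE)
  fix d e assume *: "\<forall>M. mps_coeff f M \<noteq> 0 \<longrightarrow> size M \<le> d" "\<forall>M. mps_coeff g M \<noteq> 0 \<longrightarrow> size M \<le> e"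
  have "size M \<le> d + e" if M: "mps_coeff (f * g) M \<noteq> 0" for M
  proof -
    obtain A where A: "A \<subseteq># M" "mps_coeff f A \<noteq> 0" "mps_coeff g (M - A) \<noteq> 0"
      using M unfolding mps_coeff_mult
      by (metis (mono_tags, lifting) mem_Collect_eq mult_zero_left mult_zero_right sum.neutral)
    moreover have "size M = size A + size (M - A)"
      using A by (metis size_union subset_mset.add_diff_inverse)
    ultimately show ?thesis using * by (metis add_mono)
  qed
  then show "\<exists>d. \<forall>M. mps_coeff (f * g) M \<noteq> 0 \<longrightarrow> size M \<le> d" by blast
qed

lemma mps_bounded_const: "mps_bounded (mps_const c)" "mps_bounded 0" "mps_bounded 1" "mps_bounded (mps_var l)"
  unfolding mps_bounded_def by (rule exI[of _ 1]; auto)+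

lemma mps_bounded_sum: "(\<And>x. x \<in> S \<Longrightarrow> mps_bounded (f x)) \<Longrightarrow> mps_bounded (sum f S)"
  by (induction S rule: infinite_finite_induct) (auto intro: mps_bounded_add mps_bounded_const)

lemma mps_bounded_prod: "(\<And>x. x \<in> S \<Longrightarrow> mps_bounded (f x)) \<Longrightarrow> mps_bounded (prod f S)"
  by (induction S rule: infinite_finite_induct) (auto intro: mps_bounded_mult mps_bounded_const)

lemma mps_bounded_power: "mps_bounded f \<Longrightarrow> mps_bounded (f ^ k)"
  by (induction k) (auto intro: mps_bounded_mult mps_bounded_const)

lemma mps_bounded_detf:
  assumes "\<And>i j. i < n \<Longrightarrow> j < n \<Longrightarrow> mps_bounded (e i j)"
  shows "mps_bounded (detf n e)"
  unfolding detf_leibniz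
proof (rule mps_bounded_sum)
  fix \<pi> assume "\<pi> \<in> {\<pi>. \<pi> permutes {..<n}}"
  then have \<pi>: "\<pi> permutes {..<n}" by blast
  have "mps_bounded (\<Prod>i<n. e i (\<pi> i))"
    by (rule mps_bounded_prod) (use assms permutes_in_image[OF \<pi>] in auto)
  then show "mps_bounded (of_int (sign \<pi>) * (\<Prod>i<n. e i (\<pi> i)))"
    by (metis mps_bounded_const(1) mps_bounded_mult mps_const.hom_of_int)
qed

lemma Lam_iff: "f \<in> Lam \<longleftrightarrow> mps_symmetric f \<and> (\<exists>d. \<forall>M. mps_coeff f M \<noteq> 0 \<longrightarrow> size M \<le> d)"
  by (auto simp: Lam_def mps_symmetric_iff)

lemma hprod_Lam: "hprod \<alpha> \<in> Lam"
  unfolding Lam_iff using hprod_size mps_symmetric_hprod by (metis order_refl)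

lemma schur_Lam: "schur lam \<in> Lam"
  unfolding Lam_iff using mps_coeff_schur_0 mps_symmetric_schur by (metis order_refl)

lemma Lam_add: "f \<in> Lam \<Longrightarrow> g \<in> Lam \<Longrightarrow> f + g \<in> Lam"
  using mps_bounded_add[of f g] unfolding Lam_iff mps_bounded_def[symmetric]
  by (auto intro: mps_symmetric_intros)

lemma Lam_const_mult: "f \<in> Lam \<Longrightarrow> mps_const c * f \<in> Lam"
  unfolding Lam_iff by (auto intro: mps_symmetric_intros)

lemma Lam_0: "0 \<in> Lam"
  by (auto simp: Lam_iff mps_symmetric_intros)

lemma Lam_sum: "(\<And>x. x \<in> S \<Longrightarrow> f x \<in> Lam) \<Longrightarrow> sum f S \<in> Lam"
  by (induction S rule: infinite_finite_induct) (auto simp: Lam_add Lam_0)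

lemma cfn_restrict: "cfn n (mps_restrict n f) lam = cfn n f lam"
  by (simp add: cfn_def mps_restrict_restrict)

lemma cfn_bounded:
  assumes "\<And>M. set_mset M \<subseteq> {..<n} \<Longrightarrow> mps_coeff f M \<noteq> 0 \<Longrightarrow> size M \<le> d"
    and "length lam \<le> n" "d < sum_list lam"
  shows "cfn n f lam = 0"
proof -
  have "cfn n (mps_restrict n f) lam = cfn n 0 lam"
  proof (rule cfn_local[OF assms(2)])
    fix M :: "nat multiset" assume "size M = sum_list lam"
    then show "mps_coeff (mps_restrict n f) M = mps_coeff 0 M"
      using assms(1)[of M] assms(3) by (auto simp: not_less[symmetric])
  qed
  then show ?thesis by (simp add: cfn_restrict cfn_linear)
qed

lemma schur_coeff_bounded:
  assumes "mps_symmetric h" "\<And>M. mps_coeff h M \<noteq> 0 \<Longrightarrow> size M \<le> d" "schur_coeff h lam \<noteq> 0"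
  shows "lam \<in> Par \<and> sum_list lam \<le> d"
  using assms cfn_bounded[of "length lam" h d lam] by (fastforce simp: schur_coeff_symmetric split: if_splits)

section \<open>Linearity of the Hall product and its values on Schur functions and on products of
  complete homogeneous functions\<close>

lemma hall_bounded:
  assumes "mps_symmetric h" "\<And>M. mps_coeff h M \<noteq> 0 \<Longrightarrow> size M \<le> d"
  shows "hall f h = (\<Sum>lam | lam \<in> Par \<and> sum_list lam \<le> d. schur_coeff f lam * schur_coeff h lam)"
  unfolding hall_def
  by (rule sum.mono_neutral_left) (use schur_coeff_bounded[OF assms] finite_Par_size in auto)

lemma hall_0_right: "hall f 0 = 0"
  by (subst hall_bounded[of 0 0]) (auto simp: mps_symmetric_intros schur_coeff_symmetric cfn_linear)

lemma hall_add_right: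
  assumes "g \<in> Lam" "h \<in> Lam"
  shows "hall f (g + h) = hall f g + hall f h"
proof -
  obtain d e where d: "\<And>M. mps_coeff g M \<noteq> 0 \<Longrightarrow> size M \<le> d" "\<And>M. mps_coeff h M \<noteq> 0 \<Longrightarrow> size M \<le> e"
    using assms by (auto simp: Lam_iff)
  have s: "mps_symmetric g" "mps_symmetric h" using assms by (auto simp: Lam_iff)
  have bound: "mps_coeff (g + h) M \<noteq> 0 \<Longrightarrow> size M \<le> max d e" for M
    using d by (metis add_0 le_max_iff_disj mps_coeff_simps(3))
  show ?thesis
    using d hall_bounded[OF s(1), of "max d e"] hall_bounded[OF s(2), of "max d e"]
      hall_bounded[OF mps_symmetric_intros(3)[OF s], of "max d e", OF bound]
    by (simp add: le_max_iff_disj schur_coeff_symmetric s mps_symmetric_intros cfn_linear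
        sum.distrib[symmetric] distrib_left)
qed

lemma hall_const_right:
  assumes "h \<in> Lam"
  shows "hall f (mps_const x * h) = x * hall f h"
proof -
  obtain d where d: "\<And>M. mps_coeff h M \<noteq> 0 \<Longrightarrow> size M \<le> d"
    using assms by (auto simp: Lam_iff)
  have s: "mps_symmetric h" "mps_symmetric (mps_const x * h)"
    using assms by (auto simp: Lam_iff intro: mps_symmetric_intros)
  show ?thesis
    using d hall_bounded[OF s(1), of d f] hall_bounded[OF s(2), of d f]
    by (simp add: schur_coeff_symmetric s cfn_linear sum_distrib_left mult.left_commute)
qed

lemma hall_sum_right:
  "(\<And>x. x \<in> S \<Longrightarrow> h x \<in> Lam) \<Longrightarrow> hall f (\<Sum>x\<in>S. mps_const (k x) * h x) = (\<Sum>x\<in>S. k x * hall f (h x))"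
  by (induction S rule: infinite_finite_induct)
     (auto simp: hall_0_right hall_add_right hall_const_right Lam_const_mult Lam_sum)

lemma schur_coeff_hprod: "lam \<in> Par \<Longrightarrow> schur_coeff (hprod \<alpha>) lam = mps_coeff (schur lam) \<alpha>"
  by (simp add: schur_coeff_symmetric mps_symmetric_hprod cfn_hprod)

text \<open>The duality of complete homogeneous and monomial functions. By \<open>cfn_hprod\<close>
  the Schur coefficients of \<open>hprod \<alpha>\<close> are the coefficients of the Schur
  functions at \<open>\<alpha>\<close>, so the pairing is the Schur expansion of \<open>f\<close>
  read at \<open>\<alpha>\<close>.\<close>

lemma hall_hprod:
  assumes "mps_symmetric f"
  shows "hall f (hprod \<alpha>) = mps_coeff f \<alpha>"
proof -
  have "hall f (hprod \<alpha>) = (\<Sum>lam | lam \<in> Par \<and> sum_list lam \<le> size \<alpha>. schur_coeff f lam * mps_coeff (schur lam) \<alpha>)"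
    by (subst hall_bounded[of _ "size \<alpha>"]) (use hprod_size in \<open>auto simp: mps_symmetric_hprod schur_coeff_hprod\<close>)
  also have "\<dots> = (\<Sum>lam | lam \<in> Par \<and> sum_list lam = size \<alpha>. schur_coeff f lam * mps_coeff (schur lam) \<alpha>)"
    by (rule sum.mono_neutral_right) (use finite_Par_size mps_coeff_schur_0 in auto)
  also have "\<dots> = mps_coeff f \<alpha>"
    using schur_expansion_schur_coeff[OF assms] by (simp add: schur_expansion_iff)
  finally show ?thesis .
qed

lemma schur_coeff_schur:
  assumes "mu \<in> Par" "lam \<in> Par"
  shows "schur_coeff (schur mu) lam = (if lam = mu then 1 else 0)"
  using cfn_schur[OF assms(2,1), of "max (length lam) (length mu)"]
    cfn_stable[of lam "max (length lam) (length mu)" "schur mu"] assms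
  by (simp add: schur_coeff_symmetric mps_symmetric_schur)

lemma hall_schur:
  assumes "lam \<in> Par"
  shows "hall f (schur lam) = schur_coeff f lam"
proof -
  have "hall f (schur lam) = (\<Sum>mu | mu \<in> Par \<and> sum_list mu \<le> sum_list lam. schur_coeff f mu * schur_coeff (schur lam) mu)"
  proof (rule hall_bounded[OF mps_symmetric_schur])
    show "size M \<le> sum_list lam" if "mps_coeff (schur lam) M \<noteq> 0" for M
      using mps_coeff_schur_0[of lam M] that by (cases "sum_list lam = size M") auto
  qed
  also have "\<dots> = schur_coeff f lam"
    by (rule sum_eq_single[where a = lam]) (use assms in \<open>auto simp: finite_Par_size schur_coeff_schur\<close>)
  finally show ?thesis .
qed

lemma symmetric_eqI_hall:
  assumes "mps_symmetric f" "mps_symmetric g" "\<And>h. h \<in> Lam \<Longrightarrow> hall f h = hall g h"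
  shows "f = g"
  by (rule mps_eqI) (metis assms hall_hprod hprod_Lam)

lemma Lam_hat_symmetric: "f \<in> Lam_hat \<Longrightarrow> mps_symmetric f"
  unfolding Lam_hat_def using schur_expansion_imp_symmetric by blast

text \<open>Schur coefficients of length at most \<open>n\<close> can be computed in the first
  \<open>n\<close> variables. A degree bound after restriction to these variables leaves only
  finitely many of them nonzero.\<close>

lemma Lam_hatI:
  assumes "mps_symmetric f"
    and "\<And>n. \<exists>d. \<forall>M. set_mset M \<subseteq> {..<n} \<longrightarrow> mps_coeff f M \<noteq> 0 \<longrightarrow> size M \<le> d"
  shows "f \<in> Lam_hat"
proof -
  have "finite {lam \<in> Par. length lam \<le> n \<and> schur_coeff f lam \<noteq> 0}" for n
  proof -
    obtain d where d: "\<And>M. set_mset M \<subseteq> {..<n} \<Longrightarrow> mps_coeff f M \<noteq> 0 \<Longrightarrow> size M \<le> d"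
      using assms(2) by blast
    have "{lam \<in> Par. length lam \<le> n \<and> schur_coeff f lam \<noteq> 0} \<subseteq> {lam \<in> Par. sum_list lam \<le> d}"
    proof safe
      fix lam assume lam: "lam \<in> Par" "length lam \<le> n" "schur_coeff f lam \<noteq> 0"
      then have "cfn n f lam \<noteq> 0"
        using cfn_stable[OF lam(2), of f] by (simp add: schur_coeff_symmetric assms(1))
      moreover have "cfn n f lam = 0" if "d < sum_list lam"
        by (rule cfn_bounded[OF d lam(2) that])
      ultimately show "sum_list lam \<le> d" by (auto simp: not_less[symmetric])
    qed
    then show ?thesis using finite_Par_size finite_subset by blast
  qed
  then show ?thesis
    unfolding Lam_hat_def using schur_expansion_schur_coeff[OF assms(1)] by blast
qed

section \<open>The products of complete homogeneous functions span \<open>Lam\<close>\<close>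

definition hspan :: "K mps \<Rightarrow> bool" where
  "hspan f \<longleftrightarrow> (\<exists>S k. finite S \<and> f = (\<Sum>\<alpha>\<in>S. mps_const (k \<alpha>) * hprod \<alpha>))"

lemma hspan_hprod: "hspan (hprod \<alpha>)"
  unfolding hspan_def by (rule exI[of _ "{\<alpha>}"], rule exI[of _ "\<lambda>_. 1"]) simp

lemma hspan_const_mult: "hspan f \<Longrightarrow> hspan (mps_const c * f)"
  unfolding hspan_def
proof (elim exE conjE)
  fix S k assume "finite S" "f = (\<Sum>\<alpha>\<in>S. mps_const (k \<alpha>) * hprod \<alpha>)"
  then show "\<exists>S k. finite S \<and> mps_const c * f = (\<Sum>\<alpha>\<in>S. mps_const (k \<alpha>) * hprod \<alpha>)"
    by (intro exI[of _ S] exI[of _ "\<lambda>\<alpha>. c * k \<alpha>"]) (simp add: mps_const.hom_mult sum_distrib_left mult.assoc)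
qed

lemma hspan_add: "hspan f \<Longrightarrow> hspan g \<Longrightarrow> hspan (f + g)"
  unfolding hspan_def
proof (elim exE conjE)
  fix S k S' k' assume S: "finite S" "f = (\<Sum>\<alpha>\<in>S. mps_const (k \<alpha>) * hprod \<alpha>)"
    and S': "finite S'" "g = (\<Sum>\<alpha>\<in>S'. mps_const (k' \<alpha>) * hprod \<alpha>)"
  have "f = (\<Sum>\<alpha>\<in>S \<union> S'. mps_const (if \<alpha> \<in> S then k \<alpha> else 0) * hprod \<alpha>)"
    unfolding S(2) by (rule sum.mono_neutral_cong_left) (use S(1) S'(1) in auto)
  moreover have "g = (\<Sum>\<alpha>\<in>S \<union> S'. mps_const (if \<alpha> \<in> S' then k' \<alpha> else 0) * hprod \<alpha>)"
    unfolding S'(2) by (rule sum.mono_neutral_cong_left) (use S(1) S'(1) in auto)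
  ultimately have "f + g = (\<Sum>\<alpha>\<in>S \<union> S'. mps_const ((if \<alpha> \<in> S then k \<alpha> else 0) + (if \<alpha> \<in> S' then k' \<alpha> else 0)) * hprod \<alpha>)"
    by (simp only: mps_const.hom_add distrib_right sum.distrib)
  then show "\<exists>S k. finite S \<and> f + g = (\<Sum>\<alpha>\<in>S. mps_const (k \<alpha>) * hprod \<alpha>)"
    using S(1) S'(1) by (intro exI[of _ "S \<union> S'"] exI[of _ "\<lambda>\<alpha>. (if \<alpha> \<in> S then k \<alpha> else 0) + (if \<alpha> \<in> S' then k' \<alpha> else 0)"]) simp
qed

lemma hspan_0: "hspan 0"
  unfolding hspan_def by (rule exI[of _ "{}"]) simp

lemma hspan_sum: "(\<And>x. x \<in> S \<Longrightarrow> hspan (f x)) \<Longrightarrow> hspan (sum f S)"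
  by (induction S rule: infinite_finite_induct) (auto simp: hspan_add hspan_0)

lemma hspan_schur: "hspan (schur lam)"
  unfolding schur_eq_JT[OF order_refl] JT_schur_eta detf_leibniz prod_eta_0
proof (rule hspan_sum)
  fix \<pi> :: "nat \<Rightarrow> nat"
  show "hspan (of_int (sign \<pi>) * (if \<forall>i<length lam. 0 \<le> int (part lam (Suc i)) - int (Suc i) + int (Suc (\<pi> i))
    then hprod (mon (length lam) (\<lambda>i. nat (int (part lam (Suc i)) - int (Suc i) + int (Suc (\<pi> i))))) else 0))"
    using hspan_const_mult[OF hspan_hprod, of "of_int (sign \<pi>)"] hspan_0
    by (simp only: mps_const.hom_of_int mult_zero_right split: if_split) simp
qed

text \<open>Bounded degree makes the Schur expansion finite, and each Schur function is a signed sum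
  of the \<open>hprod\<close> by its Jacobi--Trudi determinant.\<close>

lemma hspan_Lam:
  assumes "f \<in> Lam"
  shows "hspan f"
proof -
  obtain d where d: "\<And>M. mps_coeff f M \<noteq> 0 \<Longrightarrow> size M \<le> d"
    using assms by (auto simp: Lam_iff)
  have sym: "mps_symmetric f" using assms by (simp add: Lam_iff)
  have "f = (\<Sum>lam | lam \<in> Par \<and> sum_list lam \<le> d. mps_const (schur_coeff f lam) * schur lam)"
  proof (rule mps_eqI)
    fix M
    have "(\<Sum>lam | lam \<in> Par \<and> sum_list lam \<le> d. schur_coeff f lam * mps_coeff (schur lam) M)
      = (\<Sum>lam | lam \<in> Par \<and> sum_list lam = size M. schur_coeff f lam * mps_coeff (schur lam) M)"
      using finite_Par_size finite_Par_size_eq schur_coeff_bounded[OF sym d] mps_coeff_schur_0[of _ M]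
      by (intro sum.mono_neutral_cong) auto
    then show "mps_coeff f M
      = mps_coeff (\<Sum>lam | lam \<in> Par \<and> sum_list lam \<le> d. mps_const (schur_coeff f lam) * schur lam) M"
      using schur_expansion_schur_coeff[OF sym] by (simp add: schur_expansion_iff)
  qed
  then show ?thesis
    using hspan_sum hspan_const_mult hspan_schur by (metis (no_types, lifting))
qed

section \<open>Negative binomial coefficients\<close>

text \<open>The coefficient of \<open>Y\<^sup>c\<close> in \<open>(1 - \<beta> Y)\<^sup>-\<^sup>m\<close>.\<close>

definition Pc :: "int \<Rightarrow> int \<Rightarrow> K" where
  "Pc m c = zbinom (- m) c * (- beta) ^ nat c"

lemma Pc_neg: "c < 0 \<Longrightarrow> Pc m c = 0"
  by (simp add: Pc_def zbinom_def)

lemma Pc_0_right [simp]: "Pc m 0 = 1"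
  by (simp add: Pc_def zbinom_def)

lemma Pc_of_nat: "Pc m (int c) = (- of_int m gchoose c) * (- beta) ^ c"
  by (simp add: Pc_def zbinom_def)

lemma zbinom_of_nat: "zbinom a (int n) = of_int a gchoose n"
  by (simp add: zbinom_def)

lemma Pc_0_left: "Pc 0 c = (if c = 0 then 1 else 0)"
  by (cases "c < 0"; cases "nat c") (auto simp: Pc_def zbinom_def)

text \<open>The identity \<open>(1 - \<beta> Y) (1 - \<beta> Y)^-m = (1 - \<beta> Y)^-(m -
  1)\<close> read at \<open>Y^c\<close>.\<close>

lemma Pc_rec: "Pc m c = Pc (m - 1) c + beta * Pc m (c - 1)"
proof (cases "c \<le> 0")
  case True
  then show ?thesis by (cases "c = 0") (auto simp: Pc_neg)
next
  case False
  then obtain k where k: "c = int (Suc k)" using zero_less_imp_eq_int[of c] gr0_conv_Suc by auto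
  have "(- of_int m + 1 :: K) gchoose Suc k = (- of_int m gchoose k) + (- of_int m gchoose Suc k)"
    by (rule gbinomial_Suc_Suc)
  moreover have "- of_int (m - 1) = (- of_int m + 1 :: K)" by simp
  ultimately have "Pc (m - 1) (int (Suc k)) = ((- of_int m gchoose k) + (- of_int m gchoose Suc k)) * (- beta) ^ Suc k"
    by (simp only: Pc_of_nat)
  also have "\<dots> = Pc m (int (Suc k)) - beta * Pc m (int k)"
    by (simp only: Pc_of_nat) (simp add: algebra_simps)
  finally show ?thesis by (simp add: k)
qed

text \<open>For nonpositive \<open>m\<close> the power \<open>(1 - \<beta> Y)^-m\<close> is a
  polynomial of degree \<open>-m\<close>.\<close>

lemma Pc_zero:
  assumes "m \<le> 0" "- m < c"
  shows "Pc m c = 0"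
proof -
  obtain k where "c = int k" using assms zero_le_imp_eq_int[of c] by auto
  moreover obtain l where "- m = int l" using assms(1) zero_le_imp_eq_int[of "- m"] by auto
  ultimately show ?thesis using assms Pc_of_nat[of m k]
    by (simp add: binomial_gbinomial[symmetric] flip: of_int_minus)
qed

lemma Pc_Vandermonde_nat: "(\<Sum>c\<le>n. Pc a (int c) * Pc b (int n - int c)) = Pc (a + b) (int n)"
proof -
  have "(\<Sum>c\<le>n. Pc a (int c) * Pc b (int n - int c))
    = (\<Sum>c\<le>n. ((- of_int a gchoose c) * (- of_int b gchoose (n - c))) * (- beta) ^ n)"
  proof (rule sum.cong[OF refl])
    fix c assume "c \<in> {..n}"
    then have "int n - int c = int (n - c)" "(- beta) ^ n = (- beta) ^ c * (- beta) ^ (n - c)"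
      by (auto simp: of_nat_diff simp flip: power_add)
    then show "Pc a (int c) * Pc b (int n - int c) = ((- of_int a gchoose c) * (- of_int b gchoose (n - c))) * (- beta) ^ n"
      by (simp only: Pc_of_nat) (simp add: mult_ac)
  qed
  also have "\<dots> = (- of_int a + - of_int b gchoose n) * (- beta) ^ n"
    by (simp only: sum_distrib_right[symmetric] atMost_atLeast0 gbinomial_Vandermonde)
  finally show ?thesis by (simp add: Pc_of_nat)
qed

lemma Pc_Vandermonde:
  assumes "finite S" "\<And>c. 0 \<le> c \<Longrightarrow> c \<le> C \<Longrightarrow> Pc a c \<noteq> 0 \<Longrightarrow> c \<in> S"
  shows "(\<Sum>c\<in>S. Pc a c * Pc b (C - c)) = Pc (a + b) C"
proof -
  have "(\<Sum>c\<in>S. Pc a c * Pc b (C - c)) = (\<Sum>c\<in>{0..C}. Pc a c * Pc b (C - c))"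
  proof (rule sum.mono_neutral_cong)
    show "Pc a c * Pc b (C - c) = 0" if "c \<in> S - {0..C}" for c
      using that Pc_neg[of c a] Pc_neg[of "C - c" b] by auto
  qed (use assms in auto)
  also have "\<dots> = Pc (a + b) C"
  proof (cases "C < 0")
    case False
    then obtain n where C: "C = int n" by (metis not_less zero_le_imp_eq_int)
    have "(\<Sum>c\<in>{0..C}. Pc a c * Pc b (C - c)) = (\<Sum>c\<le>n. Pc a (int c) * Pc b (int n - int c))"
      by (rule sum.reindex_bij_witness[where i = int and j = nat]) (auto simp: C)
    then show ?thesis by (simp add: Pc_Vandermonde_nat C)
  qed (simp add: Pc_neg)
  finally show ?thesis .
qed

text \<open>Put \<open>\<phi> = Y / (1 - \<beta> Y)\<close>. The sum is the coefficient of
  \<open>Y^q\<close> in \<open>(1 - \<beta> Y)^(a - b) (1 + \<beta> \<phi>)^a\<close>, and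
  \<open>1 + \<beta> \<phi> = (1 - \<beta> Y)^-1\<close>. The proof needs only Vandermonde
  convolution, once the upper indices are freed from \<open>n\<close>.\<close>

lemma Pc_zbinom_sum_nat:
  "(\<Sum>n\<le>q. zbinom a (int n) * beta ^ n * Pc (b - a + int n) (int q - int n)) = Pc b (int q)"
proof -
  have "(\<Sum>n\<le>q. zbinom a (int n) * beta ^ n * Pc (b - a + int n) (int q - int n))
    = (\<Sum>n\<le>q. ((of_int a gchoose n) * (of_nat q - of_int a + of_int b - 1 gchoose (q - n))) * beta ^ q)"
  proof (rule sum.cong[OF refl])
    fix n assume n: "n \<in> {..q}"
    then have 1: "int q - int n = int (q - n)" "beta ^ q = beta ^ n * beta ^ (q - n)"
      by (auto simp: of_nat_diff simp flip: power_add)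
    \<comment> \<open>Upper negation replaces the upper index, which varies with \<open>n\<close>,
      by the constant \<open>q - a + b - 1\<close>.\<close>
    have "- of_int (b - a + int n) gchoose (q - n)
      = (- 1) ^ (q - n) * (of_nat (q - n) - (- of_int (b - a + int n)) - 1 gchoose (q - n) :: K)"
      by (rule gbinomial_negated_upper)
    also have "of_nat (q - n) - (- of_int (b - a + int n)) - 1 = (of_nat q - of_int a + of_int b - 1 :: K)"
      using n by (simp add: of_nat_diff)
    finally have 2: "- of_int (b - a + int n) gchoose (q - n)
      = (- 1) ^ (q - n) * (of_nat q - of_int a + of_int b - 1 gchoose (q - n) :: K)" .
    have 3: "(- beta) ^ (q - n) = (- 1) ^ (q - n) * beta ^ (q - n)"
      by (rule power_minus)
    have 4: "(- 1) ^ (q - n) * (- 1) ^ (q - n) = (1 :: K)"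
      by (simp flip: power_mult_distrib)
    have "zbinom a (int n) * beta ^ n * Pc (b - a + int n) (int q - int n)
      = ((- 1) ^ (q - n) * (- 1) ^ (q - n)) * ((of_int a gchoose n) *
        (of_nat q - of_int a + of_int b - 1 gchoose (q - n)) * (beta ^ n * beta ^ (q - n)))"
      unfolding 1(1) Pc_of_nat zbinom_of_nat 2 3 by (simp only: mult_ac)
    then show "zbinom a (int n) * beta ^ n * Pc (b - a + int n) (int q - int n)
      = ((of_int a gchoose n) * (of_nat q - of_int a + of_int b - 1 gchoose (q - n))) * beta ^ q"
      by (simp only: 4 1(2) mult_1_left)
  qed
  also have "\<dots> = (of_int a + (of_nat q - of_int a + of_int b - 1) gchoose q) * beta ^ q"
    by (simp only: sum_distrib_right[symmetric] atMost_atLeast0 gbinomial_Vandermonde)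
  also have "of_int a + (of_nat q - of_int a + of_int b - 1) = (of_nat q - (- of_int b) - 1 :: K)"
    by simp
  also have "(of_nat q - (- of_int b) - 1 gchoose q) * beta ^ q = (- of_int b gchoose q) * (- beta) ^ q"
  proof -
    have "- of_int b gchoose q = (- 1) ^ q * (of_nat q - (- of_int b) - 1 gchoose q :: K)"
      by (rule gbinomial_negated_upper)
    moreover have "(- beta) ^ q = (- 1) ^ q * beta ^ q" by (rule power_minus)
    moreover have "(- 1) ^ q * (- 1) ^ q = (1 :: K)" by (simp flip: power_mult_distrib)
    ultimately show ?thesis by (metis (no_types, lifting) mult.assoc mult.left_commute mult_1_left)
  qed
  finally show ?thesis by (simp add: Pc_of_nat)
qed

lemma Pc_zbinom_sum:
  assumes "q < int N"
  shows "(\<Sum>n<N. zbinom a (int n) * beta ^ n * Pc (b - a + int n) (q - int n)) = Pc b q"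
proof (cases "q < 0")
  case True
  then show ?thesis by (simp add: Pc_neg)
next
  case False
  then obtain m where q: "q = int m" by (metis not_less zero_le_imp_eq_int)
  have "(\<Sum>n<N. zbinom a (int n) * beta ^ n * Pc (b - a + int n) (q - int n))
    = (\<Sum>n\<le>m. zbinom a (int n) * beta ^ n * Pc (b - a + int n) (q - int n))"
    by (rule sum.mono_neutral_right) (use assms q in \<open>auto simp: Pc_neg\<close>)
  then show ?thesis by (simp add: q Pc_zbinom_sum_nat)
qed

section \<open>The one-row series\<close>

text \<open>This is \<^term>\<open>wpoly beta M\<close> in the variable \<open>z = w - \<beta>\<close>.\<close>

definition gpoly :: "nat multiset \<Rightarrow> K poly" where
  "gpoly M = [:beta, 1:] ^ card (set_mset M) * [:0, 1:] ^ (size M - card (set_mset M))"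

lemma gpoly_empty [simp]: "gpoly {#} = 1"
  by (simp add: gpoly_def)

lemma gpoly_add_new: "l \<notin># M \<Longrightarrow> gpoly (add_mset l M) = [:beta, 1:] * gpoly M"
  by (simp add: gpoly_def mult.assoc del: mult_pCons_left mult_pCons_right)

lemma gpoly_add_old: "l \<in># M \<Longrightarrow> gpoly (add_mset l M) = [:0, 1:] * gpoly M"
  using card_set_mset_le[of M]
  by (simp add: gpoly_def insert_absorb Suc_diff_le mult_ac del: mult_pCons_left mult_pCons_right)

definition gseries :: "nat \<Rightarrow> K mps" where
  "gseries a = Abs_mps (\<lambda>M. coeff (gpoly M) a)"

lemma mps_coeff_gseries [simp]: "mps_coeff (gseries a) M = coeff (gpoly M) a"
  by (simp add: gseries_def)

text \<open>The counterpart of \<open>HL_var_relation\<close> in the variable \<open>z\<close>: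
  multiplying by \<open>1 - x z\<close> for the last variable leaves the factor
  \<open>1 + \<beta> x\<close>.\<close>

lemma gseries_relation:
  "mps_restrict (Suc N) (gseries a) - mps_var N * (if a = 0 then 0 else mps_restrict (Suc N) (gseries (a - 1)))
    = (1 + mps_const beta * mps_var N) * mps_restrict N (gseries a)"
proof (rule mps_eqI)
  fix M
  show "mps_coeff (mps_restrict (Suc N) (gseries a) - mps_var N * (if a = 0 then 0 else mps_restrict (Suc N) (gseries (a - 1)))) M
    = mps_coeff ((1 + mps_const beta * mps_var N) * mps_restrict N (gseries a)) M"
  proof (cases "N \<in># M")
    case False
    then have "set_mset M \<subseteq> {..<Suc N} \<longleftrightarrow> set_mset M \<subseteq> {..<N}" by (auto simp: less_Suc_eq)
    with False show ?thesis by (simp add: distrib_right mult.assoc)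
  next
    case True
    then obtain M' where M: "M = add_mset N M'" by (blast dest: multi_member_split)
    show ?thesis
    proof (cases "N \<in># M'")
      case True
      then have "\<not> set_mset M' \<subseteq> {..<N}" by auto
      then show ?thesis using True
        by (cases a) (auto simp add: M distrib_right mult.assoc gpoly_add_old)
    next
      case False
      then have "set_mset M' \<subseteq> {..<Suc N} \<longleftrightarrow> set_mset M' \<subseteq> {..<N}" by (auto simp: less_Suc_eq)
      with False show ?thesis
        by (cases a) (auto simp add: M distrib_right mult.assoc gpoly_add_new)
    qed
  qed
qed

lemma gen_product_partial:
  "(\<Prod>l<N. fps_const (1 + mps_const beta * mps_var l) * geometric_fps (mps_var l))
    = Abs_fps (\<lambda>a. mps_restrict N (gseries a))"
proof (induction N)
  case 0
  have "mps_restrict 0 (gseries a) = (if a = 0 then 1 else 0)" for a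
    by (rule mps_eqI) (auto simp: coeff_1)
  then show ?case by (simp add: fps_eq_iff)
next
  case (Suc N)
  let ?F = "\<lambda>N. Abs_fps (\<lambda>a. mps_restrict N (gseries a))"
  let ?x = "mps_var N :: K mps"
  have "?F (Suc N) * (1 - fps_const ?x * fps_X) = fps_const (1 + mps_const beta * ?x) * ?F N"
  proof (rule fps_ext)
    fix a
    have "fps_nth (?F (Suc N) * (1 - fps_const ?x * fps_X)) a
      = mps_restrict (Suc N) (gseries a) - ?x * (if a = 0 then 0 else mps_restrict (Suc N) (gseries (a - 1)))"
    proof -
      have "?F (Suc N) * (1 - fps_const ?x * fps_X) = ?F (Suc N) - fps_const ?x * (fps_X * ?F (Suc N))"
        by (simp add: algebra_simps)
      then show ?thesis by simp
    qed
    also have "\<dots> = (1 + mps_const beta * ?x) * mps_restrict N (gseries a)"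
      by (rule gseries_relation)
    finally show "fps_nth (?F (Suc N) * (1 - fps_const ?x * fps_X)) a
      = fps_nth (fps_const (1 + mps_const beta * ?x) * ?F N) a"
      by simp
  qed
  then have "?F (Suc N) * ((1 - fps_const ?x * fps_X) * geometric_fps ?x)
    = ?F N * (fps_const (1 + mps_const beta * ?x) * geometric_fps ?x)"
    by (metis (no_types, lifting) mult.assoc mult.commute)
  then show ?case by (simp add: geometric_fps Suc del: fps_const_add fps_const_mult)
qed

lemma gen_product_coeff_eq: "gen_product_coeff a = gseries a"
  unfolding gen_product_coeff_def gen_product_partial fps_nth_Abs_fps
proof (rule limI)
  show "(\<lambda>N. mps_restrict N (gseries a)) \<longlonglongrightarrow> gseries a"
    unfolding tendsto_mps_iff
  proof
    fix M :: "nat multiset"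
    obtain m where "set_mset M \<subseteq> {..<m}"
      by (meson finite_nat_iff_bounded finite_set_mset)
    then show "\<forall>\<^sub>F N in sequentially. mps_coeff (mps_restrict N (gseries a)) M = mps_coeff (gseries a) M"
      by (intro eventually_sequentiallyI[of m]) auto
  qed
qed

section \<open>The one-row series as functionals, and their binomial sums\<close>

lemma mps_sums_iff:
  "F sums (f :: K mps) \<longleftrightarrow> (\<forall>M. \<exists>N0. \<forall>N\<ge>N0. (\<Sum>n<N. mps_coeff (F n) M) = mps_coeff f M)"
  by (simp add: sums_def tendsto_mps_iff eventually_sequentially)

text \<open>Induction on the monomial: a further variable multiplies \<open>gpoly\<close> by
  \<open>z\<close> or by \<open>z + \<beta>\<close>, which is matched by \<open>Pc_rec\<close> on
  the right. The bound on \<open>size M\<close> makes the truncated sum complete, since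
  \<open>gpoly M\<close> has degree \<open>size M\<close>; it is inherited for both \<open>m\<close>
  and \<open>m - 1\<close>.\<close>

lemma G_int_coeff:
  "size M < int N + m \<Longrightarrow> (\<Sum>p<N. (- beta) ^ p * (if 0 \<le> m + int p then coeff (gpoly M) (nat (m + int p)) else 0))
    = mps_coeff (HL beta (\<lambda>k. Pc m (k - m))) M"
proof (induction M arbitrary: m)
  case empty
  show ?case
  proof (cases "m \<le> 0")
    case True
    then obtain d where m: "m = - int d" by (metis add.inverse_inverse neg_0_le_iff_le zero_le_imp_eq_int)
    then have "d < N" using empty by simp
    have "(\<Sum>p<N. (- beta) ^ p * (if 0 \<le> m + int p then coeff (gpoly {#}) (nat (m + int p)) else 0)) = (- beta) ^ d"
      by (rule sum_eq_single[where a = d]) (use \<open>d < N\<close> m in \<open>auto simp: coeff_1\<close>)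
    also have "\<dots> = Pc m (- m)"
      using Pc_of_nat[of m d] by (simp add: m binomial_gbinomial[symmetric])
    finally show ?thesis by simp
  next
    case False
    then show ?thesis by (auto simp: coeff_1 Pc_neg intro!: sum.neutral)
  qed
next
  case (add l M)
  let ?l = "\<lambda>m q. \<Sum>p<N. (- beta) ^ p * (if 0 \<le> m + int p then coeff q (nat (m + int p)) else 0)"
  \<comment> \<open>Multiplication by \<open>z\<close> lowers the power to be extracted by
    one.\<close>
  have shift: "?l m (pCons 0 q) = ?l (m - 1) q" for m q
  proof (rule sum.cong[OF refl])
    fix p
    have "(if 0 \<le> m + int p then coeff (pCons 0 q) (nat (m + int p)) else 0)
      = (if 0 \<le> m - 1 + int p then coeff q (nat (m - 1 + int p)) else 0)"
    proof (cases "0 < m + int p")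
      case True
      then obtain d where "m + int p = int (Suc d)" using zero_less_imp_eq_int gr0_conv_Suc by metis
      then have "m + int p = int (Suc d)" "m - 1 + int p = int d" by simp_all
      then show ?thesis by (simp only: nat_int coeff_pCons_Suc of_nat_0_le_iff if_True)
    next
      case False
      then show ?thesis by (cases "m + int p = 0") simp_all
    qed
    then show "(- beta) ^ p * (if 0 \<le> m + int p then coeff (pCons 0 q) (nat (m + int p)) else 0)
      = (- beta) ^ p * (if 0 \<le> m - 1 + int p then coeff q (nat (m - 1 + int p)) else 0)" by simp
  qed
  have rec: "Pc m (k + 1 - m) = Pc (m - 1) (k - (m - 1)) + beta * Pc m (k - m)" for k
    using Pc_rec[of m "k + 1 - m"] by (simp add: algebra_simps)
  have IH: "?l (m - 1) (gpoly M) = mps_coeff (HL beta (\<lambda>k. Pc (m - 1) (k - (m - 1)))) M"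
    "?l m (gpoly M) = mps_coeff (HL beta (\<lambda>k. Pc m (k - m))) M"
    using add.IH[of "m - 1"] add.IH[of m] add.prems by simp_all
  show ?case
  proof (cases "l \<in># M")
    case True
    have "mps_coeff (HL beta (\<lambda>k. Pc m (k - m))) (add_mset l M)
      = mps_coeff (HL beta (\<lambda>k. Pc (m - 1) (k - (m - 1)))) M"
      unfolding mps_coeff_HL_add_old[OF True] rec by simp
    moreover have "gpoly (add_mset l M) = pCons 0 (gpoly M)" using gpoly_add_old[OF True] by simp
    ultimately show ?thesis by (simp only: shift IH)
  next
    case False
    have "mps_coeff (HL beta (\<lambda>k. Pc m (k - m))) (add_mset l M)
      = mps_coeff (HL beta (\<lambda>k. Pc (m - 1) (k - (m - 1)))) M + beta * mps_coeff (HL beta (\<lambda>k. Pc m (k - m))) M"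
      unfolding mps_coeff_HL_add_new[OF False] rec HL_add HL_scale by simp
    moreover have "?l m (gpoly (add_mset l M)) = ?l m (pCons 0 (gpoly M)) + beta * ?l m (gpoly M)"
    proof -
      have "coeff (gpoly (add_mset l M)) a = coeff (pCons 0 (gpoly M)) a + beta * coeff (gpoly M) a" for a
        by (simp add: gpoly_add_new[OF False] add.commute)
      then show ?thesis
        unfolding sum_distrib_left sum.distrib[symmetric]
        by (intro sum.cong refl) (simp add: distrib_left mult.left_commute)
    qed
    ultimately show ?thesis by (simp only: shift IH)
  qed
qed

text \<open>The functional on the right extracts the coefficients of \<open>\<phi>^m\<close>, for
  \<open>m\<close> of either sign. The constant values for \<open>m \<le> 0\<close> are thereby on
  the same footing as the genuine one-row polynomials.\<close>

lemma G_int_eq: "G_int m = HL beta (\<lambda>k. Pc m (k - m))"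
  unfolding G_int_def
proof (rule sums_unique[symmetric], unfold mps_sums_iff, intro allI)
  fix M
  show "\<exists>N0. \<forall>N\<ge>N0. (\<Sum>p<N. mps_coeff (mps_const ((- beta) ^ p) *
      (if m + int p \<ge> 0 then gen_product_coeff (nat (m + int p)) else 0)) M)
    = mps_coeff (HL beta (\<lambda>k. Pc m (k - m))) M"
  proof (intro exI allI impI)
    fix N assume "nat (int (size M) - m) + 1 \<le> N"
    then have "int (size M) < int N + m" by linarith
    from G_int_coeff[OF this]
    show "(\<Sum>p<N. mps_coeff (mps_const ((- beta) ^ p) *
      (if m + int p \<ge> 0 then gen_product_coeff (nat (m + int p)) else 0)) M)
      = mps_coeff (HL beta (\<lambda>k. Pc m (k - m))) M"
      by (simp add: gen_product_coeff_eq if_distrib[of "\<lambda>f. mps_coeff f M"] cong: if_cong)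
  qed
qed

text \<open>In terms of functionals this is \<open>\<beta>^s \<phi>^(b - a) (1 + \<beta> \<phi>)^a =
  \<beta>^s Y^(b - a) (1 - \<beta> Y)^-b\<close>. The binomial in an entry of the determinant uses
  \<open>s = 0\<close>, the one in \<open>Delta\<close> a positive \<open>s\<close>.\<close>

lemma G_int_zbinom_sums:
  "(\<lambda>n. mps_const (zbinom a (int n - int s) * beta ^ n) * G_int (b - a - int s + int n))
    sums (mps_const (beta ^ s) * HL beta (\<lambda>k. Pc b (k + a - b)))"
  unfolding mps_sums_iff
proof (intro allI exI impI)
  \<comment> \<open>Beyond this bound \<open>N - s\<close> exceeds \<open>k + a - b\<close> for
    every \<open>k \<le> size M\<close>, as \<open>Pc_zbinom_sum\<close> demands.\<close>
  fix M :: "nat multiset" and N assume N: "s + nat (int (size M) + a - b) + 1 \<le> N"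
  let ?w = "\<lambda>k. coeff (wpoly beta M) k"
  define N' where "N' = N - s"
  have "(\<Sum>n<N. mps_coeff (mps_const (zbinom a (int n - int s) * beta ^ n) * G_int (b - a - int s + int n)) M)
    = (\<Sum>n\<in>{s..<N}. zbinom a (int n - int s) * beta ^ n * mps_coeff (G_int (b - a - int s + int n)) M)"
    unfolding mps_coeff_const_mult
    by (rule sum.mono_neutral_right) (auto simp: zbinom_def)
  also have "\<dots> = (\<Sum>n<N'. zbinom a (int n) * beta ^ (s + n) * mps_coeff (G_int (b - a + int n)) M)"
    by (rule sum.reindex_bij_witness[where i = "\<lambda>n. n + s" and j = "\<lambda>n. n - s"])
       (auto simp: N'_def of_nat_diff algebra_simps)
  also have "\<dots> = (\<Sum>n<N'. \<Sum>k\<le>size M. zbinom a (int n) * beta ^ (s + n) * (?w k * Pc (b - a + int n) (int k - (b - a + int n))))"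
    by (simp add: G_int_eq mps_coeff_HL sum_distrib_left)
  also have "\<dots> = (\<Sum>k\<le>size M. beta ^ s * (?w k * (\<Sum>n<N'. zbinom a (int n) * beta ^ n * Pc (b - a + int n) (int k + a - b - int n))))"
    unfolding sum_distrib_left
    by (subst sum.swap) (intro sum.cong refl, simp add: power_add algebra_simps)
  also have "\<dots> = (\<Sum>k\<le>size M. beta ^ s * (?w k * Pc b (int k + a - b)))"
  proof (intro sum.cong refl)
    fix k assume "k \<in> {..size M}"
    then have "int k + a - b < int N'" using N unfolding N'_def by auto
    from Pc_zbinom_sum[OF this]
    show "beta ^ s * (?w k * (\<Sum>n<N'. zbinom a (int n) * beta ^ n * Pc (b - a + int n) (int k + a - b - int n)))
      = beta ^ s * (?w k * Pc b (int k + a - b))" by simp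
  qed
  also have "\<dots> = mps_coeff (mps_const (beta ^ s) * HL beta (\<lambda>k. Pc b (k + a - b))) M"
    by (simp add: mps_coeff_HL sum_distrib_left)
  finally show "(\<Sum>n<N. mps_coeff (mps_const (zbinom a (int n - int s) * beta ^ n) * G_int (b - a - int s + int n)) M)
    = mps_coeff (mps_const (beta ^ s) * HL beta (\<lambda>k. Pc b (k + a - b))) M" .
qed

lemma mps_sums_diff:
  assumes "F sums f" "F' sums (g :: K mps)"
  shows "(\<lambda>n. F n - F' n) sums (f - g)"
  unfolding mps_sums_iff
proof
  fix M
  obtain N1 N2 where "\<forall>N\<ge>N1. (\<Sum>n<N. mps_coeff (F n) M) = mps_coeff f M"
    "\<forall>N\<ge>N2. (\<Sum>n<N. mps_coeff (F' n) M) = mps_coeff g M"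
    using assms unfolding mps_sums_iff by metis
  then show "\<exists>N0. \<forall>N\<ge>N0. (\<Sum>n<N. mps_coeff (F n - F' n) M) = mps_coeff (f - g) M"
    by (intro exI[of _ "max N1 N2"]) (auto simp: sum_subtractf)
qed

text \<open>The finite geometric sum \<open>(1 - (\<beta> Y)^(s + 1)) / (1 - \<beta> Y)\<close>
  times \<open>(1 - \<beta> Y)^-m\<close>. The subtracted term is what \<open>Delta\<close>
  contributes to a column with a zero part.\<close>

lemma Pc_telescope:
  "Pc (m + 1) c - beta ^ Suc s * Pc (m + 1) (c - int (Suc s)) = (\<Sum>t\<le>s. beta ^ t * Pc m (c - int t))"
proof (induction s)
  case 0
  then show ?case using Pc_rec[of "m + 1" c] by simp
next
  case (Suc s)
  then show ?case using Pc_rec[of "m + 1" "c - int (Suc s)"] by (simp add: algebra_simps)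
qed

section \<open>Stable Grothendieck polynomials\<close>

text \<open>The coefficient of \<open>Y\<^sup>q\<close> in \<open>Y\<^sup>-\<^sup>i \<phi>\<^bsup>\<lambda>\<^sub>i\<^esup>\<close>, \<open>\<phi> = Y / (1 - \<beta> Y)\<close>; the argument \<open>i\<close> counts from 0.\<close>

definition Lrow :: "nat list \<Rightarrow> nat \<Rightarrow> int \<Rightarrow> K" where
  "Lrow lam i q = Pc (int (part lam (Suc i))) (q - int (part lam (Suc i)) + int (Suc i))"

lemma Lrow_tail: "length lam \<le> i \<Longrightarrow> Lrow lam i q = (if q = - int (Suc i) then 1 else 0)"
  by (auto simp: Lrow_def part_def Pc_0_left)

text \<open>In one variable the functional \<open>\<phi>^m Y^t\<close> yields
  \<open>\<phi>(Y)^m Y^t\<close>, and \<open>\<phi>(Y) = x\<close>. Each induction step divides by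
  the unit \<open>1 - \<beta> Y\<close>.\<close>

lemma HL_Pc_single:
  "mps_supported {l} (HL beta (\<lambda>k. Pc (int m) (k - int m - int t))) = mps_var l ^ m * yvar beta l ^ t"
proof (induction m)
  case 0
  have "HL beta (\<lambda>k. Pc 0 (k - int t)) = eta beta (int t)"
    unfolding eta_def Pc_0_left by simp
  then show ?case by (simp add: HL_single_eta)
next
  case (Suc m)
  let ?F = "\<lambda>m. mps_supported {l} (HL beta (\<lambda>k. Pc (int m) (k - int m - int t)))"
  let ?Y = "yvar beta l" and ?b = "mps_const beta"
  have "HL beta (\<lambda>k. Pc (int (Suc m)) (k + 1 - int (Suc m) - int t))
    = HL beta (\<lambda>k. Pc (int m) (k - int m - int t)) + ?b * HL beta (\<lambda>k. Pc (int (Suc m)) (k - int (Suc m) - int t))"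
    unfolding HL_scale[symmetric] HL_add[symmetric]
  proof (rule HL_cong)
    fix k
    show "Pc (int (Suc m)) (int k + 1 - int (Suc m) - int t)
      = Pc (int m) (int k - int m - int t) + beta * Pc (int (Suc m)) (int k - int (Suc m) - int t)"
      using Pc_rec[of "int (Suc m)" "int k + 1 - int (Suc m) - int t"] by (simp add: algebra_simps)
  qed
  moreover have "mps_supported {l} (f + ?b * g) = mps_supported {l} f + ?b * mps_supported {l} g" for f g
    by (rule mps_eqI) simp
  ultimately have "?F (Suc m) - ?Y * (?F m + ?b * ?F (Suc m)) = 0"
    using HL_yvar_relation[of l "{}" beta "\<lambda>k. Pc (int (Suc m)) (k - int (Suc m) - int t)"]
    by (simp add: mps_supported_empty_HL Pc_neg)
  then have "(1 - ?b * ?Y) * ?F (Suc m) = ?Y * ?F m"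
    by (simp add: algebra_simps)
  then have "(1 + ?b * mps_var l) * (1 - ?b * ?Y) * ?F (Suc m) = (1 + ?b * mps_var l) * ?Y * ?F m"
    by (simp add: mult.assoc)
  then show ?case
    using Suc by (simp only: yvar_inverse yvar_relation mult_1_left power_Suc mult.assoc)
qed

text \<open>Multiplying column \<open>l\<close> by \<open>(1 + b x)^(n - 1)\<close> clears the
  denominators of the powers of \<open>Y\<close> and leaves
  \<open>(1 + b x)^i x^(n - 1 - i)\<close>. The binomial theorem expands these rows unitriangularly
  in plain powers of \<open>x\<close>.\<close>

lemma vandermonde_alternator:
  "alternator b n * (\<Prod>l<n. (1 + mps_const b * mps_var l) ^ (n - 1)) = vandermonde n"
proof -
  let ?u = "\<lambda>l. 1 + mps_const b * mps_var l :: K mps"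
  define a :: "nat \<Rightarrow> nat \<Rightarrow> K mps"
    where "a i i' = (if i' \<le> i then of_nat (i choose i') * mps_const b ^ (i - i') else 0)" for i i'
  have "alternator b n * (\<Prod>l<n. ?u l ^ (n - 1)) = detf n (\<lambda>i l. ?u l ^ (n - 1) * yvar b l ^ (n - Suc i))"
    by (simp add: alternator_def detf_scale_cols mult.commute[of "detf n _"])
  also have "\<dots> = detf n (\<lambda>i l. \<Sum>i'<n. a i i' * mps_var l ^ (n - Suc i'))"
  proof (rule detf_cong)
    fix i l assume "i < n" "l < n"
    then have "n - 1 = i + (n - Suc i)" by simp
    then have "?u l ^ (n - 1) * yvar b l ^ (n - Suc i) = ?u l ^ i * (?u l * yvar b l) ^ (n - Suc i)"
      by (simp only: power_add power_mult_distrib mult_ac)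
    also have "\<dots> = (mps_const b * mps_var l + 1) ^ i * mps_var l ^ (n - Suc i)"
      by (simp only: yvar_relation add.commute)
    also have "\<dots> = (\<Sum>t\<le>i. of_nat (i choose t) * (mps_const b * mps_var l) ^ t * 1 ^ (i - t) * mps_var l ^ (n - Suc i))"
      by (simp only: binomial_ring sum_distrib_right)
    also have "\<dots> = (\<Sum>i'\<le>i. a i i' * mps_var l ^ (n - Suc i'))"
    proof (rule sum.reindex_bij_witness[where i = "\<lambda>t. i - t" and j = "\<lambda>t. i - t"])
      fix t assume t: "t \<in> {..i}"
      then have "n - Suc (i - t) = t + (n - Suc i)" using \<open>i < n\<close> by simp
      then show "a i (i - t) * mps_var l ^ (n - Suc (i - t))
        = of_nat (i choose t) * (mps_const b * mps_var l) ^ t * 1 ^ (i - t) * mps_var l ^ (n - Suc i)"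
        using t by (simp add: a_def power_add power_mult_distrib binomial_symmetric[of t i] mult_ac)
    qed auto
    also have "\<dots> = (\<Sum>i'<n. a i i' * mps_var l ^ (n - Suc i'))"
      by (rule sum.mono_neutral_left) (use \<open>i < n\<close> in \<open>auto simp: a_def\<close>)
    finally show "?u l ^ (n - 1) * yvar b l ^ (n - Suc i) = (\<Sum>i'<n. a i i' * mps_var l ^ (n - Suc i'))" .
  qed
  also have "\<dots> = detf n a * detf n (\<lambda>i l. mps_var l ^ (n - Suc i))"
    by (rule detf_mult)
  also have "detf n a = 1"
    by (subst detf_lower_triangular) (auto simp: a_def)
  finally show ?thesis by (simp add: alternator_0[symmetric] alternator_def yvar_0)
qed

text \<open>The one-variable entries are \<open>x^\<lambda>_i\<close> times a power of
  \<open>Y\<close>. The column factors that turn the alternator into the Vandermonde product also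
  clear these denominators, and the surplus \<open>(1 + \<beta> x)^i\<close> is the factor in the
  definition of \<open>G\<close>.\<close>

lemma JT_Lrow_alternant:
  assumes "length lam \<le> n"
  shows "mps_restrict n (JT beta (Lrow lam) n) * vandermonde n
    = detf n (\<lambda>i l. mps_var l ^ expo n lam i * (1 + mps_const beta * mps_var l) ^ i)"
proof -
  let ?u = "\<lambda>l. 1 + mps_const beta * mps_var l :: K mps"
  have "mps_restrict n (JT beta (Lrow lam) n) * alternator beta n
    = detf n (\<lambda>i l. mps_var l ^ part lam (Suc i) * yvar beta l ^ (n - Suc i))"
    unfolding JT_def HL_alternant
  proof (rule detf_cong)
    fix i l assume "i < n" "l < n"
    then have "(\<lambda>k. Lrow lam i (k - int n))
      = (\<lambda>k. Pc (int (part lam (Suc i))) (k - int (part lam (Suc i)) - int (n - Suc i)))"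
      by (auto simp: Lrow_def of_nat_diff algebra_simps)
    then show "mps_supported {l} (HL beta (\<lambda>k. Lrow lam i (k - int n)))
      = mps_var l ^ part lam (Suc i) * yvar beta l ^ (n - Suc i)"
      by (simp only: HL_Pc_single)
  qed
  then have "mps_restrict n (JT beta (Lrow lam) n) * vandermonde n
    = (\<Prod>l<n. ?u l ^ (n - 1)) * detf n (\<lambda>i l. mps_var l ^ part lam (Suc i) * yvar beta l ^ (n - Suc i))"
    unfolding vandermonde_alternator[of beta n, symmetric] mult.assoc[symmetric]
    by (simp only: mult.commute)
  also have "\<dots> = detf n (\<lambda>i l. ?u l ^ (n - 1) * (mps_var l ^ part lam (Suc i) * yvar beta l ^ (n - Suc i)))"
    by (simp add: detf_scale_cols)
  also have "\<dots> = detf n (\<lambda>i l. mps_var l ^ expo n lam i * ?u l ^ i)"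
  proof (rule detf_cong)
    fix i l assume "i < n" "l < n"
    then have eq: "n - 1 = i + (n - Suc i)" "expo n lam i = part lam (Suc i) + (n - Suc i)"
      by (simp_all add: expo_def)
    have "?u l ^ (n - 1) * (mps_var l ^ part lam (Suc i) * yvar beta l ^ (n - Suc i))
      = ?u l ^ i * (mps_var l ^ part lam (Suc i) * (?u l * yvar beta l) ^ (n - Suc i))"
      unfolding eq(1) power_add power_mult_distrib by (simp only: mult_ac)
    also have "\<dots> = mps_var l ^ expo n lam i * ?u l ^ i"
      unfolding yvar_relation eq(2) power_add by (simp only: mult_ac)
    finally show "?u l ^ (n - 1) * (mps_var l ^ part lam (Suc i) * yvar beta l ^ (n - Suc i))
      = mps_var l ^ expo n lam i * ?u l ^ i" .
  qed
  finally show ?thesis .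
qed

text \<open>Multiplication by the homogeneous Vandermonde product shifts the homogeneous components.\<close>

lemma mps_bounded_vandermonde:
  assumes "mps_bounded (mps_restrict n f * vandermonde n)"
  shows "mps_bounded (mps_restrict n f)"
proof -
  define g where "g = mps_restrict n f"
  define v where "v = (\<Sum>i<n. n - Suc i)"
  obtain d where d: "\<And>M. mps_coeff (g * vandermonde n) M \<noteq> 0 \<Longrightarrow> size M \<le> d"
    using assms unfolding mps_bounded_def g_def by blast
  have V: "size A = v" if "mps_coeff (vandermonde n) A \<noteq> 0" for A
  proof -
    have "int (size A) = (\<Sum>i<n. int (n - Suc i))"
      using mps_homogeneous_vandermonde[of n] that by (simp add: mps_homogeneous_def)
    then show ?thesis unfolding v_def by (metis of_nat_eq_iff of_nat_sum)
  qed
  have "size M \<le> d" if M: "mps_coeff g M \<noteq> 0" for M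
  proof (rule ccontr)
    assume big: "\<not> size M \<le> d"
    define h where "h = (Abs_mps (\<lambda>A. if size A = size M then mps_coeff g A else 0) :: K mps)"
    have "h * vandermonde n = 0"
    proof (rule mps_eqI)
      fix X
      have eq: "mps_coeff h A * mps_coeff (vandermonde n) (X - A) =
        (if size X = size M + v then mps_coeff g A * mps_coeff (vandermonde n) (X - A) else 0)" if "A \<subseteq># X" for A
      proof (cases "mps_coeff (vandermonde n) (X - A) = 0")
        case False
        then have "size X = size A + v"
          using V[of "X - A"] that by (metis size_union subset_mset.add_diff_inverse)
        then show ?thesis by (simp add: h_def)
      qed simp
      have "mps_coeff (h * vandermonde n) X = (if size X = size M + v then mps_coeff (g * vandermonde n) X else 0)"
        unfolding mps_coeff_mult using eq by (auto intro!: sum.cong sum.neutral)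
      also have "\<dots> = 0"
      proof (cases "size X = size M + v")
        case True
        with big have "\<not> size X \<le> d" by simp
        with d[of X] have "mps_coeff (g * vandermonde n) X = 0" by blast
        then show ?thesis by simp
      qed simp
      finally show "mps_coeff (h * vandermonde n) X = mps_coeff 0 X" by simp
    qed
    then have "h = 0" by (rule vandermonde_cancel)
    from arg_cong[OF this, of "\<lambda>f. mps_coeff f M"] show False using M by (simp add: h_def)
  qed
  then show ?thesis unfolding mps_bounded_def g_def by blast
qed

lemma JT_Lrow_stable: "length lam \<le> r \<Longrightarrow> JT beta (Lrow lam) r = JT beta (Lrow lam) (length lam)"
  by (rule JT_stable) (use Lrow_tail in auto)

text \<open>For \<open>n\<close> at least the length, the product with the Vandermonde product is a
  determinant of polynomials, and the degree bound descends through this homogeneous factor. A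
  smaller \<open>n\<close> only restricts further.\<close>

lemma mps_bounded_JT_Lrow: "mps_bounded (mps_restrict n (JT beta (Lrow lam) (length lam)))"
proof -
  have large: "mps_bounded (mps_restrict n (JT beta (Lrow lam) (length lam)))" if "length lam \<le> n" for n
  proof (rule mps_bounded_vandermonde)
    show "mps_bounded (mps_restrict n (JT beta (Lrow lam) (length lam)) * vandermonde n)"
      using JT_Lrow_alternant[OF that]
      by (simp add: JT_Lrow_stable[OF that])
         (intro mps_bounded_detf mps_bounded_mult mps_bounded_power mps_bounded_add mps_bounded_const)
  qed
  from large[of "max n (length lam)"] obtain d where
    d: "\<And>M. mps_coeff (mps_restrict (max n (length lam)) (JT beta (Lrow lam) (length lam))) M \<noteq> 0 \<Longrightarrow> size M \<le> d"
    unfolding mps_bounded_def by auto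
  show ?thesis
    unfolding mps_bounded_def
  proof (intro exI allI impI)
    fix M assume M: "mps_coeff (mps_restrict n (JT beta (Lrow lam) (length lam))) M \<noteq> 0"
    then have "set_mset M \<subseteq> {..<n}" by (auto split: if_splits)
    then have "set_mset M \<subseteq> {..<max n (length lam)}" by auto
    then show "size M \<le> d" using M d[of M] by (auto split: if_splits)
  qed
qed

lemma G_eq_JT:
  assumes "length lam \<le> r"
  shows "G lam = JT beta (Lrow lam) r"
proof -
  let ?g = "JT beta (Lrow lam) (length lam)"
  have det: "det (mat1 n (\<lambda>i j. mps_var (i - 1) ^ (part lam j + n - j) * (1 + mps_const beta * mps_var (i - 1)) ^ (j - 1)))
    = detf n (\<lambda>i l. mps_var l ^ expo n lam i * (1 + mps_const beta * mps_var l) ^ i)" for n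
    unfolding det_mat1 expo_def by (subst detf_transpose[symmetric]) simp
  have alt: "mps_restrict n ?g * vandermonde n = det (mat1 n (\<lambda>i j. mps_var (i - 1) ^ (part lam j + n - j) *
      (1 + mps_const beta * mps_var (i - 1)) ^ (j - 1)))" if "length lam \<le> n" for n
    unfolding det using JT_Lrow_alternant[OF that] by (simp only: JT_Lrow_stable[OF that])
  have hat: "?g \<in> Lam_hat"
  proof (rule Lam_hatI[OF mps_symmetric_JT])
    fix n
    show "\<exists>d. \<forall>M. set_mset M \<subseteq> {..<n} \<longrightarrow> mps_coeff ?g M \<noteq> 0 \<longrightarrow> size M \<le> d"
      using mps_bounded_JT_Lrow[of n lam] unfolding mps_bounded_def by (metis mps_coeff_simps(6))
  qed
  have "G lam = ?g"
    unfolding G_def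
  proof (rule the_equality, goal_cases)
    case 1
    show ?case using hat alt by blast
  next
    case (2 f)
    show ?case
    proof (rule mps_eqI_vandermonde[of "length lam"])
      fix n assume n: "length lam \<le> n"
      show "mps_restrict n f * vandermonde n = mps_restrict n ?g * vandermonde n"
        unfolding alt[OF n] using 2 n by blast
    qed
  qed
  then show ?thesis using JT_Lrow_stable[OF assms] by simp
qed

section \<open>Leading terms and dual families\<close>

text \<open>For negative \<open>k\<close> the condition is vacuous. This admits determinant entries
  of negative nominal degree, where the functional series need not vanish although
  \<open>eta 0 k\<close> does.\<close>

definition mps_lead :: "int \<Rightarrow> K mps \<Rightarrow> K mps \<Rightarrow> bool" where
  "mps_lead k f g \<longleftrightarrow> (\<forall>M. (int (size M) < k \<longrightarrow> mps_coeff f M = 0 \<and> mps_coeff g M = 0) \<and>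
     (int (size M) \<le> k \<longrightarrow> mps_coeff f M = mps_coeff g M))"

lemma mps_lead_mult:
  assumes "mps_lead k f g" "mps_lead k' f' g'"
  shows "mps_lead (k + k') (f * f') (g * g')"
proof -
  have *: "mps_coeff f A * mps_coeff f' (M - A) = mps_coeff g A * mps_coeff g' (M - A) \<and>
      (int (size M) < k + k' \<longrightarrow> mps_coeff f A * mps_coeff f' (M - A) = 0)"
    if "A \<subseteq># M" "int (size M) \<le> k + k'" for A M
  proof -
    have M: "size M = size A + size (M - A)"
      using that by (metis size_union subset_mset.add_diff_inverse)
    show ?thesis
    proof (cases "int (size A) < k \<or> int (size (M - A)) < k'")
      case True
      then show ?thesis using assms by (auto simp: mps_lead_def)
    next
      case False
      then have "int (size A) = k" "int (size (M - A)) = k'" using M that(2) by linarith+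
      then show ?thesis using assms M by (auto simp: mps_lead_def)
    qed
  qed
  have "mps_coeff (f * f') M = mps_coeff (g * g') M" if "int (size M) \<le> k + k'" for M
    unfolding mps_coeff_mult by (rule sum.cong) (use * that in auto)
  moreover have "mps_coeff (f * f') M = 0" if "int (size M) < k + k'" for M
    unfolding mps_coeff_mult by (rule sum.neutral) (use * that in fastforce)
  ultimately show ?thesis unfolding mps_lead_def by force
qed

lemma mps_lead_prod:
  "(\<And>x. x \<in> S \<Longrightarrow> mps_lead (k x) (f x) (g x)) \<Longrightarrow> mps_lead (\<Sum>x\<in>S. k x) (\<Prod>x\<in>S. f x) (\<Prod>x\<in>S. g x)"
proof (induction S rule: infinite_finite_induct)
  case (insert x S)
  then show ?case using mps_lead_mult by simp
qed (auto simp: mps_lead_def)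

lemma mps_lead_detf:
  assumes "\<And>i j. i < n \<Longrightarrow> j < n \<Longrightarrow> mps_lead (a i + d j) (e i j) (e' i j)"
  shows "mps_lead (\<Sum>i<n. a i + d i) (detf n e) (detf n e')"
proof -
  have "mps_lead (\<Sum>i<n. a i + d i) (\<Prod>i<n. e i (\<pi> i)) (\<Prod>i<n. e' i (\<pi> i))" if \<pi>: "\<pi> permutes {..<n}" for \<pi>
  proof -
    have "mps_lead (\<Sum>i<n. a i + d (\<pi> i)) (\<Prod>i<n. e i (\<pi> i)) (\<Prod>i<n. e' i (\<pi> i))"
      by (rule mps_lead_prod) (use assms permutes_in_image[OF \<pi>] in auto)
    then show ?thesis by (simp only: sum_permutes_lessThan[OF \<pi>])
  qed
  then show ?thesis
    unfolding detf_leibniz mps_lead_def mps_coeff_sum mps_coeff_of_int_mult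
    by (auto intro!: sum.cong sum.neutral)
qed

lemma mps_lead_HL:
  assumes "\<And>k. k < m \<Longrightarrow> c k = 0" "c m = 1"
  shows "mps_lead m (HL b c) (eta 0 m)"
proof -
  have "mps_coeff (HL b c) M = (if int (size M) = m then 1 else 0)" if "int (size M) \<le> m" for M
  proof -
    have "mps_coeff (HL b c) M = (\<Sum>k\<le>size M. if k = size M then c (int (size M)) else 0)"
      unfolding mps_coeff_HL by (rule sum.cong) (use that assms(1) coeff_wpoly_size in auto)
    then show ?thesis using that assms by auto
  qed
  then show ?thesis unfolding mps_lead_def by (auto simp: mps_coeff_h)
qed

text \<open>Each member is a Schur function plus terms of strictly larger degree, possibly
  infinitely many. Pairings with \<open>Lam\<close> still lead to finite unitriangular
  systems.\<close>

definition schur_triangular :: "(nat list \<Rightarrow> K mps) \<Rightarrow> bool" where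
  "schur_triangular F \<longleftrightarrow> (\<forall>lam\<in>Par. mps_symmetric (F lam) \<and>
     (\<forall>nu\<in>Par. sum_list nu \<le> sum_list lam \<longrightarrow> schur_coeff (F lam) nu = (if nu = lam then 1 else 0)))"

text \<open>Every row functional starts at \<open>w^(\<lambda>_i - i)\<close> with coefficient one,
  so the lowest terms of the entries are those of the Jacobi--Trudi matrix of the Schur
  function.\<close>

lemma schur_triangular_JT:
  assumes "\<And>lam i q. q < int (part lam (Suc i)) - int (Suc i) \<Longrightarrow> rw lam i q = 0"
    and "\<And>lam i. rw lam i (int (part lam (Suc i)) - int (Suc i)) = 1"
  shows "schur_triangular (\<lambda>lam. JT b (rw lam) (length lam))"
  unfolding schur_triangular_def
proof (intro ballI conjI impI)
  fix lam nu assume *: "lam \<in> Par" "nu \<in> Par" "sum_list nu \<le> sum_list lam"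
  let ?n = "length lam"
  have "mps_lead (\<Sum>i<?n. (int (part lam (Suc i)) - int (Suc i)) + int (Suc i)) (JT b (rw lam) ?n) (schur lam)"
    unfolding schur_eq_JT[OF order_refl] JT_schur_eta unfolding JT_def
  proof (rule mps_lead_detf, rule mps_lead_HL)
    fix i j :: nat and k
    show "rw lam i (k - int (Suc j)) = 0" if "k < int (part lam (Suc i)) - int (Suc i) + int (Suc j)"
      by (rule assms(1)) (use that in simp)
    show "rw lam i (int (part lam (Suc i)) - int (Suc i) + int (Suc j) - int (Suc j)) = 1"
      using assms(2) by (simp only: add_diff_cancel_right')
  qed
  then have "mps_lead (int (sum_list lam)) (JT b (rw lam) ?n) (schur lam)"
    by (simp add: of_nat_sum[symmetric] sum_part del: of_nat_sum)
  then have "mps_coeff (JT b (rw lam) ?n) M = mps_coeff (schur lam) M" if "size M = sum_list nu" for M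
    using that * by (simp add: mps_lead_def)
  then have "cfn (length nu) (JT b (rw lam) ?n) nu = cfn (length nu) (schur lam) nu"
    by (intro cfn_local) auto
  then have "schur_coeff (JT b (rw lam) ?n) nu = schur_coeff (schur lam) nu"
    by (simp add: schur_coeff_symmetric mps_symmetric_JT mps_symmetric_schur)
  then show "schur_coeff (JT b (rw lam) ?n) nu = (if nu = lam then 1 else 0)"
    using * by (simp add: schur_coeff_schur)
qed (rule mps_symmetric_JT)

text \<open>The degree of \<open>g\<close> is bounded, so its Schur coefficients can be shown to
  vanish from the largest size downwards: pairing with \<open>F nu\<close> sees the coefficient at
  \<open>nu\<close> and coefficients of larger size, which are already zero.\<close>

lemma dual_unique:
  assumes F: "schur_triangular F" and g: "g \<in> Lam" "\<And>lam. lam \<in> Par \<Longrightarrow> hall (F lam) g = 0"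
  shows "g = 0"
proof -
  have sym: "mps_symmetric g" using g by (simp add: Lam_iff)
  obtain d where d: "\<And>M. mps_coeff g M \<noteq> 0 \<Longrightarrow> size M \<le> d" using g by (auto simp: Lam_iff)
  have zero: "schur_coeff g nu = 0" if "nu \<in> Par" for nu
    using that
  proof (induction "Suc d - sum_list nu" arbitrary: nu rule: less_induct)
    case less
    show ?case
    proof (cases "sum_list nu \<le> d")
      case True
      have "hall (F nu) g = (\<Sum>lam | lam \<in> Par \<and> sum_list lam \<le> d. schur_coeff (F nu) lam * schur_coeff g lam)"
        by (rule hall_bounded[OF sym d])
      also have "\<dots> = schur_coeff g nu"
      proof (rule sum_eq_single[where a = nu])
        fix lam assume lam: "lam \<in> {lam. lam \<in> Par \<and> sum_list lam \<le> d}"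
        show "schur_coeff (F nu) lam * schur_coeff g lam = (if lam = nu then schur_coeff g nu else 0)"
        proof (cases "sum_list lam \<le> sum_list nu")
          case True
          then have "schur_coeff (F nu) lam = (if lam = nu then 1 else 0)"
            using F lam less.prems by (auto simp: schur_triangular_def)
          then show ?thesis by simp
        next
          case False
          then have "schur_coeff g lam = 0" using lam by (intro less.hyps) auto
          then show ?thesis using False by auto
        qed
      qed (use True less.prems finite_Par_size in auto)
      finally show ?thesis using g(2)[OF less.prems] by simp
    next
      case False
      then show ?thesis using schur_coeff_bounded[OF sym d, of nu] by blast
    qed
  qed
  show ?thesis
  proof (rule mps_eqI)
    fix M
    show "mps_coeff g M = mps_coeff 0 M"
      using schur_expansion_schur_coeff[OF sym] zero by (simp add: schur_expansion_iff)
  qed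
qed

text \<open>The values on the top layer of size \<open>N\<close> are matched by a combination of
  Schur functions. This disturbs only the values at smaller sizes, which the induction hypothesis
  corrects.\<close>

lemma dual_exists:
  assumes F: "schur_triangular F" and t: "\<And>kap. N \<le> sum_list kap \<Longrightarrow> t kap = 0"
  shows "\<exists>g\<in>Lam. \<forall>kap\<in>Par. hall (F kap) g = t kap"
  using t
proof (induction N arbitrary: t)
  case 0
  then show ?case using Lam_0 by (intro bexI[of _ 0]) (auto simp: hall_0_right)
next
  case (Suc N)
  let ?S = "{nu \<in> Par. sum_list nu = N}"
  define g0 where "g0 = (\<Sum>nu\<in>?S. mps_const (t nu) * schur nu)"
  define t' where "t' kap = (if kap \<in> Par then t kap - hall (F kap) g0 else 0)" for kap
  have g0: "g0 \<in> Lam" unfolding g0_def by (intro Lam_sum Lam_const_mult schur_Lam)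
  have "t' kap = 0" if "N \<le> sum_list kap" for kap
  proof (cases "kap \<in> Par")
    case True
    have "hall (F kap) g0 = (\<Sum>nu\<in>?S. t nu * schur_coeff (F kap) nu)"
      unfolding g0_def by (subst hall_sum_right) (auto simp: schur_Lam hall_schur)
    also have "\<dots> = (\<Sum>nu\<in>?S. if nu = kap then t kap else 0)"
      by (rule sum.cong) (use F True that in \<open>auto simp: schur_triangular_def\<close>)
    also have "\<dots> = (if sum_list kap = N then t kap else 0)"
      using finite_Par_size_eq[of N] True by (simp add: sum.delta)
    also have "\<dots> = t kap" using Suc.prems[of kap] that by auto
    finally show ?thesis by (simp add: t'_def)
  qed (simp add: t'_def)
  from Suc.IH[of t', OF this] obtain g1 where g1: "g1 \<in> Lam" "\<And>kap. kap \<in> Par \<Longrightarrow> hall (F kap) g1 = t' kap" by auto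
  show ?case
    by (rule bexI[of _ "g0 + g1"]) (use g0 g1 in \<open>auto simp: hall_add_right Lam_add t'_def\<close>)
qed

section \<open>The dual columns\<close>

text \<open>The coefficient of \<open>w\<^sup>p\<close> in the column vector \<open>w\<^bsup>m-j\<^esup> (1 - \<beta>/w)\<^bsup>m-1\<^esup>\<close> for \<open>m = \<mu>\<^sub>j > 0\<close>,
  and in \<open>w\<^bsup>-j\<^esup>\<close> for \<open>\<mu>\<^sub>j = 0\<close>; rows and columns are indexed from 0.\<close>

definition Vcol :: "nat list \<Rightarrow> nat \<Rightarrow> int \<Rightarrow> K" where
  "Vcol mu j p = (if part mu (Suc j) = 0 then (if p = - int (Suc j) then 1 else 0)
     else Pc (1 - int (part mu (Suc j))) (int (part mu (Suc j)) - int (Suc j) - p))"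

text \<open>The pairing of \<^term>\<open>Lrow lam i\<close> with \<^term>\<open>Vcol mu j\<close> shifted by \<open>k\<close>, see \<open>Vcol_Lrow\<close>.\<close>

definition skew_entry :: "nat list \<Rightarrow> nat list \<Rightarrow> nat \<Rightarrow> nat \<Rightarrow> int \<Rightarrow> K" where
  "skew_entry lam mu i j k = (if part mu (Suc j) = 0 then Lrow lam i (k - int (Suc j))
     else Pc (int (part lam (Suc i)) - int (part mu (Suc j)) + 1)
       (k + int i - int j - int (part lam (Suc i)) + int (part mu (Suc j))))"

lemma Vcol_above: "int (part mu (Suc j)) - int (Suc j) < p \<Longrightarrow> Vcol mu j p = 0"
  by (auto simp: Vcol_def Pc_neg)

text \<open>Writing \<open>1/Y\<close> for \<open>w\<close> in the column, the sum is the
  coefficient of \<open>Y^k\<close> in column times row. Both are monomials times powers of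
  \<open>1 - \<beta> Y\<close>, with exponents \<open>m - 1\<close> and \<open>-l\<close> for a
  positive part \<open>m\<close>.\<close>

lemma Vcol_Lrow:
  assumes "j < r" "part mu (Suc j) \<le> N"
  shows "(\<Sum>p\<in>{- int r..int N}. Vcol mu j p * Lrow lam i (p + k)) = skew_entry lam mu i j k"
proof (cases "part mu (Suc j) = 0")
  case True
  have "(\<Sum>p\<in>{- int r..int N}. Vcol mu j p * Lrow lam i (p + k)) = Lrow lam i (- int (Suc j) + k)"
    by (rule sum_eq_single[where a = "- int (Suc j)"]) (use assms True in \<open>auto simp: Vcol_def\<close>)
  also have "- int (Suc j) + k = k - int (Suc j)" by simp
  finally show ?thesis using True by (simp only: skew_entry_def simp_thms if_True)
next
  case False
  define m l where "m = int (part mu (Suc j))" and "l = int (part lam (Suc i))"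
  define C where "C = k + int i - int j - l + m"
  have m: "0 < m" "m \<le> int N" using False assms by (auto simp: m_def)
  have "(\<Sum>p\<in>{- int r..int N}. Vcol mu j p * Lrow lam i (p + k))
    = (\<Sum>c\<in>{m - int (Suc j) - int N..m - int (Suc j) + int r}. Pc (1 - m) c * Pc l (C - c))"
    by (rule sum.reindex_bij_witness[where i = "\<lambda>c. m - int (Suc j) - c" and j = "\<lambda>p. m - int (Suc j) - p"])
       (use False in \<open>auto simp: Vcol_def Lrow_def m_def l_def C_def algebra_simps\<close>)
  also have "\<dots> = Pc (1 - m + l) C"
  proof (rule Pc_Vandermonde)
    \<comment> \<open>A positive part gives a column with finitely many powers of \<open>w\<close>,
      and the interval \<open>- r..N\<close> contains all of them.\<close>
    fix c assume c: "0 \<le> c" "Pc (1 - m) c \<noteq> 0"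
    then have "c \<le> m - 1" using Pc_zero[of "1 - m" c] m by force
    then show "c \<in> {m - int (Suc j) - int N..m - int (Suc j) + int r}" using c m assms by auto
  qed simp
  finally show ?thesis using False by (simp add: skew_entry_def m_def l_def C_def algebra_simps)
qed

text \<open>For equal partitions the matrix is lower unitriangular. Otherwise an index
  \<open>k\<close> where the parts differ gives a zero block: if
  \<open>\<lambda>_k > \<mu>_k\<close>, the entries with \<open>i \<le> k \<le> j\<close> ask for a
  negative coefficient; if \<open>\<lambda>_k < \<mu>_k\<close>, those with
  \<open>j \<le> k \<le> i\<close> ask for a coefficient beyond the degree of a polynomial.\<close>

lemma skew_entry_orthogonal:
  assumes "lam \<in> Par" "mu \<in> Par" "length lam \<le> r" "length mu \<le> r"
  shows "detf r (\<lambda>i j. skew_entry lam mu i j 0) = (if lam = mu then 1 else 0)"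
proof (cases "lam = mu")
  case True
  have "detf r (\<lambda>i j. skew_entry lam mu i j 0) = (\<Prod>i<r. skew_entry lam mu i i 0)"
  proof (rule detf_lower_triangular)
    fix i j assume "i < j" "j < r"
    then show "skew_entry lam mu i j 0 = 0"
      using Par_part_decreasing[OF assms(1), of "Suc i" "Suc j"] True
      by (auto simp: skew_entry_def Lrow_def intro!: Pc_neg)
  qed
  also have "\<dots> = 1"
  proof (rule prod.neutral, rule ballI)
    fix i
    show "skew_entry lam mu i i 0 = 1"
      using True by (cases "part mu (Suc i) = 0") (simp_all add: skew_entry_def Lrow_def)
  qed
  finally show ?thesis using True by simp
next
  case False
  then obtain k where k: "part lam (Suc k) \<noteq> part mu (Suc k)"
    using Par_eqI[OF assms(1,2)] by blast
  then have "k < r" using assms(3,4) by (auto simp: part_def split: if_splits)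
  consider "part mu (Suc k) < part lam (Suc k)" | "part lam (Suc k) < part mu (Suc k)"
    using k by linarith
  then have "detf r (\<lambda>i j. skew_entry lam mu i j 0) = 0"
  proof cases
    case 1
    show ?thesis
    proof (rule detf_zero_block[OF \<open>k < r\<close>])
      fix i j assume "i \<le> k" "k \<le> j"
      then show "skew_entry lam mu i j 0 = 0"
        using Par_part_decreasing[OF assms(1), of "Suc i" "Suc k"] Par_part_decreasing[OF assms(2), of "Suc k" "Suc j"] 1
        by (auto simp: skew_entry_def Lrow_def intro!: Pc_neg)
    qed
  next
    case 2
    have "detf r (\<lambda>i j. skew_entry lam mu j i 0) = 0"
    proof (rule detf_zero_block[OF \<open>k < r\<close>])
      fix j i assume "j \<le> k" "k \<le> i"
      then show "skew_entry lam mu i j 0 = 0"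
        using Par_part_decreasing[OF assms(2), of "Suc j" "Suc k"] Par_part_decreasing[OF assms(1), of "Suc k" "Suc i"] 2
        by (auto simp: skew_entry_def intro!: Pc_zero)
    qed
    then show ?thesis by (subst detf_transpose[symmetric])
  qed
  then show ?thesis using False by simp
qed

text \<open>The minor of the columns \<open>V\<close> in the rows that belong to \<open>kap\<close>.
  It is the value prescribed for the pairing with the Schur function of \<open>kap\<close> in the
  variables \<open>Y\<close>.\<close>

definition dual_target :: "nat list \<Rightarrow> nat \<Rightarrow> nat list \<Rightarrow> K" where
  "dual_target mu r kap = detf r (\<lambda>i j. Vcol mu j (int (part kap (Suc i)) - int (Suc i)))"

lemma dual_target_stable:
  assumes "max (length mu) (length kap) \<le> r"
  shows "dual_target mu r kap = dual_target mu (max (length mu) (length kap)) kap"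
  using assms
proof (induction r rule: dec_induct)
  case (step r)
  then have 0: "part mu (Suc r) = 0" "part kap (Suc r) = 0" by (auto simp: part_def)
  have "dual_target mu (Suc r) kap = dual_target mu r kap"
    unfolding dual_target_def
    by (rule detf_last_row) (use 0 in \<open>auto simp: Vcol_def intro!: Pc_zero\<close>)
  with step show ?case by simp
qed simp

text \<open>A partition of larger size has a larger part at some index \<open>k\<close>; the entries
  with \<open>i \<le> k \<le> j\<close> then lie above the top power of their column. This provides
  the vanishing that \<open>dual_exists\<close> asks for.\<close>

lemma dual_target_zero:
  assumes "mu \<in> Par" "kap \<in> Par" "sum_list mu < sum_list kap" "length mu \<le> r" "length kap \<le> r"
  shows "dual_target mu r kap = 0"
proof -
  have "\<exists>k<r. part mu (Suc k) < part kap (Suc k)"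
  proof (rule ccontr)
    assume "\<not> ?thesis"
    then have "part kap (Suc k) \<le> part mu (Suc k)" if "k < r" for k
      using that by (meson not_less)
    then have "(\<Sum>k<r. part kap (Suc k)) \<le> (\<Sum>k<r. part mu (Suc k))"
      by (intro sum_mono) simp
    then show False using assms by (simp add: sum_part)
  qed
  then obtain k where k: "k < r" "part mu (Suc k) < part kap (Suc k)" by blast
  show ?thesis
    unfolding dual_target_def
  proof (rule detf_zero_block[OF k(1)])
    fix i j assume "i \<le> k" "k \<le> j"
    then show "Vcol mu j (int (part kap (Suc i)) - int (Suc i)) = 0"
      using Par_part_decreasing[OF assms(2), of "Suc i" "Suc k"] Par_part_decreasing[OF assms(1), of "Suc k" "Suc j"] k
      by (intro Vcol_above) auto
  qed
qed

text \<open>Both sides are alternating in \<open>f\<close>, so it suffices to treat decreasing \<open>f\<close>, which come from partitions.\<close>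

lemma hall_detf_eta:
  assumes g: "g \<in> Lam" "\<And>kap. kap \<in> Par \<Longrightarrow>
      hall (JT beta (schur_row kap) (length kap)) g = dual_target mu (max (length mu) (length kap)) kap"
    and "length mu \<le> r" "\<And>i. i < r \<Longrightarrow> - int r \<le> f i"
    and T: "\<And>F. mps_symmetric F \<Longrightarrow> hall F g = (\<Sum>\<gamma>\<in>S. p \<gamma> * mps_coeff F \<gamma>)"
  shows "(\<Sum>\<gamma>\<in>S. p \<gamma> * mps_coeff (detf r (\<lambda>i j. eta beta (f i + int (Suc j)))) \<gamma>) = detf r (\<lambda>i j. Vcol mu j (f i))"
proof (cases "inj_on f {..<r}")
  case False
  then obtain i k where ik: "i < r" "k < r" "i \<noteq> k" "f i = f k" by (auto simp: inj_on_def)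
  have "detf r (\<lambda>i j. eta beta (f i + int (Suc j))) = 0" "detf r (\<lambda>i j. Vcol mu j (f i)) = 0"
    by (rule detf_identical_rows[OF ik(1-3)]; simp add: ik(4))+
  then show ?thesis by simp
next
  case True
  from sorting_permutation[OF True] obtain \<pi> where \<pi>: "\<pi> permutes {..<r}"
    "\<And>i j. i < j \<Longrightarrow> j < r \<Longrightarrow> f (\<pi> j) < f (\<pi> i)" by blast
  have "- int r \<le> f (\<pi> i)" if "i < r" for i
    using assms(4) permutes_in_image[OF \<pi>(1), of i] that by simp
  from Par_exists_shifted[of r "\<lambda>i. f (\<pi> i)", OF \<pi>(2) this] obtain kap where
    kap: "kap \<in> Par" "length kap \<le> r" "\<And>i. i < r \<Longrightarrow> f (\<pi> i) = int (part kap (Suc i)) - int (Suc i)" by blast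
  let ?E = "detf r (\<lambda>i j. eta beta (f i + int (Suc j)))" and ?V = "detf r (\<lambda>i j. Vcol mu j (f i))"
  have "of_int (sign \<pi>) * ?E = detf r (\<lambda>i j. eta beta (f (\<pi> i) + int (Suc j)))"
    using detf_permute_rows[OF \<pi>(1), of "\<lambda>i j. eta beta (f i + int (Suc j))"] by simp
  also have "\<dots> = JT beta (schur_row kap) r"
    unfolding JT_schur_eta by (rule detf_cong) (simp add: kap(3))
  also have "\<dots> = JT beta (schur_row kap) (length kap)"
    by (rule JT_stable) (use kap schur_row_tail in auto)
  finally have E: "of_int (sign \<pi>) * ?E = JT beta (schur_row kap) (length kap)" .
  have "of_int (sign \<pi>) * ?V = detf r (\<lambda>i j. Vcol mu j (f (\<pi> i)))"
    using detf_permute_rows[OF \<pi>(1), of "\<lambda>i j. Vcol mu j (f i)"] by simp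
  also have "\<dots> = dual_target mu r kap"
    unfolding dual_target_def by (rule detf_cong) (simp add: kap(3))
  also have "\<dots> = hall (JT beta (schur_row kap) (length kap)) g"
    using g(2)[OF kap(1)] dual_target_stable[of mu kap r] kap(2) assms(3) by simp
  also have "\<dots> = (\<Sum>\<gamma>\<in>S. p \<gamma> * mps_coeff (of_int (sign \<pi>) * ?E) \<gamma>)"
    unfolding E by (rule T) (rule mps_symmetric_JT)
  also have "\<dots> = of_int (sign \<pi>) * (\<Sum>\<gamma>\<in>S. p \<gamma> * mps_coeff ?E \<gamma>)"
    by (simp add: sum_distrib_left mult.left_commute)
  finally have "of_int (sign \<pi>) * ?V = of_int (sign \<pi>) * (\<Sum>\<gamma>\<in>S. p \<gamma> * mps_coeff ?E \<gamma>)" .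
  then show ?thesis by (simp add: sign_def split: if_splits)
qed

section \<open>Splitting the alphabet\<close>

text \<open>Two alphabets are interleaved in the single countable one: even indices carry the first,
  odd indices the second.\<close>

definition even_odd :: "nat multiset \<Rightarrow> nat multiset \<Rightarrow> nat multiset" where
  "even_odd A B = image_mset (\<lambda>n. 2 * n) A + image_mset (\<lambda>n. 2 * n + 1) B"

text \<open>The series \<open>f(x, y)\<close> as a series in \<open>x\<close> whose coefficients are
  series in \<open>y\<close>.\<close>

definition mps_split :: "K mps \<Rightarrow> K mps mps" where
  "mps_split f = Abs_mps (\<lambda>A. Abs_mps (\<lambda>B. mps_coeff f (even_odd A B)))"

definition mps_lift :: "K mps \<Rightarrow> K mps mps" where
  "mps_lift f = Abs_mps (\<lambda>A. mps_const (mps_coeff f A))"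

lemma mps_coeff_split [simp]: "mps_coeff (mps_coeff (mps_split f) A) B = mps_coeff f (even_odd A B)"
  by (simp add: mps_split_def)

lemma mps_coeff_lift [simp]: "mps_coeff (mps_lift f) A = mps_const (mps_coeff f A)"
  by (simp add: mps_lift_def)

lemma mps_eqI2: "(\<And>A B. mps_coeff (mps_coeff F A) B = mps_coeff (mps_coeff F' A) B) \<Longrightarrow> F = F'"
  by (intro mps_eqI)

lemma count_image_mset_inj: "inj f \<Longrightarrow> count (image_mset f A) (f x) = count A x"
  by (induction A) (auto simp: inj_eq)

lemma count_even_odd:
  "count (even_odd A B) (2 * n) = count A n" "count (even_odd A B) (Suc (2 * n)) = count B n"
proof -
  have inj: "inj (\<lambda>n::nat. 2 * n)" "inj (\<lambda>n::nat. Suc (2 * n))" by (auto simp: inj_def)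
  have "count (image_mset (\<lambda>n. Suc (2 * n)) B) (2 * n) = 0" "count (image_mset (\<lambda>n. 2 * n) A) (Suc (2 * n)) = 0"
    by (auto simp: count_eq_zero_iff) presburger+
  then show "count (even_odd A B) (2 * n) = count A n" "count (even_odd A B) (Suc (2 * n)) = count B n"
    using count_image_mset_inj[OF inj(1), of A n] count_image_mset_inj[OF inj(2), of B n]
    by (simp_all add: even_odd_def)
qed

lemma multiset_eq_even_odd_iff:
  "X = Y \<longleftrightarrow> (\<forall>n. count X (2 * n) = count Y (2 * n) \<and> count X (Suc (2 * n)) = count Y (Suc (2 * n)))"
  unfolding multiset_eq_iff by (metis Suc_eq_plus1 evenE oddE)

lemma subset_even_odd_iff:
  "X \<subseteq># Y \<longleftrightarrow> (\<forall>n. count X (2 * n) \<le> count Y (2 * n) \<and> count X (Suc (2 * n)) \<le> count Y (Suc (2 * n)))"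
  unfolding subseteq_mset_def by (metis Suc_eq_plus1 evenE oddE)

lemma ex_even_odd: "\<exists>A B. X = even_odd A B"
proof (induction X)
  case empty
  have "{#} = even_odd {#} {#}" by (simp add: even_odd_def)
  then show ?case by blast
next
  case (add x X)
  then obtain A B where X: "X = even_odd A B" by blast
  have "add_mset x X = (if even x then even_odd (add_mset (x div 2) A) B else even_odd A (add_mset (x div 2) B))"
    by (auto simp: X even_odd_def)
  then show ?case by (cases "even x") auto
qed

lemma even_odd_eq_iff: "even_odd A B = even_odd A' B' \<longleftrightarrow> A = A' \<and> B = B'"
  unfolding multiset_eq_even_odd_iff[of "even_odd A B"] count_even_odd multiset_eq_iff[of A] multiset_eq_iff[of B] by auto

lemma even_odd_subset_iff: "even_odd A B \<subseteq># even_odd A' B' \<longleftrightarrow> A \<subseteq># A' \<and> B \<subseteq># B'"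
  unfolding subset_even_odd_iff[of "even_odd A B"] count_even_odd subseteq_mset_def[of A] subseteq_mset_def[of B] by auto

lemma even_odd_diff: "even_odd A B - even_odd A' B' = even_odd (A - A') (B - B')"
  unfolding multiset_eq_even_odd_iff by (simp add: count_even_odd)

lemma comm_ring_hom_mps_split: "comm_ring_hom mps_split"
proof
  fix f g
  show "mps_split (f * g) = mps_split f * mps_split g"
  proof (rule mps_eqI2)
    fix A B
    have "mps_coeff (mps_coeff (mps_split (f * g)) A) B
      = (\<Sum>X | X \<subseteq># even_odd A B. mps_coeff f X * mps_coeff g (even_odd A B - X))"
      by (simp add: mps_coeff_mult)
    also have "\<dots> = (\<Sum>(A', B')\<in>{A'. A' \<subseteq># A} \<times> {B'. B' \<subseteq># B}.
        mps_coeff f (even_odd A' B') * mps_coeff g (even_odd (A - A') (B - B')))"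
    proof -
      have "{X. X \<subseteq># even_odd A B} = case_prod even_odd ` ({A'. A' \<subseteq># A} \<times> {B'. B' \<subseteq># B})"
      proof (rule Set.set_eqI, rule iffI)
        fix X assume X: "X \<in> {X. X \<subseteq># even_odd A B}"
        obtain A' B' where eq: "X = even_odd A' B'" using ex_even_odd by blast
        then have "(A', B') \<in> {A'. A' \<subseteq># A} \<times> {B'. B' \<subseteq># B}"
          using X by (simp add: even_odd_subset_iff)
        then show "X \<in> case_prod even_odd ` ({A'. A' \<subseteq># A} \<times> {B'. B' \<subseteq># B})"
          using eq by (metis case_prod_conv image_eqI)
      qed (auto simp: even_odd_subset_iff)
      moreover have inj: "inj_on (case_prod even_odd) ({A'. A' \<subseteq># A} \<times> {B'. B' \<subseteq># B})"
        by (auto simp: inj_on_def even_odd_eq_iff)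
      ultimately show ?thesis
        by (simp only: sum.reindex[OF inj] comp_def) (intro sum.cong refl, auto simp: even_odd_diff)
    qed
    also have "\<dots> = mps_coeff (mps_coeff (mps_split f * mps_split g) A) B"
      by (simp add: mps_coeff_mult sum.cartesian_product)
    finally show "mps_coeff (mps_coeff (mps_split (f * g)) A) B = mps_coeff (mps_coeff (mps_split f * mps_split g) A) B" .
  qed
  have "even_odd A B = {#} \<longleftrightarrow> A = {#} \<and> B = {#}" for A B
    by (auto simp: even_odd_def)
  then show "mps_split 1 = 1"
    by (intro mps_eqI2) auto
qed (rule mps_eqI2, simp)+

interpretation mps_split: comm_ring_hom mps_split
  by (rule comm_ring_hom_mps_split)

lemma comm_ring_hom_mps_lift: "comm_ring_hom mps_lift"
proof
  fix f g
  show "mps_lift (f * g) = mps_lift f * mps_lift g"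
    by (rule mps_eqI) (simp add: mps_coeff_mult mps_const.hom_sum mps_const.hom_mult)
  show "mps_lift 1 = 1" by (rule mps_eqI) auto
qed (rule mps_eqI, simp)+

interpretation mps_lift: comm_ring_hom mps_lift
  by (rule comm_ring_hom_mps_lift)

text \<open>Agreement up to degree \<open>N\<close> in the outer variables. It permits replacing the
  infinite expansion of a split series by a finite sum inside a determinant.\<close>

definition mps_agree :: "nat \<Rightarrow> 'a mps \<Rightarrow> 'a mps \<Rightarrow> bool" where
  "mps_agree N F F' \<longleftrightarrow> (\<forall>A. size A \<le> N \<longrightarrow> mps_coeff F A = mps_coeff F' A)"

lemma mps_agree_mult:
  assumes "mps_agree N F F'" "mps_agree N H H'"
  shows "mps_agree N (F * H) (F' * (H' :: 'a::comm_ring_1 mps))"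
  unfolding mps_agree_def
proof (intro allI impI)
  fix A :: "nat multiset" assume A: "size A \<le> N"
  show "mps_coeff (F * H) A = mps_coeff (F' * H') A"
    unfolding mps_coeff_mult
  proof (rule sum.cong[OF refl])
    fix X assume "X \<in> {X. X \<subseteq># A}"
    then have "size X \<le> N" "size (A - X) \<le> N"
      using A size_mset_mono[of X A] size_mset_mono[of "A - X" A] by auto
    then show "mps_coeff F X * mps_coeff H (A - X) = mps_coeff F' X * mps_coeff H' (A - X)"
      using assms by (simp add: mps_agree_def)
  qed
qed

lemma mps_agree_detf:
  assumes "\<And>i j. i < n \<Longrightarrow> j < n \<Longrightarrow> mps_agree N (e i j) (e' i j :: 'a::comm_ring_1 mps)"
  shows "mps_agree N (detf n e) (detf n e')"
proof -
  have prod: "mps_agree N (\<Prod>i\<in>S. F i) (\<Prod>i\<in>S. F' i :: 'a mps)"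
    if "\<And>i. i \<in> S \<Longrightarrow> mps_agree N (F i) (F' i)" for F F' and S :: "nat set"
    using that
  proof (induction S rule: infinite_finite_induct)
    case (insert x S)
    then show ?case by (simp add: mps_agree_mult)
  qed (auto simp: mps_agree_def)
  have "mps_agree N (of_int (sign \<pi>) * (\<Prod>i<n. e i (\<pi> i))) (of_int (sign \<pi>) * (\<Prod>i<n. e' i (\<pi> i)))"
    if "\<pi> permutes {..<n}" for \<pi>
    using prod[of "{..<n}" "\<lambda>i. e i (\<pi> i)" "\<lambda>i. e' i (\<pi> i)"] assms permutes_in_image[OF that]
    by (simp add: mps_agree_def)
  then show ?thesis
    unfolding detf_leibniz mps_agree_def mps_coeff_sum by (auto intro!: sum.cong)
qed

lemma poly_functional_mult:
  fixes p q :: "'a::comm_ring_1 poly"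
  assumes "degree p \<le> m" "degree q \<le> n"
  shows "(\<Sum>k\<le>m + n. coeff (p * q) k * x k) = (\<Sum>a\<le>m. \<Sum>b\<le>n. coeff p a * coeff q b * x (a + b))"
proof -
  have "(\<Sum>k\<le>m + n. coeff (p * q) k * x k) = (\<Sum>k\<le>m + n. \<Sum>i\<le>k. coeff p i * coeff q (k - i) * x (i + (k - i)))"
    by (simp add: coeff_mult sum_distrib_right)
  also have "\<dots> = (\<Sum>(a, b)\<in>{(a, b). a + b \<le> m + n}. coeff p a * coeff q b * x (a + b))"
    by (rule sum.triangle_reindex_eq[symmetric])
  also have "\<dots> = (\<Sum>(a, b)\<in>{..m} \<times> {..n}. coeff p a * coeff q b * x (a + b))"
  proof (rule sum.mono_neutral_right)
    show "finite {(a, b). a + b \<le> m + n}"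
      by (rule finite_subset[of _ "{..m + n} \<times> {..m + n}"]) auto
    show "\<forall>i\<in>{(a, b). a + b \<le> m + n} - {..m} \<times> {..n}. (case i of (a, b) \<Rightarrow> coeff p a * coeff q b * x (a + b)) = 0"
    proof
      fix i assume i: "i \<in> {(a, b). a + b \<le> m + n} - {..m} \<times> {..n}"
      obtain a b where ab: "i = (a, b)" by (cases i)
      with i have "m < a \<or> n < b" by auto
      then have "coeff p a = 0 \<or> coeff q b = 0" using assms by (auto intro: coeff_eq_0)
      with ab show "(case i of (a, b) \<Rightarrow> coeff p a * coeff q b * x (a + b)) = 0" by auto
    qed
  qed auto
  finally show ?thesis by (simp add: sum.cartesian_product)
qed

lemma mps_coeff_mult_const [simp]: "mps_coeff (f * mps_const c) M = c * mps_coeff f M"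
  by (subst mult.commute) simp

text \<open>The generating series of the joint alphabet is the product of the two generating series.
  Expanding the outer one, \<open>p + j + 1\<close> is the power of \<open>w\<close> taken from it;
  nonnegativity gives \<open>p \<ge> - r\<close>, and \<open>eta b m\<close> has no terms of degree
  below \<open>m\<close>, which gives \<open>p \<le> N\<close>.\<close>

lemma mps_split_HL:
  assumes "j < r"
  shows "mps_agree N (mps_split (HL b (\<lambda>k. c (k - int (Suc j)))))
    (\<Sum>p\<in>{- int r..int N}. mps_const (HL b (\<lambda>k. c (p + k))) * mps_lift (eta b (p + int (Suc j))))"
  unfolding mps_agree_def
proof (intro allI impI, rule mps_eqI)
  fix A B :: "nat multiset" assume A: "size A \<le> N"
  let ?v = "\<lambda>p. mps_coeff (HL b (\<lambda>k. c (p + k))) B"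
  have inj: "inj (\<lambda>n::nat. 2 * n)" "inj (\<lambda>n::nat. 2 * n + 1)" by (auto simp: inj_def)
  have "set_mset (image_mset (\<lambda>n. 2 * n) A) \<inter> set_mset (image_mset (\<lambda>n. 2 * n + 1) B) = {}"
    by auto presburger
  from wpoly_union[OF this, of b] have w: "wpoly b (even_odd A B) = wpoly b A * wpoly b B"
    by (simp only: even_odd_def wpoly_image[OF inj(1)] wpoly_image[OF inj(2)])
  have "mps_coeff (mps_coeff (mps_split (HL b (\<lambda>k. c (k - int (Suc j))))) A) B
    = (\<Sum>k\<le>size A + size B. coeff (wpoly b A * wpoly b B) k * c (int k - int (Suc j)))"
    unfolding mps_coeff_split mps_coeff_HL w by (simp add: even_odd_def)
  also have "\<dots> = (\<Sum>a\<le>size A. \<Sum>k\<le>size B. coeff (wpoly b A) a * coeff (wpoly b B) k * c (int (a + k) - int (Suc j)))"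
    by (rule poly_functional_mult) (simp_all add: degree_wpoly)
  also have "\<dots> = (\<Sum>a\<le>size A. coeff (wpoly b A) a * ?v (int a - int (Suc j)))"
    by (simp add: mps_coeff_HL sum_distrib_left mult.assoc algebra_simps)
  also have "\<dots> = (\<Sum>p\<in>{- int (Suc j)..int (size A) - int (Suc j)}. mps_coeff (eta b (p + int (Suc j))) A * ?v p)"
    by (rule sum.reindex_bij_witness[where i = "\<lambda>p. nat (p + int (Suc j))" and j = "\<lambda>a. int a - int (Suc j)"])
       (auto simp: mps_coeff_eta)
  also have "\<dots> = (\<Sum>p\<in>{- int r..int N}. mps_coeff (eta b (p + int (Suc j))) A * ?v p)"
  proof (rule sum.mono_neutral_left)
    show "{- int (Suc j)..int (size A) - int (Suc j)} \<subseteq> {- int r..int N}" using assms A by auto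
    show "\<forall>p\<in>{- int r..int N} - {- int (Suc j)..int (size A) - int (Suc j)}.
        mps_coeff (eta b (p + int (Suc j))) A * ?v p = 0"
    proof
      fix p assume "p \<in> {- int r..int N} - {- int (Suc j)..int (size A) - int (Suc j)}"
      then consider "p + int (Suc j) < 0" | "size A < nat (p + int (Suc j))" by fastforce
      then have "mps_coeff (eta b (p + int (Suc j))) A = 0"
        by cases (auto simp: mps_coeff_eta coeff_eq_0 degree_wpoly)
      then show "mps_coeff (eta b (p + int (Suc j))) A * ?v p = 0" by simp
    qed
  qed simp
  finally show "mps_coeff (mps_coeff (mps_split (HL b (\<lambda>k. c (k - int (Suc j))))) A) B
    = mps_coeff (mps_coeff (\<Sum>p\<in>{- int r..int N}. mps_const (HL b (\<lambda>k. c (p + k))) * mps_lift (eta b (p + int (Suc j)))) A) B"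
    by (simp only: mps_coeff_sum mps_coeff_const_mult mps_coeff_lift mps_coeff_mult_const)
qed

text \<open>The Cauchy--Binet step: \<open>g\<close> is paired with the half of the alphabet formed by the even variables.\<close>

lemma split_pairing:
  assumes g: "g \<in> Lam" "\<And>kap. kap \<in> Par \<Longrightarrow>
      hall (JT beta (schur_row kap) (length kap)) g = dual_target mu (max (length mu) (length kap)) kap"
    and r: "length mu \<le> r" and S: "finite S"
    and T: "\<And>F. mps_symmetric F \<Longrightarrow> hall F g = (\<Sum>\<gamma>\<in>S. p \<gamma> * mps_coeff F \<gamma>)"
  shows "(\<Sum>\<gamma>\<in>S. mps_const (p \<gamma>) * mps_coeff (mps_split (JT beta (Lrow lam) r)) \<gamma>)
    = detf r (\<lambda>i j. HL beta (skew_entry lam mu i j))"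
proof -
  \<comment> \<open>The first summand bounds the degrees of the monomials in \<open>S\<close>, for
    the truncated splitting; the second bounds the parts of \<open>mu\<close>, for
    \<open>Vcol_Lrow\<close>.\<close>
  define N where "N = Max (insert 0 (size ` S)) + sum_list mu"
  let ?P = "{- int r..int N}"
  let ?Fs = "{..<r} \<rightarrow>\<^sub>E ?P"
  define v where "v i p = HL beta (\<lambda>k. Lrow lam i (p + k))" for i p
  have N: "size \<gamma> \<le> N" if "\<gamma> \<in> S" for \<gamma>
  proof -
    have "size \<gamma> \<le> Max (insert 0 (size ` S))" using S that by (intro Max_ge) auto
    then show ?thesis by (simp add: N_def)
  qed
  have mu: "part mu (Suc j) \<le> N" for j
    by (auto simp: N_def part_def intro!: trans_le_add2 member_le_sum_list)
  have coeff: "mps_coeff (mps_split (JT beta (Lrow lam) r)) \<gamma>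
    = (\<Sum>f\<in>?Fs. (\<Prod>i<r. v i (f i)) * mps_const (mps_coeff (detf r (\<lambda>i j. eta beta (f i + int (Suc j)))) \<gamma>))"
    if "\<gamma> \<in> S" for \<gamma>
  proof -
    have "mps_agree N (mps_split (JT beta (Lrow lam) r))
      (detf r (\<lambda>i j. \<Sum>p\<in>?P. mps_const (v i p) * mps_lift (eta beta (p + int (Suc j)))))"
      unfolding JT_def mps_split.hom_detf v_def by (rule mps_agree_detf) (rule mps_split_HL)
    then have "mps_coeff (mps_split (JT beta (Lrow lam) r)) \<gamma>
      = mps_coeff (detf r (\<lambda>i j. \<Sum>p\<in>?P. mps_const (v i p) * mps_lift (eta beta (p + int (Suc j))))) \<gamma>"
      using N[OF that] by (simp add: mps_agree_def)
    also have "\<dots> = mps_coeff (\<Sum>f\<in>?Fs. mps_const (\<Prod>i<r. v i (f i)) * mps_lift (detf r (\<lambda>i j. eta beta (f i + int (Suc j))))) \<gamma>"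
      by (subst detf_row_sum) (simp_all only: finite_atLeastAtMost_int mps_const.hom_prod mps_lift.hom_detf)
    finally show ?thesis by simp
  qed
  have "(\<Sum>\<gamma>\<in>S. mps_const (p \<gamma>) * mps_coeff (mps_split (JT beta (Lrow lam) r)) \<gamma>)
    = (\<Sum>\<gamma>\<in>S. \<Sum>f\<in>?Fs. (\<Prod>i<r. v i (f i)) *
        (mps_const (p \<gamma>) * mps_const (mps_coeff (detf r (\<lambda>i j. eta beta (f i + int (Suc j)))) \<gamma>)))"
    by (intro sum.cong refl) (simp only: coeff sum_distrib_left mult.left_commute)
  also have "\<dots> = (\<Sum>f\<in>?Fs. (\<Prod>i<r. v i (f i)) *
      mps_const (\<Sum>\<gamma>\<in>S. p \<gamma> * mps_coeff (detf r (\<lambda>i j. eta beta (f i + int (Suc j)))) \<gamma>))"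
    by (subst sum.swap) (simp only: sum_distrib_left mps_const.hom_sum mps_const.hom_mult)
  also have "\<dots> = (\<Sum>f\<in>?Fs. (\<Prod>i<r. v i (f i)) * detf r (\<lambda>i j. mps_const (Vcol mu j (f i))))"
  proof (intro sum.cong refl arg_cong2[of _ _ _ _ "(*)"])
    fix f assume "f \<in> ?Fs"
    then have "- int r \<le> f i" if "i < r" for i using that by (auto simp: PiE_iff)
    from hall_detf_eta[OF g r this T]
    show "mps_const (\<Sum>\<gamma>\<in>S. p \<gamma> * mps_coeff (detf r (\<lambda>i j. eta beta (f i + int (Suc j)))) \<gamma>)
      = detf r (\<lambda>i j. mps_const (Vcol mu j (f i)))"
      by (simp only: mps_const.hom_detf)
  qed
  also have "\<dots> = detf r (\<lambda>i j. \<Sum>p\<in>?P. v i p * mps_const (Vcol mu j p))"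
    by (rule detf_row_sum[symmetric]) simp
  also have "\<dots> = detf r (\<lambda>i j. HL beta (skew_entry lam mu i j))"
  proof (rule detf_cong)
    fix i j assume "j < r"
    have "(\<Sum>p\<in>?P. v i p * mps_const (Vcol mu j p)) = HL beta (\<lambda>k. \<Sum>p\<in>?P. Vcol mu j p * Lrow lam i (p + k))"
      by (simp only: v_def HL_sum HL_scale mult.commute)
    then show "(\<Sum>p\<in>?P. v i p * mps_const (Vcol mu j p)) = HL beta (skew_entry lam mu i j)"
      by (simp only: Vcol_Lrow[OF \<open>j < r\<close> mu])
  qed
  finally show ?thesis .
qed

section \<open>The determinant formula\<close>

text \<open>The index alphabets are moved apart before the product is taken. Multiplying products of
  complete homogeneous functions thus corresponds to joining monomials of two alphabets, which is
  dual to splitting.\<close>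

lemma hprod_mult: "hprod \<alpha> * hprod \<gamma> = hprod (even_odd \<alpha> \<gamma>)"
proof -
  have inj: "inj (\<lambda>n::nat. 2 * n)" "inj (\<lambda>n::nat. 2 * n + 1)" by (auto simp: inj_def)
  have "set_mset (image_mset (\<lambda>n. 2 * n) \<alpha>) \<inter> set_mset (image_mset (\<lambda>n. 2 * n + 1) \<gamma>) = {}"
    by auto presburger
  from hprod_union[OF this] show ?thesis
    by (simp only: even_odd_def hprod_image[OF inj(1)] hprod_image[OF inj(2)])
qed

lemma Lam_mult: "f \<in> Lam \<Longrightarrow> g \<in> Lam \<Longrightarrow> f * g \<in> Lam"
  using mps_bounded_mult[of f g] unfolding Lam_iff mps_bounded_def[symmetric]
  by (auto intro: mps_symmetric_intros)

lemma mps_symmetric_G: "mps_symmetric (G lam)"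
  using G_eq_JT[of lam "length lam"] mps_symmetric_JT by simp

text \<open>The element \<open>g\<close> is fixed by its pairings with the Schur functions in
  \<open>Y\<close>, not with the \<open>G\<close>. It comes with an expansion in the
  \<open>hprod\<close>, so that pairing the first alphabet with \<open>g\<close> is a finite
  combination of coefficients. The identity covers all \<open>lam\<close>, as the check of duality
  uses every \<open>G\<close>.\<close>

lemma dual_functional_exists:
  assumes "mu \<in> Par"
  obtains g S p where "g \<in> Lam" "finite S" "g = (\<Sum>\<gamma>\<in>S. mps_const (p \<gamma>) * hprod \<gamma>)"
    "\<And>lam r. length lam \<le> r \<Longrightarrow> length mu \<le> r \<Longrightarrow>
      (\<Sum>\<gamma>\<in>S. mps_const (p \<gamma>) * mps_coeff (mps_split (G lam)) \<gamma>) = detf r (\<lambda>i j. HL beta (skew_entry lam mu i j))"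
proof -
  have tri: "schur_triangular (\<lambda>kap. JT beta (schur_row kap) (length kap))"
    by (rule schur_triangular_JT) (auto simp: schur_row_def)
  define t where "t kap = (if kap \<in> Par then dual_target mu (max (length mu) (length kap)) kap else 0)" for kap
  have "t kap = 0" if "Suc (sum_list mu) \<le> sum_list kap" for kap
    using dual_target_zero[OF assms, of kap] that by (auto simp: t_def)
  from dual_exists[of _ "Suc (sum_list mu)" t, OF tri this] obtain g where g: "g \<in> Lam"
    "\<And>kap. kap \<in> Par \<Longrightarrow> hall (JT beta (schur_row kap) (length kap)) g = dual_target mu (max (length mu) (length kap)) kap"
    by (auto simp: t_def)
  obtain S p where S: "finite S" "g = (\<Sum>\<gamma>\<in>S. mps_const (p \<gamma>) * hprod \<gamma>)"
    using hspan_Lam[OF g(1)] by (auto simp: hspan_def)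
  have T: "hall F g = (\<Sum>\<gamma>\<in>S. p \<gamma> * mps_coeff F \<gamma>)" if "mps_symmetric F" for F
    unfolding S(2) using that by (simp add: hall_sum_right hprod_Lam hall_hprod del: mps_coeff_hprod)
  show thesis
  proof (rule that[OF g(1) S])
    fix lam :: "nat list" and r assume "length lam \<le> r" "length mu \<le> r"
    then show "(\<Sum>\<gamma>\<in>S. mps_const (p \<gamma>) * mps_coeff (mps_split (G lam)) \<gamma>) = detf r (\<lambda>i j. HL beta (skew_entry lam mu i j))"
      unfolding G_eq_JT[OF \<open>length lam \<le> r\<close>] using split_pairing[OF g _ S(1) T] by blast
  qed
qed

text \<open>The determinant is \<open>G_\<lambda>(x, y)\<close> with its \<open>x\<close> half
  paired with \<open>g\<close>. Its constant term is the pairing of \<open>G_\<lambda>\<close> with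
  \<open>g\<close>, which biorthogonality shows to be that of the dual element; its other
  coefficients are the pairings with \<open>g * hprod \<alpha>\<close>, which characterise the
  skewing operator.\<close>

lemma skew_G_eq:
  assumes "lam \<in> Par" "mu \<in> Par" "length lam \<le> r" "length mu \<le> r"
  shows "skew_G lam mu = detf r (\<lambda>i j. HL beta (skew_entry lam mu i j))"
proof -
  obtain g S p where g: "g \<in> Lam" and S: "finite S" "g = (\<Sum>\<gamma>\<in>S. mps_const (p \<gamma>) * hprod \<gamma>)"
    and main: "\<And>lam r. length lam \<le> r \<Longrightarrow> length mu \<le> r \<Longrightarrow>
      (\<Sum>\<gamma>\<in>S. mps_const (p \<gamma>) * mps_coeff (mps_split (G lam)) \<gamma>) = detf r (\<lambda>i j. HL beta (skew_entry lam mu i j))"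
    by (rule dual_functional_exists[OF assms(2)]) blast
  let ?U = "\<lambda>lam r. detf r (\<lambda>i j. HL beta (skew_entry lam mu i j))"
  have U_coeff: "mps_coeff (?U lam r) \<alpha> = (\<Sum>\<gamma>\<in>S. p \<gamma> * mps_coeff (G lam) (even_odd \<gamma> \<alpha>))"
    if "length lam \<le> r" "length mu \<le> r" for lam r \<alpha>
    unfolding main[OF that, symmetric] by simp
  have g_mult: "g * hprod \<alpha> = (\<Sum>\<gamma>\<in>S. mps_const (p \<gamma>) * hprod (even_odd \<gamma> \<alpha>))" for \<alpha>
    unfolding S(2) sum_distrib_right by (simp only: mult.assoc hprod_mult)
  have pairing: "hall (G lam) (g * hprod \<alpha>) = mps_coeff (?U lam r) \<alpha>"
    if "length lam \<le> r" "length mu \<le> r" for lam r \<alpha>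
    unfolding g_mult U_coeff[OF that]
    by (simp add: hall_sum_right hprod_Lam hall_hprod mps_symmetric_G del: mps_coeff_hprod)
  have dual: "hall (G nu) g = (if nu = mu then 1 else 0)" if "nu \<in> Par" for nu
  proof -
    let ?r = "max (length nu) (length mu)"
    \<comment> \<open>Taking the constant term is a ring homomorphism, so it passes into the entries
      of the determinant.\<close>
    interpret comm_ring_hom "\<lambda>f :: K mps. mps_coeff f {#}"
      by unfold_locales (simp_all add: mps_coeff_mult)
    have "hall (G nu) g = mps_coeff (?U nu ?r) {#}"
      using pairing[of nu ?r "{#}"] by simp
    also have "\<dots> = detf ?r (\<lambda>i j. skew_entry nu mu i j 0)"
      unfolding hom_detf mps_coeff_HL_empty ..
    also have "\<dots> = (if nu = mu then 1 else 0)"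
      by (rule skew_entry_orthogonal) (use that assms in auto)
    finally show ?thesis .
  qed
  have tri: "schur_triangular G"
  proof -
    have "schur_triangular (\<lambda>lam. JT beta (Lrow lam) (length lam))"
      by (rule schur_triangular_JT) (auto simp: Lrow_def Pc_neg)
    moreover have "G = (\<lambda>lam. JT beta (Lrow lam) (length lam))"
      using G_eq_JT by blast
    ultimately show ?thesis by simp
  qed
  have "dual_g mu = g"
    unfolding dual_g_def
  proof (rule the_equality)
    show "g \<in> Lam \<and> (\<forall>lam\<in>Par. hall (G lam) g = (if lam = mu then 1 else 0))"
      using g dual by blast
    fix g' assume g': "g' \<in> Lam \<and> (\<forall>lam\<in>Par. hall (G lam) g' = (if lam = mu then 1 else 0))"
    have "g' + mps_const (- 1) * g = 0"
    proof (rule dual_unique[OF tri])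
      show "g' + mps_const (- 1) * g \<in> Lam" using g g' by (intro Lam_add Lam_const_mult) auto
      fix nu assume "nu \<in> Par"
      then show "hall (G nu) (g' + mps_const (- 1) * g) = 0"
        using g g' dual by (subst hall_add_right) (auto simp: Lam_const_mult hall_const_right)
    qed
    then show "g' = g" by (simp add: mps_const.hom_uminus)
  qed
  then have "skew_G lam mu = perp g (G lam)" by (simp add: skew_G_def)
  also have "\<dots> = ?U lam r"
    unfolding perp_def
  proof (rule the_equality)
    have sym: "mps_symmetric (?U lam r)"
      by (intro mps_symmetric_detf mps_symmetric_HL)
    have hat: "?U lam r \<in> Lam_hat"
    proof (rule Lam_hatI[OF sym])
      fix n
      obtain m where m: "\<forall>\<gamma>\<in>S. set_mset \<gamma> \<subseteq> {..<m}"
      proof -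
        have "finite (\<Union>\<gamma>\<in>S. set_mset \<gamma>)" using S(1) by simp
        then obtain m where "(\<Union>\<gamma>\<in>S. set_mset \<gamma>) \<subseteq> {..<m}" by (meson finite_nat_iff_bounded)
        then show ?thesis by (intro that[of m]) blast
      qed
      \<comment> \<open>Enough variables to contain both the even indices coming from monomials in
        \<open>S\<close> and the odd ones coming from the first \<open>n\<close> variables; the
        degree bound for \<open>G lam\<close> there is passed on to the determinant.\<close>
      let ?n = "2 * m + 2 * n"
      obtain d where d: "\<And>M. mps_coeff (mps_restrict ?n (G lam)) M \<noteq> 0 \<Longrightarrow> size M \<le> d"
        using mps_bounded_JT_Lrow[of ?n lam] G_eq_JT[of lam "length lam"] unfolding mps_bounded_def by auto
      have "size \<alpha> \<le> d" if \<alpha>: "set_mset \<alpha> \<subseteq> {..<n}" "mps_coeff (?U lam r) \<alpha> \<noteq> 0" for \<alpha>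
      proof -
        obtain \<gamma> where \<gamma>: "\<gamma> \<in> S" "mps_coeff (G lam) (even_odd \<gamma> \<alpha>) \<noteq> 0"
        proof -
          have "\<exists>\<gamma>\<in>S. p \<gamma> * mps_coeff (G lam) (even_odd \<gamma> \<alpha>) \<noteq> 0"
          proof (rule ccontr)
            assume "\<not> ?thesis"
            then have "(\<Sum>\<gamma>\<in>S. p \<gamma> * mps_coeff (G lam) (even_odd \<gamma> \<alpha>)) = 0" by (intro sum.neutral) blast
            with \<alpha>(2) show False unfolding U_coeff[OF assms(3,4)] by contradiction
          qed
          then show ?thesis using that by (metis mult_zero_right)
        qed
        have "set_mset (even_odd \<gamma> \<alpha>) = (\<lambda>n. 2 * n) ` set_mset \<gamma> \<union> (\<lambda>n. 2 * n + 1) ` set_mset \<alpha>"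
          by (simp add: even_odd_def)
        moreover have "(\<lambda>n. 2 * n) ` set_mset \<gamma> \<subseteq> {..<?n}"
        proof -
          have "set_mset \<gamma> \<subseteq> {..<m}" using m \<gamma>(1) by blast
          then show ?thesis by (auto dest!: subsetD)
        qed
        moreover have "(\<lambda>n. 2 * n + 1) ` set_mset \<alpha> \<subseteq> {..<?n}"
          using \<alpha>(1) by (auto dest!: subsetD)
        ultimately have "set_mset (even_odd \<gamma> \<alpha>) \<subseteq> {..<?n}" by simp
        then have "size (even_odd \<gamma> \<alpha>) \<le> d" using \<gamma>(2) by (intro d) simp
        then show ?thesis by (simp add: even_odd_def)
      qed
      then show "\<exists>d. \<forall>M. set_mset M \<subseteq> {..<n} \<longrightarrow> mps_coeff (?U lam r) M \<noteq> 0 \<longrightarrow> size M \<le> d" by blast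
    qed
    have eq: "hall (?U lam r) h = hall (G lam) (g * h)" if h_Lam: "h \<in> Lam" for h
    proof -
      obtain S' p' where h: "finite S'" "h = (\<Sum>\<alpha>\<in>S'. mps_const (p' \<alpha>) * hprod \<alpha>)"
        using hspan_Lam[OF h_Lam] by (auto simp: hspan_def)
      have "g * h = (\<Sum>\<alpha>\<in>S'. mps_const (p' \<alpha>) * (g * hprod \<alpha>))"
        by (simp only: h(2) sum_distrib_left mult.left_commute)
      then have "hall (G lam) (g * h) = (\<Sum>\<alpha>\<in>S'. p' \<alpha> * mps_coeff (?U lam r) \<alpha>)"
        by (simp add: hall_sum_right Lam_mult g hprod_Lam pairing[OF assms(3,4)])
      also have "\<dots> = hall (?U lam r) h"
        unfolding h(2) by (subst hall_sum_right) (simp_all add: hprod_Lam hall_hprod[OF sym] del: mps_coeff_hprod)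
      finally show ?thesis ..
    qed
    show "?U lam r \<in> Lam_hat \<and> (\<forall>h\<in>Lam. hall (?U lam r) h = hall (G lam) (g * h))"
      using hat eq by blast
    fix u assume u: "u \<in> Lam_hat \<and> (\<forall>h\<in>Lam. hall u h = hall (G lam) (g * h))"
    show "u = ?U lam r"
      by (rule symmetric_eqI_hall) (use u eq sym Lam_hat_symmetric in auto)
  qed
  finally show ?thesis .
qed

text \<open>For a positive part the binomial series sums to a skew entry directly. For a zero part
  the two binomial series give \<open>(1 - \<beta>/w)^-1\<close> with its tail cut off, that is a
  finite geometric combination of the later columns.\<close>

lemma entry_eq:
  assumes "mu \<in> Par" "j < r"
  shows "(\<Sum>n. mps_const ((zbinom (int (Suc i) - int (Suc j) + 1) (int n) - Delta r mu (Suc i) (Suc j) n) * beta ^ n) *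
      G_int (int (part lam (Suc i)) - int (part mu (Suc j)) - int (Suc i) + int (Suc j) + int n))
    = (\<Sum>k<r. HL beta (skew_entry lam mu i k) *
        mps_const (if part mu (Suc j) = 0 then (if j \<le> k then beta ^ (k - j) else 0) else if k = j then 1 else 0))"
    (is "(\<Sum>n. ?F n) = (\<Sum>k<r. ?R k)")
proof -
  define l m where "l = int (part lam (Suc i))" and "m = int (part mu (Suc j))"
  let ?a = "int i - int j + 1" and ?b = "l - m + 1"
  have s1: "(\<lambda>n. mps_const (zbinom ?a (int n) * beta ^ n) * G_int (l - m - int i + int j + int n))
    sums HL beta (\<lambda>k. Pc ?b (k + ?a - ?b))"
    using G_int_zbinom_sums[of ?a 0 ?b] by (simp add: algebra_simps)
  show ?thesis
  proof (cases "part mu (Suc j) = 0")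
    case False
    have F: "?F = (\<lambda>n. mps_const (zbinom ?a (int n) * beta ^ n) * G_int (l - m - int i + int j + int n))"
    proof
      fix n
      have "Delta r mu (Suc i) (Suc j) n = 0" using False by (simp add: Delta_def)
      moreover have "int (part lam (Suc i)) - int (part mu (Suc j)) - int (Suc i) + int (Suc j) + int n
        = l - m - int i + int j + int n" by (simp add: l_def m_def)
      moreover have "int (Suc i) - int (Suc j) + 1 = ?a" by simp
      ultimately show "?F n = mps_const (zbinom ?a (int n) * beta ^ n) * G_int (l - m - int i + int j + int n)"
        by (simp only: diff_zero)
    qed
    have "(\<Sum>n. ?F n) = HL beta (\<lambda>k. Pc ?b (k + ?a - ?b))"
      unfolding F by (rule sums_unique[OF s1, symmetric])
    also have "\<dots> = HL beta (skew_entry lam mu i j)"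
      using False by (intro HL_cong) (simp add: skew_entry_def l_def m_def algebra_simps)
    also have "\<dots> = (\<Sum>k<r. ?R k)"
      by (rule sum_eq_single[where a = j, symmetric]) (use False assms in auto)
    finally show ?thesis .
  next
    case True
    then have m: "m = 0" by (simp add: m_def)
    \<comment> \<open>With indices from 0 the lower entry of the binomial in \<open>Delta\<close> is
      \<open>n - (r - j)\<close>. These values give the same one-row index as the first series, and
      the same exponent \<open>l + 1\<close> of \<open>1 - \<beta> Y\<close>, so that the difference
      telescopes.\<close>
    let ?s = "r - j" and ?a' = "int (Suc i) - int r"
    have s2: "(\<lambda>n. mps_const (zbinom ?a' (int n - int ?s) * beta ^ n) * G_int (l + 1 - ?a' - int ?s + int n))
      sums (mps_const (beta ^ ?s) * HL beta (\<lambda>k. Pc (l + 1) (k + ?a' - (l + 1))))"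
      by (rule G_int_zbinom_sums)
    have F: "?F = (\<lambda>n. mps_const (zbinom ?a (int n) * beta ^ n) * G_int (l - m - int i + int j + int n)
      - mps_const (zbinom ?a' (int n - int ?s) * beta ^ n) * G_int (l + 1 - ?a' - int ?s + int n))"
    proof
      fix n
      have "Delta r mu (Suc i) (Suc j) n = zbinom ?a' (int n - int ?s)"
        using True assms by (simp add: Delta_def of_nat_diff algebra_simps)
      moreover have "l + 1 - ?a' - int ?s + int n = l - m - int i + int j + int n"
        using assms m by (simp add: of_nat_diff)
      moreover have "int (part lam (Suc i)) - int (part mu (Suc j)) - int (Suc i) + int (Suc j) + int n
        = l - m - int i + int j + int n" by (simp add: l_def m_def)
      moreover have "int (Suc i) - int (Suc j) + 1 = ?a" by simp
      ultimately show "?F n = mps_const (zbinom ?a (int n) * beta ^ n) * G_int (l - m - int i + int j + int n)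
        - mps_const (zbinom ?a' (int n - int ?s) * beta ^ n) * G_int (l + 1 - ?a' - int ?s + int n)"
        by (simp only: left_diff_distrib mps_const.hom_minus)
    qed
    have "(\<Sum>n. ?F n) = HL beta (\<lambda>k. Pc ?b (k + ?a - ?b)) - mps_const (beta ^ ?s) * HL beta (\<lambda>k. Pc (l + 1) (k + ?a' - (l + 1)))"
      unfolding F by (rule sums_unique[symmetric]) (rule mps_sums_diff[OF s1 s2])
    also have "\<dots> = HL beta (\<lambda>k. \<Sum>t\<le>r - Suc j. beta ^ t * Lrow lam i (k - int (Suc (j + t))))"
      unfolding HL_scale[symmetric] HL_diff[symmetric]
    proof (rule HL_cong)
      fix k
      let ?c = "int k + int i - int j - l"
      have s: "?s = Suc (r - Suc j)" using assms by simp
      have "Pc ?b (int k + ?a - ?b) - beta ^ ?s * Pc (l + 1) (int k + ?a' - (l + 1))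
        = Pc (l + 1) ?c - beta ^ Suc (r - Suc j) * Pc (l + 1) (?c - int (Suc (r - Suc j)))"
        using assms m unfolding s by (simp add: of_nat_diff algebra_simps)
      also have "\<dots> = (\<Sum>t\<le>r - Suc j. beta ^ t * Pc l (?c - int t))"
        by (rule Pc_telescope)
      also have "\<dots> = (\<Sum>t\<le>r - Suc j. beta ^ t * Lrow lam i (int k - int (Suc (j + t))))"
        by (intro sum.cong refl) (simp add: Lrow_def l_def algebra_simps)
      finally show "Pc ?b (int k + ?a - ?b) - beta ^ ?s * Pc (l + 1) (int k + ?a' - (l + 1))
        = (\<Sum>t\<le>r - Suc j. beta ^ t * Lrow lam i (int k - int (Suc (j + t))))" .
    qed
    also have "\<dots> = (\<Sum>t\<le>r - Suc j. mps_const (beta ^ t) * HL beta (\<lambda>k. Lrow lam i (k - int (Suc (j + t)))))"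
      by (simp only: HL_sum HL_scale)
    also have "\<dots> = (\<Sum>k\<in>{j..<r}. ?R k)"
    proof (rule sum.reindex_bij_witness[where i = "\<lambda>k. k - j" and j = "\<lambda>t. j + t"])
      \<comment> \<open>The zero parts form a final segment, so the later columns that enter are
        again plain powers of \<open>w\<close>.\<close>
      fix t assume t: "t \<in> {..r - Suc j}"
      have "part mu (Suc (j + t)) = 0"
        using True Par_part_decreasing[OF assms(1), of "Suc j" "Suc (j + t)"] by simp
      then have "skew_entry lam mu i (j + t) = (\<lambda>k. Lrow lam i (k - int (Suc (j + t))))"
        by (auto simp: skew_entry_def)
      then show "?R (j + t) = mps_const (beta ^ t) * HL beta (\<lambda>k. Lrow lam i (k - int (Suc (j + t))))"
        using True by (simp only: mult.commute) simp
    qed (use assms in auto)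
    also have "\<dots> = (\<Sum>k<r. ?R k)"
      by (rule sum.mono_neutral_left) (use True in auto)
    finally show ?thesis .
  qed
qed

theorem proposition4p3:
  fixes lam mu :: "nat list" and r :: nat
  assumes "lam \<in> Par" and "mu \<in> Par"
    and "r \<ge> 1" and "r \<ge> length lam" and "r \<ge> length mu"
  shows "skew_G lam mu =
    det (mat1 r (\<lambda>i j. \<Sum>n.
      mps_const ((zbinom (int i - int j + 1) (int n) - Delta r mu i j n) * beta ^ n) *
      G_int (int (part lam i) - int (part mu j) - int i + int j + int n)))"
proof -
  \<comment> \<open>The column operations: the identity in columns with a positive part, a truncated
    geometric series in the others. Only columns \<open>k \<ge> j\<close> enter column
    \<open>j\<close>, so the determinant is one.\<close>
  define T :: "nat \<Rightarrow> nat \<Rightarrow> K mps" where "T k j = mps_const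
    (if part mu (Suc j) = 0 then (if j \<le> k then beta ^ (k - j) else 0) else if k = j then 1 else 0)" for k j
  have "det (mat1 r (\<lambda>i j. \<Sum>n.
      mps_const ((zbinom (int i - int j + 1) (int n) - Delta r mu i j n) * beta ^ n) *
      G_int (int (part lam i) - int (part mu j) - int i + int j + int n)))
    = detf r (\<lambda>i j. \<Sum>k<r. HL beta (skew_entry lam mu i k) * T k j)"
    unfolding det_mat1 T_def by (rule detf_cong) (rule entry_eq[OF assms(2)])
  also have "\<dots> = detf r (\<lambda>i j. HL beta (skew_entry lam mu i j)) * detf r T"
    by (rule detf_mult)
  also have "detf r T = (\<Prod>i<r. T i i)"
    by (rule detf_lower_triangular) (auto simp: T_def)
  also have "\<dots> = 1"
    by (rule prod.neutral) (auto simp: T_def)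
  also have "detf r (\<lambda>i j. HL beta (skew_entry lam mu i j)) * 1 = skew_G lam mu"
    using skew_G_eq[OF assms(1,2,4,5)] by simp
  finally show ?thesis ..
qed

end
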